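(* Let $P$ be ergodic (not necessarily reversible) with stationary distribution $\pi$, and let $(X_n)_{n\ge0}$ be a stationary Markov chain with kernel $P$. Let $h\in L^1(\pi)$ with $\pi(h)=0$ and $S_n=\sum_{k=0}^{n-1}h(X_k)$. Define $r(x)=P(x,\{x\})$ and $q(x)=1-r(x)$. If $(S_n/\sqrt n)_{n\ge1}$ is bounded in probability, then $h=0$ on $\{q=0\}$ $\pi$-almost surely, and $$\int_{\{q>0\}}h(x)^2\frac{r(x)}{q(x)}\,\pi(dx)<\infty.$$ Consequently, $$\lim_{n\to\infty}n\,\mathbb E_\pi\big[h(X_0)^2r(X_0)^n\big]=0.$$ If $S_n/\sqrt n\Rightarrow\mathsf N(0,\sigma^2)$ for $0\le\sigma^2<\infty$, then also $$\int_{\{q>0\}}h(x)^2\frac{r(x)}{q(x)}\,\pi(dx)\le\sigma^2.$$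
   Context: $P$ is a Markov transition kernel on a Polish space $\mathcal X$ with its Borel sigma-algebra (so that $x\mapsto P(x,\{x\})$ is measurable), with stationary probability distribution $\pi$. Ergodic means $\phi$-irreducible and aperiodic. Stationary means $X_0\sim\pi$; $\mathbb E_\pi$ is expectation under $X_0\sim\pi$. Bounded in probability: $\lim_{N\to\infty}\sup_n\mathbb P(|S_n/\sqrt n|\ge N)=0$. $\Rightarrow$ is weak convergence, and $\mathsf N(0,0)$ is the point mass at $0$. *)

theory Defs
  imports "HOL-Probability.Probability"
begin

definition markov_kernel :: "('a::polish_space \<Rightarrow> 'a measure) \<Rightarrow> bool" where
  "markov_kernel P \<longleftrightarrow> P \<in> borel \<rightarrow>\<^sub>M prob_algebra borel"

definition stationary_distribution ::
    "('a::polish_space \<Rightarrow> 'a measure) \<Rightarrow> 'a measure \<Rightarrow> bool" where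
  "stationary_distribution P \<pi> \<longleftrightarrow> \<pi> \<in> space (prob_algebra borel) \<and> \<pi> \<bind> P = \<pi>"

primrec kernel_pow ::
    "('a::polish_space \<Rightarrow> 'a measure) \<Rightarrow> nat \<Rightarrow> 'a \<Rightarrow> 'a measure" where
  "kernel_pow P 0 x = return borel x"
| "kernel_pow P (Suc n) x = kernel_pow P n x \<bind> P"

definition phi_irreducible :: "('a::polish_space \<Rightarrow> 'a measure) \<Rightarrow> bool" where
  "phi_irreducible P \<longleftrightarrow>
    (\<exists>\<phi>. sets \<phi> = sets borel \<and> sigma_finite_measure \<phi> \<and> emeasure \<phi> UNIV > 0 \<and>
      (\<forall>x. \<forall>A\<in>sets borel. emeasure \<phi> A > 0 \<longrightarrow>
        (\<exists>n\<ge>1. emeasure (kernel_pow P n x) A > 0)))"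

text \<open>Aperiodicity relative to the stationary distribution: there is no cyclic decomposition
  \<open>D 0, \<dots>, D (d - 1)\<close> with \<open>d \<ge> 2\<close> that carries positive \<open>\<pi>\<close>-mass. Since \<open>\<pi>\<close> is stationary,
  positivity of \<open>\<pi>\<close> on \<open>D 0\<close> forces it on every \<open>D i\<close>.\<close>

definition aperiodic ::
    "('a::polish_space \<Rightarrow> 'a measure) \<Rightarrow> 'a measure \<Rightarrow> bool" where
  "aperiodic P \<pi> \<longleftrightarrow>
    \<not> (\<exists>d\<ge>2. \<exists>D :: nat \<Rightarrow> 'a set.
        (\<forall>i<d. D i \<in> sets borel) \<and> disjoint_family_on D {..<d} \<and>
        (\<forall>i<d. \<forall>x\<in>D i. emeasure (P x) (D (Suc i mod d)) = 1) \<and>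
        emeasure \<pi> (D 0) > 0)"

definition ergodic_kernel ::
    "('a::polish_space \<Rightarrow> 'a measure) \<Rightarrow> 'a measure \<Rightarrow> bool" where
  "ergodic_kernel P \<pi> \<longleftrightarrow> phi_irreducible P \<and> aperiodic P \<pi>"

definition natural_filtration ::
    "'w measure \<Rightarrow> (nat \<Rightarrow> 'w \<Rightarrow> 'a::polish_space) \<Rightarrow> nat \<Rightarrow> 'w measure" where
  "natural_filtration M X n =
    sigma (space M) (\<Union>i\<le>n. {X i -` A \<inter> space M | A. A \<in> sets borel})"

text \<open>The Markov property
  \<open>\<P>(X (Suc n) \<in> A | X 0, \<dots>, X n) = P (X n) A\<close> almost surely.\<close>

definition markov_chain ::
    "'w measure \<Rightarrow> ('a::polish_space \<Rightarrow> 'a measure) \<Rightarrow> (nat \<Rightarrow> 'w \<Rightarrow> 'a) \<Rightarrow> bool" where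
  "markov_chain M P X \<longleftrightarrow>
    prob_space M \<and> (\<forall>n. X n \<in> M \<rightarrow>\<^sub>M borel) \<and>
    (\<forall>n. \<forall>A\<in>sets borel. AE \<omega> in M.
      real_cond_exp M (natural_filtration M X n) (indicator (X (Suc n) -` A \<inter> space M)) \<omega>
        = measure (P (X n \<omega>)) A)"

definition stationary_markov_chain ::
    "'w measure \<Rightarrow> ('a::polish_space \<Rightarrow> 'a measure) \<Rightarrow> 'a measure \<Rightarrow>
      (nat \<Rightarrow> 'w \<Rightarrow> 'a) \<Rightarrow> bool" where
  "stationary_markov_chain M P \<pi> X \<longleftrightarrow> markov_chain M P X \<and> distr M borel (X 0) = \<pi>"

definition additive_functional ::
    "('a \<Rightarrow> real) \<Rightarrow> (nat \<Rightarrow> 'w \<Rightarrow> 'a) \<Rightarrow> nat \<Rightarrow> 'w \<Rightarrow> real" where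
  "additive_functional h X n \<omega> = (\<Sum>k<n. h (X k \<omega>))"

definition holding_prob :: "('a \<Rightarrow> 'a measure) \<Rightarrow> 'a \<Rightarrow> real" where
  "holding_prob P x = measure (P x) {x}"

definition moving_prob :: "('a \<Rightarrow> 'a measure) \<Rightarrow> 'a \<Rightarrow> real" where
  "moving_prob P x = 1 - holding_prob P x"

text \<open>For sequences indexed by \<open>n \<ge> 1\<close>; the value \<open>Y 0\<close> is ignored.\<close>

definition bounded_in_probability :: "'w measure \<Rightarrow> (nat \<Rightarrow> 'w \<Rightarrow> real) \<Rightarrow> bool" where
  "bounded_in_probability M Y \<longleftrightarrow>
    ((\<lambda>N::real. SUP n\<in>{1..}. measure M {\<omega> \<in> space M. \<bar>Y n \<omega>\<bar> \<ge> N}) \<longlongrightarrow> 0) at_top"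

text \<open>The second argument is the variance; \<open>normal_density\<close> takes the standard deviation and does
  not cover the degenerate case.\<close>

definition normal_law :: "real \<Rightarrow> real \<Rightarrow> real measure" where
  "normal_law m v =
    (if v = 0 then return borel m else density lborel (normal_density m (sqrt v)))"

end

theory Submission
  imports Defs
begin

text \<open>
  Fix a bounded measurable \<open>w\<close> and centre the holding indicators along the
  path, \<open>\<zeta>(X\<^sub>k, X\<^sub>k\<^sub>+\<^sub>1) = w(X\<^sub>k) (1[X\<^sub>k\<^sub>+\<^sub>1 = X\<^sub>k] - r(X\<^sub>k))\<close>. These are martingale differences; let \<open>Z\<^sub>n\<close> be
  their sum over \<open>k < n\<close>. Holding in a state and inserting a copy of that state into the path are the
  same operation up to a weight: for every functional \<open>F\<close> of the path,
  \<open>E[1[X\<^sub>k\<^sub>+\<^sub>1 = X\<^sub>k] F(X)] = E[r(X\<^sub>k) F(X with X\<^sub>k repeated)]\<close> (lemma \<open>hold_insertion\<close>). This turns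
  \<open>E[Z\<^sub>n F]\<close> into a sum of effects of inserting one extra step, a discrete integration by parts.

  Apply it to \<open>F = exp(i (t S\<^sub>n + s Z\<^sub>n) / \<surd>n)\<close> and let \<open>J\<^sub>n(s) = E F\<close>. Inserting a step at time \<open>k\<close>
  adds \<open>t h(X\<^sub>k) + s \<zeta>(X\<^sub>k, X\<^sub>k)\<close> to \<open>t S\<^sub>n + s Z\<^sub>n\<close> and pushes its last summand out of the window. By the
  \<open>L\<^sup>1\<close> ergodic theorem the first effect averages out to \<open>t c + s v\<close>, where, with \<open>q = 1 - r\<close>,
  \<open>c = \<integral> w r h d\<pi>\<close> and \<open>v = \<integral> w\<^sup>2 r q d\<pi>\<close>. The second effect tends to \<open>0\<close> because \<open>\<pi>(h) = 0\<close>: by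
  stationarity the last summand may be replaced by an average of many neighbouring summands
  (lemma \<open>end_term_bound\<close>). Hence \<open>J\<^sub>n'(s) = - (t c + s v) J\<^sub>n(s) + o(1)\<close>, locally uniformly in \<open>s\<close>
  (lemma \<open>uniform_derivative_error\<close>). Integrating, and using \<open>\<bar>J\<^sub>n(s)\<bar> \<le> 1\<close>,
  \<open>\<bar>E exp(i t S\<^sub>n / \<surd>n)\<bar> = \<bar>J\<^sub>n(0)\<bar> \<le> exp(t s c + s\<^sup>2 v / 2) + o(1)\<close> for every \<open>s\<close>.

  For \<open>w = h / q\<close>, restricted to a set on which \<open>\<bar>h\<bar>\<close> is bounded and \<open>q\<close> is bounded away from \<open>0\<close>,
  both \<open>c\<close> and \<open>v\<close> equal the integral of \<open>h\<^sup>2 r / q\<close> over that set, and the best choice is \<open>s = - t\<close>: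
  \<open>\<bar>E exp(i t S\<^sub>n / \<surd>n)\<bar> \<le> exp(- t\<^sup>2 v / 2) + o(1)\<close> (lemma \<open>char_additive_functional_bound\<close>). So \<open>S\<^sub>n / \<surd>n\<close>
  is at least as spread out as a Gaussian of variance \<open>v\<close>. A Gaussian limit of variance \<open>\<sigma>\<^sup>2\<close> forces
  \<open>v \<le> \<sigma>\<^sup>2\<close>; tightness keeps the left-hand side above \<open>1/2\<close> for one fixed \<open>t > 0\<close>, which bounds \<open>v\<close>.
  Letting the set grow to \<open>{q > 0}\<close> gives both claims about the integral. The claim on \<open>{q = 0}\<close>
  follows from irreducibility: the set where \<open>q = 0\<close> and \<open>h > 0\<close> is absorbing, hence of measure
  \<open>0\<close> or \<open>1\<close>, and measure \<open>1\<close> contradicts \<open>\<pi>(h) = 0\<close>; likewise for \<open>h < 0\<close>. The last limit is dominated convergence, since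
  \<open>n r\<^sup>n \<le> r / q\<close>.
\<close>

section \<open>Transition kernels and holding probabilities\<close>

lemma diagonal_measurable [measurable]: "{z :: 'a::polish_space \<times> 'a. fst z = snd z} \<in> sets (borel \<Otimes>\<^sub>M borel)"
proof -
  have "closed {z :: 'a::polish_space \<times> 'a. fst z = snd z}"
    by (intro closed_Collect_eq continuous_intros)
  then show ?thesis by (metis borel_closed borel_prod)
qed

lemma pred_eq_measurable [measurable (raw)]:
  fixes f g :: "'b \<Rightarrow> 'a::polish_space"
  assumes [measurable]: "f \<in> N \<rightarrow>\<^sub>M borel" "g \<in> N \<rightarrow>\<^sub>M borel"
  shows "Measurable.pred N (\<lambda>z. f z = g z)"
proof -
  have "Measurable.pred N (\<lambda>z. (f z, g z) \<in> {z :: 'a::polish_space \<times> 'a. fst z = snd z})"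
    by measurable
  then show ?thesis by simp
qed

locale markov_operator =
  fixes P :: "'a::polish_space \<Rightarrow> 'a measure" and \<pi> :: "'a measure"
  assumes kernel: "markov_kernel P"
    and stationary: "stationary_distribution P \<pi>"
begin

lemma P_measurable [measurable]: "P \<in> borel \<rightarrow>\<^sub>M prob_algebra borel"
  using kernel by (simp add: markov_kernel_def)

lemma P_subprob_measurable [measurable]: "P \<in> borel \<rightarrow>\<^sub>M subprob_algebra borel"
  by (rule measurable_prob_algebraD[OF P_measurable])

lemma P_in_prob_algebra: "P x \<in> space (prob_algebra borel)"
  using measurable_space[OF P_measurable, of x] by simp

lemma sets_P [simp, measurable_cong]: "sets (P x) = sets borel"
  using P_in_prob_algebra[of x] by (simp add: space_prob_algebra)

lemma space_P [simp]: "space (P x) = UNIV"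
  using sets_eq_imp_space_eq[OF sets_P[of x]] by simp

lemma prob_space_P: "prob_space (P x)"
  using P_in_prob_algebra[of x] by (simp add: space_prob_algebra)

lemma sets_pi [simp, measurable_cong]: "sets \<pi> = sets borel"
  using stationary by (simp add: stationary_distribution_def space_prob_algebra)

lemma space_pi [simp]: "space \<pi> = UNIV"
  using sets_eq_imp_space_eq[OF sets_pi] by simp

sublocale prob_space \<pi>
  using stationary by (simp add: stationary_distribution_def space_prob_algebra)

lemma bind_pi: "\<pi> \<bind> P = \<pi>"
  using stationary by (simp add: stationary_distribution_def)

lemma nn_integral_pi_P:
  assumes [measurable]: "u \<in> borel_measurable borel"
  shows "(\<integral>\<^sup>+x. \<integral>\<^sup>+y. u y \<partial>P x \<partial>\<pi>) = (\<integral>\<^sup>+x. u x \<partial>\<pi>)"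
proof -
  have "(\<integral>\<^sup>+x. u x \<partial>(\<pi> \<bind> P)) = (\<integral>\<^sup>+x. \<integral>\<^sup>+y. u y \<partial>P x \<partial>\<pi>)"
    by (rule nn_integral_bind[where B = borel]) measurable
  then show ?thesis by (simp add: bind_pi)
qed

lemma holding_prob_measurable [measurable]: "holding_prob P \<in> borel_measurable borel"
proof -
  have eq: "(SIGMA x:UNIV. {x::'a}) = {z. fst z = snd z}" by auto
  have "(\<lambda>x. measure (P x) {x}) \<in> borel_measurable borel"
    by (rule measure_measurable_prob_algebra2[where N = borel]) (use diagonal_measurable in \<open>simp_all add: eq\<close>)
  then show ?thesis by (simp add: holding_prob_def[abs_def])
qed

lemma holding_prob_nonneg [simp]: "0 \<le> holding_prob P x"
  and holding_prob_le_1 [simp]: "holding_prob P x \<le> 1"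
  using prob_space.prob_le_1[OF prob_space_P] by (auto simp: holding_prob_def)

lemma moving_prob_measurable [measurable]: "moving_prob P \<in> borel_measurable borel"
  unfolding moving_prob_def[abs_def] by measurable

lemma moving_prob_nonneg: "0 \<le> moving_prob P x"
  by (simp add: moving_prob_def)

lemma emeasure_P_self: "emeasure (P x) {x} = ennreal (holding_prob P x)"
  using finite_measure.emeasure_eq_measure[OF prob_space.finite_measure[OF prob_space_P]] by (simp add: holding_prob_def)

end

section \<open>The law of the path\<close>

abbreviation path_space :: "(nat \<Rightarrow> 'a::polish_space) measure" where
  "path_space \<equiv> PiM UNIV (\<lambda>_. borel)"

definition stop_at :: "nat \<Rightarrow> (nat \<Rightarrow> 'a) \<Rightarrow> nat \<Rightarrow> 'a" where
  "stop_at n \<xi> = (\<lambda>i. \<xi> (min i n))"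

definition continue_with :: "nat \<Rightarrow> (nat \<Rightarrow> 'a) \<Rightarrow> 'a \<Rightarrow> nat \<Rightarrow> 'a" where
  "continue_with n \<xi> y = (\<lambda>i. if i \<le> n then \<xi> i else y)"

text \<open>
  Coordinate \<open>k\<close> occurs twice, and everything after it is delayed by one time unit.
\<close>

definition insert_hold :: "nat \<Rightarrow> (nat \<Rightarrow> 'a) \<Rightarrow> nat \<Rightarrow> 'a" where
  "insert_hold k \<xi> = (\<lambda>i. if i \<le> k then \<xi> i else \<xi> (i - 1))"

definition shift_path :: "(nat \<Rightarrow> 'a) \<Rightarrow> nat \<Rightarrow> 'a" where
  "shift_path \<xi> = (\<lambda>i. \<xi> (Suc i))"

lemma path_map_measurable [measurable]:
  "stop_at n \<in> path_space \<rightarrow>\<^sub>M path_space"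
  "insert_hold k \<in> path_space \<rightarrow>\<^sub>M path_space"
  "shift_path \<in> path_space \<rightarrow>\<^sub>M path_space"
  unfolding stop_at_def[abs_def] insert_hold_def[abs_def] shift_path_def[abs_def]
  by (rule measurable_PiM_single'; simp; measurable)+

lemma continue_with_measurable [measurable]:
  "(\<lambda>(\<xi>, y). continue_with n \<xi> y) \<in> path_space \<Otimes>\<^sub>M borel \<rightarrow>\<^sub>M path_space"
  unfolding continue_with_def[abs_def] split_beta'
  by (rule measurable_PiM_single'; simp; measurable)

lemma stop_at_Suc:
  "stop_at (Suc n) \<xi> = continue_with n (stop_at n \<xi>) (\<xi> (Suc n))"
  by (rule ext) (auto simp: stop_at_def continue_with_def min_def not_le Suc_le_eq
    intro: arg_cong[where f = \<xi>])

lemma stop_at_apply [simp]: "i \<le> n \<Longrightarrow> stop_at n \<xi> i = \<xi> i"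
  by (simp add: stop_at_def min_def)

lemma continue_with_apply [simp]: "i \<le> n \<Longrightarrow> continue_with n \<xi> y i = \<xi> i"
  by (simp add: continue_with_def)

lemma shift_path_apply [simp]: "shift_path \<xi> i = \<xi> (Suc i)"
  by (simp add: shift_path_def)

text \<open>
  Stopped paths determine a path law, because every cylinder set depends on finitely many
  coordinates. The lower bound \<open>m\<close> on the stopping times leaves room for identities that make sense
  only once the path is longer than the coordinates that they mention.
\<close>

lemma path_law_eqI:
  fixes \<mu> \<nu> :: "(nat \<Rightarrow> 'a::polish_space) measure"
  assumes sets: "sets \<mu> = sets path_space" "sets \<nu> = sets path_space" and fin: "finite_measure \<mu>"
    and eq: "\<And>n G. n \<ge> m \<Longrightarrow> G \<in> borel_measurable path_space \<Longrightarrow>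
        (\<integral>\<^sup>+\<xi>. G (stop_at n \<xi>) \<partial>\<mu>) = (\<integral>\<^sup>+\<xi>. G (stop_at n \<xi>) \<partial>\<nu>)"
  shows "\<mu> = \<nu>"
proof (rule measure_eqI_PiM_infinite[OF sets _ fin])
  fix A :: "nat \<Rightarrow> 'a set" and J :: "nat set"
  assume J: "finite J" and A: "\<And>i. i \<in> J \<Longrightarrow> A i \<in> sets borel"
  let ?E = "prod_emb UNIV (\<lambda>_. borel) J (Pi\<^sub>E J A)"
  obtain n where n: "\<forall>i\<in>J. i \<le> n" using J finite_nat_set_iff_bounded_le by blast
  define k where "k = max n m"
  have [measurable]: "?E \<in> sets path_space"
    using J A by (intro sets_PiM_I) auto
  have stop: "stop_at k \<xi> i = \<xi> i" if "i \<in> J" for \<xi> :: "nat \<Rightarrow> 'a" and i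
    using n that by (auto simp: stop_at_def k_def min_def)
  have ind: "indicator ?E (stop_at k \<xi>) = (indicator ?E \<xi> :: ennreal)" for \<xi>
    by (auto simp: indicator_def prod_emb_def PiE_iff stop)
  have "emeasure \<mu> ?E = (\<integral>\<^sup>+\<xi>. indicator ?E (stop_at k \<xi>) \<partial>\<mu>)"
    using sets by (simp add: ind)
  also have "\<dots> = (\<integral>\<^sup>+\<xi>. indicator ?E (stop_at k \<xi>) \<partial>\<nu>)"
    by (rule eq) (auto simp: k_def)
  also have "\<dots> = emeasure \<nu> ?E"
    using sets by (simp add: ind)
  finally show "emeasure \<mu> ?E = emeasure \<nu> ?E" .
qed

locale stationary_chain = markov_operator P \<pi> for P :: "'a::polish_space \<Rightarrow> 'a measure" and \<pi> +
  fixes M :: "'w measure" and X :: "nat \<Rightarrow> 'w \<Rightarrow> 'a"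
  assumes chain: "stationary_markov_chain M P \<pi> X"
begin

sublocale M: prob_space M
  using chain by (simp add: stationary_markov_chain_def markov_chain_def)

lemma X_measurable [measurable]: "X n \<in> M \<rightarrow>\<^sub>M borel"
  using chain by (simp add: stationary_markov_chain_def markov_chain_def)

lemma distr_X0: "distr M borel (X 0) = \<pi>"
  using chain by (simp add: stationary_markov_chain_def)

definition path :: "'w \<Rightarrow> nat \<Rightarrow> 'a" where
  "path \<omega> = (\<lambda>i. X i \<omega>)"

lemma path_measurable [measurable]: "path \<in> M \<rightarrow>\<^sub>M path_space"
  unfolding path_def[abs_def] by (rule measurable_PiM_single') auto

lemma space_natural_filtration [simp]: "space (natural_filtration M X n) = space M"
  by (simp add: natural_filtration_def space_measure_of_conv)

lemma sets_natural_filtration: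
  "sets (natural_filtration M X n) =
    sigma_sets (space M) (\<Union>i\<le>n. {X i -` A \<inter> space M | A. A \<in> sets borel})"
  unfolding natural_filtration_def by (rule sets_measure_of) auto

lemma X_adapted: "i \<le> n \<Longrightarrow> X i \<in> natural_filtration M X n \<rightarrow>\<^sub>M borel"
  using measurable_space[OF X_measurable]
  by (intro measurableI) (auto simp: sets_natural_filtration intro!: sigma_sets.Basic)

lemma subalgebra_natural_filtration: "subalgebra M (natural_filtration M X n)"
  unfolding subalgebra_def sets_natural_filtration
  by (auto intro!: sets.sigma_sets_subset)

lemma stopped_path_adapted:
  "(\<lambda>\<omega>. stop_at n (path \<omega>)) \<in> natural_filtration M X n \<rightarrow>\<^sub>M path_space"
  unfolding stop_at_def path_def by (rule measurable_PiM_single') (auto intro!: X_adapted)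

text \<open>
  This is the defining property of the conditional probability, tested on events of the past. The
  past is encoded by the stopped path, so that it takes values in one space for all times.
\<close>

lemma markov_property_rectangle:
  assumes A: "A \<in> sets path_space" and B: "B \<in> sets borel"
  shows "emeasure M {\<omega> \<in> space M. stop_at n (path \<omega>) \<in> A \<and> X (Suc n) \<omega> \<in> B} =
    (\<integral>\<^sup>+\<omega>. indicator A (stop_at n (path \<omega>)) * emeasure (P (X n \<omega>)) B \<partial>M)"
proof -
  let ?F = "natural_filtration M X n"
  interpret F: finite_measure_subalgebra M ?F
    by unfold_locales (rule subalgebra_natural_filtration)
  define a where "a = (\<lambda>\<omega>. indicator A (stop_at n (path \<omega>)) :: real)"
  define b where "b = (indicator (X (Suc n) -` B \<inter> space M) :: _ \<Rightarrow> real)"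
  have a_F: "a \<in> borel_measurable ?F"
    unfolding a_def using stopped_path_adapted A by measurable
  have [measurable]: "A \<in> sets path_space" "B \<in> sets borel" by fact+
  have a_M [measurable]: "a \<in> borel_measurable M" unfolding a_def by measurable
  have b_M [measurable]: "b \<in> borel_measurable M" unfolding b_def by measurable
  have ab: "integrable M (\<lambda>\<omega>. a \<omega> * b \<omega>)"
    by (rule M.integrable_const_bound[of _ 1]) (auto simp: a_def b_def indicator_def)
  have cond: "AE \<omega> in M. real_cond_exp M ?F b \<omega> = measure (P (X n \<omega>)) B"
    using chain B by (auto simp: stationary_markov_chain_def markov_chain_def b_def)
  have "(\<integral>\<omega>. a \<omega> * b \<omega> \<partial>M) = (\<integral>\<omega>. a \<omega> * real_cond_exp M ?F b \<omega> \<partial>M)"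
    by (rule F.real_cond_exp_intg(2)[OF ab a_F b_M, symmetric])
  also have "\<dots> = (\<integral>\<omega>. a \<omega> * measure (P (X n \<omega>)) B \<partial>M)"
    using cond by (intro integral_cong_AE) auto
  finally have eq: "(\<integral>\<omega>. a \<omega> * b \<omega> \<partial>M) = (\<integral>\<omega>. a \<omega> * measure (P (X n \<omega>)) B \<partial>M)" .
  have "emeasure M {\<omega> \<in> space M. stop_at n (path \<omega>) \<in> A \<and> X (Suc n) \<omega> \<in> B}
      = (\<integral>\<^sup>+\<omega>. ennreal (a \<omega> * b \<omega>) \<partial>M)"
  proof -
    let ?D = "{\<omega> \<in> space M. stop_at n (path \<omega>) \<in> A \<and> X (Suc n) \<omega> \<in> B}"
    have "(\<integral>\<^sup>+\<omega>. ennreal (a \<omega> * b \<omega>) \<partial>M) = (\<integral>\<^sup>+\<omega>. indicator ?D \<omega> \<partial>M)"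
      by (intro nn_integral_cong) (auto simp: a_def b_def indicator_def)
    also have "\<dots> = emeasure M ?D"
      by (rule nn_integral_indicator) measurable
    finally show ?thesis by simp
  qed
  also have "\<dots> = ennreal (\<integral>\<omega>. a \<omega> * b \<omega> \<partial>M)"
    by (rule nn_integral_eq_integral[OF ab]) (auto simp: a_def b_def)
  also have "\<dots> = (\<integral>\<^sup>+\<omega>. ennreal (a \<omega> * measure (P (X n \<omega>)) B) \<partial>M)"
    unfolding eq
    by (rule nn_integral_eq_integral[symmetric], rule M.integrable_const_bound[of _ 1])
      (auto simp: a_def indicator_def prob_space.prob_le_1[OF prob_space_P])
  also have "\<dots> = (\<integral>\<^sup>+\<omega>. indicator A (stop_at n (path \<omega>)) * emeasure (P (X n \<omega>)) B \<partial>M)"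
    by (auto intro!: nn_integral_cong simp: a_def indicator_def
      finite_measure.emeasure_eq_measure[OF prob_space.finite_measure[OF prob_space_P]])
  finally show ?thesis .
qed

text \<open>
  Rectangles generate the product sigma-algebra, so the law of the pair (past, next state) is the
  past followed by one step of the kernel.
\<close>

lemma markov_property:
  assumes G [measurable]: "(\<lambda>(\<xi>, y). G \<xi> y) \<in> borel_measurable (path_space \<Otimes>\<^sub>M borel)"
  shows "(\<integral>\<^sup>+\<omega>. G (stop_at n (path \<omega>)) (X (Suc n) \<omega>) \<partial>M) =
    (\<integral>\<^sup>+\<omega>. \<integral>\<^sup>+y. G (stop_at n (path \<omega>)) y \<partial>P (X n \<omega>) \<partial>M)"
proof -
  define R where "R = distr M path_space (\<lambda>\<omega>. stop_at n (path \<omega>))"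
  interpret R: prob_space R unfolding R_def by (rule M.prob_space_distr) simp
  have [measurable_cong, simp]: "sets R = sets path_space" by (simp add: R_def)
  have spR [simp]: "space R = UNIV" by (simp add: R_def space_PiM)
  define L where "L = distr M (path_space \<Otimes>\<^sub>M borel) (\<lambda>\<omega>. (stop_at n (path \<omega>), X (Suc n) \<omega>))"
  define Q where "Q = R \<bind> (\<lambda>\<xi>. distr (P (\<xi> n)) (path_space \<Otimes>\<^sub>M borel) (Pair \<xi>))"
  have [measurable]: "(\<lambda>\<xi>. P (\<xi> n)) \<in> path_space \<rightarrow>\<^sub>M prob_algebra borel"
    by measurable
  have K [measurable]: "(\<lambda>\<xi>. distr (P (\<xi> n)) (path_space \<Otimes>\<^sub>M borel) (Pair \<xi>))
      \<in> path_space \<rightarrow>\<^sub>M prob_algebra (path_space \<Otimes>\<^sub>M borel)"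
    by (rule measurable_distr_prob_space2) measurable
  have K' [measurable]: "(\<lambda>\<xi>. distr (P (\<xi> n)) (path_space \<Otimes>\<^sub>M borel) (Pair \<xi>))
      \<in> R \<rightarrow>\<^sub>M subprob_algebra (path_space \<Otimes>\<^sub>M borel)"
    using measurable_prob_algebraD[OF K] by simp
  have nnQ: "(\<integral>\<^sup>+z. g z \<partial>Q) = (\<integral>\<^sup>+\<omega>. \<integral>\<^sup>+y. g (stop_at n (path \<omega>), y) \<partial>P (X n \<omega>) \<partial>M)"
    if [measurable]: "g \<in> borel_measurable (path_space \<Otimes>\<^sub>M borel)" for g
  proof -
    have "(\<integral>\<^sup>+z. g z \<partial>Q) = (\<integral>\<^sup>+\<xi>. \<integral>\<^sup>+z. g z \<partial>distr (P (\<xi> n)) (path_space \<Otimes>\<^sub>M borel) (Pair \<xi>) \<partial>R)"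
      unfolding Q_def by (rule nn_integral_bind[OF that K'])
    also have "\<dots> = (\<integral>\<^sup>+\<xi>. \<integral>\<^sup>+y. g (\<xi>, y) \<partial>P (\<xi> n) \<partial>R)"
      by (intro nn_integral_cong nn_integral_distr) (auto simp: space_PiM)
    also have "\<dots> = (\<integral>\<^sup>+\<omega>. \<integral>\<^sup>+y. g (stop_at n (path \<omega>), y) \<partial>P (stop_at n (path \<omega>) n) \<partial>M)"
      unfolding R_def
      by (rule nn_integral_distr) (auto intro!: nn_integral_measurable_subprob_algebra2[where N = borel])
    also have "\<dots> = (\<integral>\<^sup>+\<omega>. \<integral>\<^sup>+y. g (stop_at n (path \<omega>), y) \<partial>P (X n \<omega>) \<partial>M)"
      by (simp add: stop_at_def path_def)
    finally show ?thesis .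
  qed
  let ?E = "{A \<times> B | A B. A \<in> sets (path_space :: (nat \<Rightarrow> 'a) measure) \<and> B \<in> sets (borel :: 'a measure)}"
  have "L = Q"
  proof (rule measure_eqI_generator_eq[where
        E = ?E and A = "\<lambda>_. UNIV" and \<Omega> = UNIV])
    show "Int_stable ?E"
      using Int_stable_pair_measure_generator[of path_space borel] by simp
    have sQ: "sets Q = sets (path_space \<Otimes>\<^sub>M borel)"
      unfolding Q_def by (rule sets_bind) auto
    have g: "sets (path_space \<Otimes>\<^sub>M borel) = sigma_sets UNIV ?E"
      by (simp add: sets_pair_measure space_PiM)
    show "sets L = sigma_sets UNIV ?E"
      by (simp add: L_def g)
    show "sets Q = sigma_sets UNIV ?E"
      by (simp add: sQ g)
    show "range (\<lambda>_. UNIV) \<subseteq> ?E"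
      using sets.top[of "path_space :: (nat \<Rightarrow> 'a) measure"] by (auto simp: space_PiM intro!: exI[of _ UNIV])
    show "emeasure L UNIV \<noteq> \<infinity>"
    proof -
      interpret L: prob_space L unfolding L_def by (rule M.prob_space_distr) simp
      show ?thesis by simp
    qed
    fix C assume "C \<in> ?E"
    then obtain A B where C: "C = A \<times> B" and AB [measurable]: "A \<in> sets path_space" "B \<in> sets borel" by auto
    have "emeasure Q C = (\<integral>\<^sup>+z. indicator C z \<partial>Q)"
      using C sQ by (subst nn_integral_indicator) auto
    also have "\<dots> = (\<integral>\<^sup>+\<omega>. \<integral>\<^sup>+y. indicator C (stop_at n (path \<omega>), y) \<partial>P (X n \<omega>) \<partial>M)"
      by (rule nnQ) (auto simp: C)
    also have "\<dots> = (\<integral>\<^sup>+\<omega>. indicator A (stop_at n (path \<omega>)) * emeasure (P (X n \<omega>)) B \<partial>M)"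
      unfolding C indicator_times by (simp add: nn_integral_cmult)
    also have "\<dots> = emeasure L C"
      unfolding L_def C
      by (subst emeasure_distr) (auto simp: markov_property_rectangle[symmetric] intro!: arg_cong[where f = "emeasure M"])
    finally show "emeasure L C = emeasure Q C" by simp
  qed auto
  have "(\<integral>\<^sup>+\<omega>. G (stop_at n (path \<omega>)) (X (Suc n) \<omega>) \<partial>M) = (\<integral>\<^sup>+z. case_prod G z \<partial>L)"
    unfolding L_def by (subst nn_integral_distr) auto
  also have "\<dots> = (\<integral>\<^sup>+\<omega>. \<integral>\<^sup>+y. G (stop_at n (path \<omega>)) y \<partial>P (X n \<omega>) \<partial>M)"
    unfolding \<open>L = Q\<close> by (subst nnQ) auto
  finally show ?thesis .
qed

section \<open>Shifting the path and inserting a holding step\<close>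

lemma path_apply [simp]: "path \<omega> i = X i \<omega>"
  by (simp add: path_def)

lemma next_step_measurable [measurable]:
  fixes G :: "(nat \<Rightarrow> 'a) \<Rightarrow> ennreal"
  assumes [measurable]: "G \<in> borel_measurable path_space"
  shows "(\<lambda>\<xi>. \<integral>\<^sup>+y. G (continue_with n \<xi> y) \<partial>P (\<xi> n)) \<in> borel_measurable path_space"
proof (rule nn_integral_measurable_subprob_algebra2[where N = borel])
  have "(\<lambda>z. G (case_prod (continue_with n) z)) \<in> borel_measurable (path_space \<Otimes>\<^sub>M borel)"
    by measurable
  then show "(\<lambda>(\<xi>, y). G (continue_with n \<xi> y)) \<in> borel_measurable (path_space \<Otimes>\<^sub>M borel)"
    by (simp add: split_beta')
qed measurable

lemma next_step:
  assumes [measurable]: "G \<in> borel_measurable path_space"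
  shows "(\<integral>\<^sup>+\<omega>. G (stop_at (Suc n) (path \<omega>)) \<partial>M) =
    (\<integral>\<^sup>+\<omega>. \<integral>\<^sup>+y. G (continue_with n (stop_at n (path \<omega>)) y) \<partial>P (X n \<omega>) \<partial>M)"
proof -
  have "(\<lambda>z. G (case_prod (continue_with n) z)) \<in> borel_measurable (path_space \<Otimes>\<^sub>M borel)"
    by measurable
  then have "(\<lambda>(\<xi>, y). G (continue_with n \<xi> y)) \<in> borel_measurable (path_space \<Otimes>\<^sub>M borel)"
    by (simp add: split_beta')
  from markov_property[OF this, of n] show ?thesis
    by (simp add: stop_at_Suc)
qed

text \<open>
  Both sides grow by one transition of the same kernel from the same last state, so the identity
  propagates from one time to the next; at time \<open>0\<close> it is the stationarity of \<open>\<pi>\<close>.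
\<close>

lemma shift_stopped:
  assumes "G \<in> borel_measurable path_space"
  shows "(\<integral>\<^sup>+\<omega>. G (shift_path (stop_at (Suc n) (path \<omega>))) \<partial>M) = (\<integral>\<^sup>+\<omega>. G (stop_at n (path \<omega>)) \<partial>M)"
  using assms
proof (induction n arbitrary: G)
  case (0 G)
  note [measurable] = 0
  have [measurable]: "(\<lambda>y i. y) \<in> borel \<rightarrow>\<^sub>M (path_space :: (nat \<Rightarrow> 'a) measure)"
    by (rule measurable_PiM_single') auto
  have shift: "shift_path (continue_with 0 \<xi> y) = (\<lambda>_. y)" for \<xi> :: "nat \<Rightarrow> 'a" and y
    by (simp add: shift_path_def continue_with_def)
  have stop: "stop_at 0 (path \<omega>) = (\<lambda>_. X 0 \<omega>)" for \<omega>
    by (simp add: stop_at_def)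
  have "(\<integral>\<^sup>+\<omega>. G (shift_path (stop_at (Suc 0) (path \<omega>))) \<partial>M) = (\<integral>\<^sup>+\<omega>. \<integral>\<^sup>+y. G (\<lambda>_. y) \<partial>P (X 0 \<omega>) \<partial>M)"
    by (subst next_step) (auto simp: shift)
  also have "\<dots> = (\<integral>\<^sup>+x. \<integral>\<^sup>+y. G (\<lambda>_. y) \<partial>P x \<partial>\<pi>)"
    unfolding distr_X0[symmetric]
    by (subst nn_integral_distr) (auto intro!: nn_integral_measurable_subprob_algebra2[where N = borel])
  also have "\<dots> = (\<integral>\<^sup>+y. G (\<lambda>_. y) \<partial>\<pi>)"
    by (rule nn_integral_pi_P) measurable
  also have "\<dots> = (\<integral>\<^sup>+\<omega>. G (\<lambda>_. X 0 \<omega>) \<partial>M)"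
    unfolding distr_X0[symmetric] by (subst nn_integral_distr) auto
  finally show ?case unfolding stop .
next
  case (Suc n G)
  note [measurable] = Suc.prems
  define G' where "G' = (\<lambda>\<xi>. \<integral>\<^sup>+y. G (continue_with n \<xi> y) \<partial>P (\<xi> n))"
  have [measurable]: "G' \<in> borel_measurable path_space" unfolding G'_def by measurable
  have shift: "shift_path (continue_with (Suc n) \<xi> y) = continue_with n (shift_path \<xi>) y" for \<xi> :: "nat \<Rightarrow> 'a" and y
    by (auto simp: shift_path_def continue_with_def fun_eq_iff)
  have "(\<integral>\<^sup>+\<omega>. G (shift_path (stop_at (Suc (Suc n)) (path \<omega>))) \<partial>M)
      = (\<integral>\<^sup>+\<omega>. G' (shift_path (stop_at (Suc n) (path \<omega>))) \<partial>M)"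
    by (subst next_step) (auto simp: shift G'_def)
  also have "\<dots> = (\<integral>\<^sup>+\<omega>. G' (stop_at n (path \<omega>)) \<partial>M)"
    by (rule Suc.IH) measurable
  also have "\<dots> = (\<integral>\<^sup>+\<omega>. G (stop_at (Suc n) (path \<omega>)) \<partial>M)"
    by (subst next_step) (auto simp: G'_def)
  finally show ?case .
qed

lemma shift_law: "distr M path_space (\<lambda>\<omega>. shift_path (path \<omega>)) = distr M path_space path"
proof (rule path_law_eqI[where m = 0])
  show "finite_measure (distr M path_space (\<lambda>\<omega>. shift_path (path \<omega>)))"
    by (intro M.finite_measure_distr) measurable
  fix n :: nat and G :: "(nat \<Rightarrow> 'a) \<Rightarrow> ennreal"
  assume [measurable]: "G \<in> borel_measurable path_space"
  have "stop_at n (shift_path \<xi>) = shift_path (stop_at (Suc n) \<xi>)" for \<xi> :: "nat \<Rightarrow> 'a"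
    by (simp add: stop_at_def shift_path_def)
  then show "(\<integral>\<^sup>+\<xi>. G (stop_at n \<xi>) \<partial>distr M path_space (\<lambda>\<omega>. shift_path (path \<omega>)))
      = (\<integral>\<^sup>+\<xi>. G (stop_at n \<xi>) \<partial>distr M path_space path)"
    using shift_stopped[of G n] by (simp add: nn_integral_distr)
qed simp_all

abbreviation held :: "nat \<Rightarrow> 'w \<Rightarrow> real" where
  "held k \<omega> \<equiv> of_bool (X (Suc k) \<omega> = X k \<omega>)"

text \<open>
  Holding at time \<open>k\<close> has conditional probability \<open>r(X\<^sub>k)\<close>. Afterwards the chain sits in the same state
  one time unit later, and by the Markov property it continues as if the holding step had not
  happened. In the induction both sides make one further transition from the same state.
\<close>

lemma hold_insertion_stopped:
  assumes "G \<in> borel_measurable path_space" "k \<le> n"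
  shows "(\<integral>\<^sup>+\<omega>. ennreal (held k \<omega>) * G (stop_at (Suc n) (path \<omega>)) \<partial>M) =
    (\<integral>\<^sup>+\<omega>. ennreal (holding_prob P (X k \<omega>)) * G (insert_hold k (stop_at n (path \<omega>))) \<partial>M)"
  using assms(2,1)
proof (induction n arbitrary: G rule: dec_induct)
  case (base G)
  note [measurable] = base
  have cont: "continue_with k (stop_at k (path \<omega>)) (X k \<omega>) = insert_hold k (stop_at k (path \<omega>))" for \<omega>
    by (rule ext) (auto simp: continue_with_def stop_at_def insert_hold_def min_def
      intro!: arg_cong[where f = "\<lambda>i. X i \<omega>"])
  have "(\<integral>\<^sup>+\<omega>. ennreal (held k \<omega>) * G (stop_at (Suc k) (path \<omega>)) \<partial>M)
     = (\<integral>\<^sup>+\<omega>. (\<lambda>\<xi>. ennreal (of_bool (\<xi> (Suc k) = \<xi> k)) * G \<xi>) (stop_at (Suc k) (path \<omega>)) \<partial>M)"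
    by simp
  also have "\<dots> = (\<integral>\<^sup>+\<omega>. \<integral>\<^sup>+y. ennreal (of_bool (y = X k \<omega>)) *
      G (continue_with k (stop_at k (path \<omega>)) y) \<partial>P (X k \<omega>) \<partial>M)"
    by (subst next_step) (auto simp: continue_with_def)
  also have "\<dots> = (\<integral>\<^sup>+\<omega>. ennreal (holding_prob P (X k \<omega>)) * G (insert_hold k (stop_at k (path \<omega>))) \<partial>M)"
  proof (rule nn_integral_cong)
    fix \<omega>
    have "(\<integral>\<^sup>+y. ennreal (of_bool (y = X k \<omega>)) * G (continue_with k (stop_at k (path \<omega>)) y) \<partial>P (X k \<omega>))
      = (\<integral>\<^sup>+y. G (insert_hold k (stop_at k (path \<omega>))) * indicator {X k \<omega>} y \<partial>P (X k \<omega>))"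
      by (intro nn_integral_cong) (auto simp: cont[symmetric] indicator_def)
    also have "\<dots> = G (insert_hold k (stop_at k (path \<omega>))) * emeasure (P (X k \<omega>)) {X k \<omega>}"
      by (rule nn_integral_cmult_indicator) simp
    finally show "(\<integral>\<^sup>+y. ennreal (of_bool (y = X k \<omega>)) * G (continue_with k (stop_at k (path \<omega>)) y) \<partial>P (X k \<omega>))
      = ennreal (holding_prob P (X k \<omega>)) * G (insert_hold k (stop_at k (path \<omega>)))"
      by (simp add: emeasure_P_self mult.commute)
  qed
  finally show ?case .
next
  case (step n G)
  note [measurable] = step.prems
  define G' where "G' = (\<lambda>\<xi>. \<integral>\<^sup>+y. G (continue_with (Suc n) \<xi> y) \<partial>P (\<xi> (Suc n)))"
  have [measurable]: "G' \<in> borel_measurable path_space" unfolding G'_def by measurable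
  have comm: "continue_with (Suc n) (insert_hold k \<xi>) y = insert_hold k (continue_with n \<xi> y)"
    for \<xi> :: "nat \<Rightarrow> 'a" and y
    using \<open>k \<le> n\<close> by (auto simp: continue_with_def insert_hold_def fun_eq_iff)
  have pull_P: "(\<integral>\<^sup>+y. c * f y \<partial>P x) = c * (\<integral>\<^sup>+y. f y \<partial>P x)" if "f \<in> borel_measurable borel"
    for c :: ennreal and f x
    using that by (intro nn_integral_cmult) simp
  have cw: "(\<lambda>y. G (continue_with m \<xi> y)) \<in> borel_measurable borel" for m \<xi>
  proof -
    have "(\<lambda>y. case_prod (continue_with m) (\<xi>, y)) \<in> borel \<rightarrow>\<^sub>M path_space"
      by (rule measurable_compose[OF _ continue_with_measurable]) (simp add: space_PiM)
    then show ?thesis by (auto intro!: measurable_compose[OF _ step.prems])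
  qed
  have ih: "(\<lambda>y. G (insert_hold k (continue_with m \<xi> y))) \<in> borel_measurable borel" for m \<xi>
  proof -
    have "(\<lambda>y. case_prod (continue_with m) (\<xi>, y)) \<in> borel \<rightarrow>\<^sub>M path_space"
      by (rule measurable_compose[OF _ continue_with_measurable]) (simp add: space_PiM)
    then show ?thesis by (auto intro!: measurable_compose[OF _ step.prems])
  qed
  have "(\<integral>\<^sup>+\<omega>. ennreal (held k \<omega>) * G (stop_at (Suc (Suc n)) (path \<omega>)) \<partial>M)
     = (\<integral>\<^sup>+\<omega>. (\<lambda>\<xi>. ennreal (of_bool (\<xi> (Suc k) = \<xi> k)) * G \<xi>) (stop_at (Suc (Suc n)) (path \<omega>)) \<partial>M)"
    using \<open>k \<le> n\<close> by simp
  also have "\<dots> = (\<integral>\<^sup>+\<omega>. \<integral>\<^sup>+y. ennreal (held k \<omega>) *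
      G (continue_with (Suc n) (stop_at (Suc n) (path \<omega>)) y) \<partial>P (X (Suc n) \<omega>) \<partial>M)"
    using \<open>k \<le> n\<close> by (subst next_step) auto
  also have "\<dots> = (\<integral>\<^sup>+\<omega>. ennreal (held k \<omega>) * G' (stop_at (Suc n) (path \<omega>)) \<partial>M)"
    by (simp add: G'_def pull_P cw)
  also have "\<dots> = (\<integral>\<^sup>+\<omega>. ennreal (holding_prob P (X k \<omega>)) * G' (insert_hold k (stop_at n (path \<omega>))) \<partial>M)"
    by (rule step.IH) measurable
  also have "\<dots> = (\<integral>\<^sup>+\<omega>. \<integral>\<^sup>+y. ennreal (holding_prob P (X k \<omega>)) *
      G (insert_hold k (continue_with n (stop_at n (path \<omega>)) y)) \<partial>P (X n \<omega>) \<partial>M)"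
    using \<open>k \<le> n\<close> by (simp add: G'_def comm pull_P ih) (simp add: insert_hold_def)
  also have "\<dots> = (\<integral>\<^sup>+\<omega>. (\<lambda>\<xi>. ennreal (holding_prob P (\<xi> k)) * G (insert_hold k \<xi>)) (stop_at (Suc n) (path \<omega>)) \<partial>M)"
    using \<open>k \<le> n\<close> by (subst next_step) auto
  also have "\<dots> = (\<integral>\<^sup>+\<omega>. ennreal (holding_prob P (X k \<omega>)) * G (insert_hold k (stop_at (Suc n) (path \<omega>))) \<partial>M)"
    using \<open>k \<le> n\<close> by simp
  finally show ?case .
qed

lemma hold_insertion_law:
  "distr (density M (held k)) path_space path =
   distr (density M (\<lambda>\<omega>. holding_prob P (X k \<omega>))) path_space (\<lambda>\<omega>. insert_hold k (path \<omega>))"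
proof (rule path_law_eqI[where m = "Suc k"])
  have "finite_measure (density M (held k))"
  proof (rule finite_measureI)
    have "emeasure (density M (held k)) (space M) = (\<integral>\<^sup>+\<omega>. ennreal (held k \<omega>) \<partial>M)"
      by (subst emeasure_density) (auto intro!: nn_integral_cong)
    also have "\<dots> \<le> (\<integral>\<^sup>+\<omega>. 1 \<partial>M)" by (intro nn_integral_mono) auto
    finally show "emeasure (density M (held k)) (space (density M (held k))) \<noteq> \<infinity>"
      by (auto simp: M.emeasure_space_1 top_unique)
  qed
  then show "finite_measure (distr (density M (held k)) path_space path)"
    by (rule finite_measure.finite_measure_distr) simp
  fix n and G :: "(nat \<Rightarrow> 'a) \<Rightarrow> ennreal"
  assume "Suc k \<le> n" and [measurable]: "G \<in> borel_measurable path_space"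
  then obtain m where n: "n = Suc m" and "k \<le> m" by (cases n) auto
  have "stop_at (Suc m) (insert_hold k \<xi>) = insert_hold k (stop_at m \<xi>)" for \<xi> :: "nat \<Rightarrow> 'a"
    using \<open>k \<le> m\<close> by (auto simp: stop_at_def insert_hold_def fun_eq_iff min_def)
  then show "(\<integral>\<^sup>+\<xi>. G (stop_at n \<xi>) \<partial>distr (density M (held k)) path_space path) =
    (\<integral>\<^sup>+\<xi>. G (stop_at n \<xi>) \<partial>distr (density M (\<lambda>\<omega>. holding_prob P (X k \<omega>)))
      path_space (\<lambda>\<omega>. insert_hold k (path \<omega>)))"
    using hold_insertion_stopped[of G k m] \<open>k \<le> m\<close>
    by (simp add: nn_integral_distr nn_integral_density n)
qed simp_all

text \<open>
  The integration by parts behind the whole proof: a factor that detects holding is traded for the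
  insertion of an additional step.
\<close>

lemma hold_insertion:
  fixes F :: "(nat \<Rightarrow> 'a) \<Rightarrow> 'b::{banach, second_countable_topology}"
  assumes [measurable]: "F \<in> borel_measurable path_space"
  shows "(\<integral>\<omega>. held k \<omega> *\<^sub>R F (path \<omega>) \<partial>M) =
    (\<integral>\<omega>. holding_prob P (X k \<omega>) *\<^sub>R F (insert_hold k (path \<omega>)) \<partial>M)"
proof -
  have "(\<integral>\<omega>. held k \<omega> *\<^sub>R F (path \<omega>) \<partial>M) = (\<integral>\<xi>. F \<xi> \<partial>distr (density M (held k)) path_space path)"
    by (simp add: integral_distr integral_density)
  also have "\<dots> = (\<integral>\<omega>. holding_prob P (X k \<omega>) *\<^sub>R F (insert_hold k (path \<omega>)) \<partial>M)"
    unfolding hold_insertion_law by (simp add: integral_distr integral_density)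
  finally show ?thesis .
qed

lemma shift_integral:
  fixes F :: "(nat \<Rightarrow> 'a) \<Rightarrow> 'b::{banach, second_countable_topology}"
  assumes [measurable]: "F \<in> borel_measurable path_space"
  shows "(\<integral>\<omega>. F (shift_path (path \<omega>)) \<partial>M) = (\<integral>\<omega>. F (path \<omega>) \<partial>M)"
proof -
  have "(\<integral>\<omega>. F (shift_path (path \<omega>)) \<partial>M) = (\<integral>\<xi>. F \<xi> \<partial>distr M path_space (\<lambda>\<omega>. shift_path (path \<omega>)))"
    by (simp add: integral_distr)
  also have "\<dots> = (\<integral>\<omega>. F (path \<omega>) \<partial>M)"
    unfolding shift_law by (simp add: integral_distr)
  finally show ?thesis .
qed

lemma distr_X: "distr M borel (X n) = \<pi>"
proof (induction n)
  case (Suc n)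
  have "distr M borel (X (Suc n)) = distr (distr M path_space (\<lambda>\<omega>. shift_path (path \<omega>))) borel (\<lambda>\<xi>. \<xi> n)"
    by (subst distr_distr) (auto simp: comp_def)
  also have "\<dots> = distr M borel (X n)"
    unfolding shift_law by (subst distr_distr) (auto simp: comp_def)
  finally show ?case using Suc by simp
qed (rule distr_X0)

end

section \<open>The zero-one law and the ergodic theorem for the transition operator\<close>

lemma limsup_le_perturb:
  fixes a b e :: "nat \<Rightarrow> ennreal"
  assumes "\<And>n. a n \<le> b n + e n" "e \<longlonglongrightarrow> 0"
  shows "limsup a \<le> limsup b"
proof (rule ennreal_le_epsilon)
  fix r :: real assume "0 < r"
  have "eventually (\<lambda>n. e n < ennreal r) sequentially"
    using assms(2) \<open>0 < r\<close> by (intro order_tendstoD) auto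
  then have "eventually (\<lambda>n. a n \<le> ennreal r + b n) sequentially"
    by eventually_elim (use assms(1) in \<open>metis add.commute add_left_mono less_imp_le order_trans\<close>)
  then have "limsup a \<le> limsup (\<lambda>n. ennreal r + b n)" by (rule Limsup_mono)
  also have "\<dots> = ennreal r + limsup b" by (rule Limsup_const_add) simp
  finally show "limsup a \<le> limsup b + ennreal r" by (simp add: add.commute)
qed

context markov_operator
begin

lemma kernel_pow_measurable [measurable]: "kernel_pow P n \<in> borel \<rightarrow>\<^sub>M prob_algebra borel"
proof (induction n)
  case 0
  have "kernel_pow P 0 = return borel" by (rule ext) simp
  then show ?case by simp
next
  case (Suc n)
  have "kernel_pow P (Suc n) = (\<lambda>x. kernel_pow P n x \<bind> P)" by (rule ext) simp
  then show ?case by (simp add: measurable_bind_prob_space[OF Suc P_measurable])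
qed

lemma kernel_pow_subprob_measurable [measurable]: "kernel_pow P n \<in> borel \<rightarrow>\<^sub>M subprob_algebra borel"
  by (rule measurable_prob_algebraD[OF kernel_pow_measurable])

lemma kernel_pow_in_prob_algebra: "kernel_pow P n x \<in> space (prob_algebra borel)"
  using measurable_space[OF kernel_pow_measurable, of x n] by simp

lemma sets_kernel_pow [simp, measurable_cong]: "sets (kernel_pow P n x) = sets borel"
  using kernel_pow_in_prob_algebra[of n x] by (simp add: space_prob_algebra)

lemma space_kernel_pow [simp]: "space (kernel_pow P n x) = UNIV"
  using sets_eq_imp_space_eq[OF sets_kernel_pow[of n x]] by simp

lemma nn_integral_pi_kernel_pow:
  assumes "u \<in> borel_measurable borel"
  shows "(\<integral>\<^sup>+x. \<integral>\<^sup>+y. u y \<partial>kernel_pow P n x \<partial>\<pi>) = (\<integral>\<^sup>+x. u x \<partial>\<pi>)"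
  using assms
proof (induction n arbitrary: u)
  case 0
  then show ?case by (simp add: nn_integral_return)
next
  case (Suc n u)
  note [measurable] = Suc.prems
  have "(\<integral>\<^sup>+x. \<integral>\<^sup>+y. u y \<partial>kernel_pow P (Suc n) x \<partial>\<pi>) =
      (\<integral>\<^sup>+x. \<integral>\<^sup>+y. (\<integral>\<^sup>+z. u z \<partial>P y) \<partial>kernel_pow P n x \<partial>\<pi>)"
    by (simp add: nn_integral_bind[where B = borel])
  also have "\<dots> = (\<integral>\<^sup>+y. (\<integral>\<^sup>+z. u z \<partial>P y) \<partial>\<pi>)"
    by (rule Suc.IH) measurable
  also have "\<dots> = (\<integral>\<^sup>+z. u z \<partial>\<pi>)" by (rule nn_integral_pi_P) measurable
  finally show ?case .
qed

lemma emeasure_kernel_pow_Suc: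
  assumes "A \<in> sets borel"
  shows "emeasure (kernel_pow P (Suc n) x) A = (\<integral>\<^sup>+y. emeasure (P y) A \<partial>kernel_pow P n x)"
  using assms by (simp add: emeasure_bind[where N = borel])

text \<open>
  The exceptional states, which belong to the set but may leave it, are \<open>\<pi>\<close>-null. By stationarity almost
  every starting point never meets them, so almost every starting point in the set stays there.
\<close>

lemma closed_set_confines:
  assumes A [measurable]: "A \<in> sets borel"
    and closed: "AE x in \<pi>. x \<in> A \<longrightarrow> emeasure (P x) (- A) = 0"
  shows "AE x in \<pi>. x \<in> A \<longrightarrow> (\<forall>n. emeasure (kernel_pow P n x) (- A) = 0)"
proof -
  define N where "N = {x \<in> A. emeasure (P x) (- A) \<noteq> 0}"
  have [measurable]: "- A \<in> sets borel" by (simp add: sets.compl_sets[of _ borel, simplified] Compl_eq_Diff_UNIV)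
  have [measurable]: "(\<lambda>x. emeasure (P x) (- A)) \<in> borel_measurable borel" by measurable
  have N [measurable]: "N \<in> sets borel" unfolding N_def by measurable
  have "AE x in \<pi>. x \<notin> N" using closed by eventually_elim (auto simp: N_def)
  then have "emeasure \<pi> N = 0"
    by (simp add: AE_iff_null_sets[symmetric] null_sets_def)
  then have "(\<integral>\<^sup>+x. emeasure (kernel_pow P n x) N \<partial>\<pi>) = 0" for n
    using nn_integral_pi_kernel_pow[of "indicator N" n] by simp
  then have "AE x in \<pi>. emeasure (kernel_pow P n x) N = 0" for n
    by (subst (asm) nn_integral_0_iff_AE) auto
  then have "AE x in \<pi>. \<forall>n. emeasure (kernel_pow P n x) N = 0"
    by (simp add: AE_all_countable)
  then show ?thesis
  proof eventually_elim
    case (elim x)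
    have "emeasure (kernel_pow P n x) (- A) = 0" if "x \<in> A" for n
    proof (induction n)
      case 0
      then show ?case using that by simp
    next
      case (Suc n)
      have "AE y in kernel_pow P n x. y \<notin> N"
        using elim by (intro AE_not_in) (simp add: null_sets_def)
      moreover have "AE y in kernel_pow P n x. y \<notin> - A"
        using Suc by (intro AE_not_in) (simp add: null_sets_def)
      ultimately have "AE y in kernel_pow P n x. emeasure (P y) (- A) = 0"
        by eventually_elim (auto simp: N_def)
      then show ?case
        by (subst emeasure_kernel_pow_Suc) (auto simp: nn_integral_0_iff_AE)
    qed
    then show ?case by simp
  qed
qed

text \<open>
  The complement of an almost surely closed set is almost surely closed as well, because \<open>\<pi>\<close> does not
  change in one step. If both had positive measure, each would contain a point from which the other
  is unreachable; the irreducibility measure would then vanish on both.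
\<close>

lemma zero_one_law:
  assumes irr: "phi_irreducible P"
    and A [measurable]: "A \<in> sets borel"
    and closed: "AE x in \<pi>. x \<in> A \<longrightarrow> emeasure (P x) (- A) = 0"
  shows "(AE x in \<pi>. x \<in> A) \<or> (AE x in \<pi>. x \<notin> A)"
proof (rule ccontr)
  assume "\<not> ?thesis"
  then have nA: "\<not> (AE x in \<pi>. x \<in> A)" and nB: "\<not> (AE x in \<pi>. x \<notin> A)" by auto
  have [measurable]: "- A \<in> sets borel" by (simp add: sets.compl_sets[of _ borel, simplified] Compl_eq_Diff_UNIV)
  have [measurable]: "(\<lambda>x. emeasure (P x) A) \<in> borel_measurable borel"
     "(\<lambda>x. emeasure (P x) (- A)) \<in> borel_measurable borel" by measurable
  have "(\<integral>\<^sup>+x. emeasure (P x) (- A) \<partial>\<pi>) = emeasure \<pi> (- A)"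
    using nn_integral_pi_P[of "indicator (- A)"] by simp
  moreover have "(\<integral>\<^sup>+x. emeasure (P x) (- A) \<partial>\<pi>) = (\<integral>\<^sup>+x. emeasure (P x) (- A) * indicator (- A) x \<partial>\<pi>)"
    using closed by (intro nn_integral_cong_AE) (auto elim!: AE_mp simp: indicator_def)
  moreover have "(\<integral>\<^sup>+x. indicator (- A) x \<partial>\<pi>) =
      (\<integral>\<^sup>+x. emeasure (P x) (- A) * indicator (- A) x + emeasure (P x) A * indicator (- A) x \<partial>\<pi>)"
  proof (rule nn_integral_cong)
    fix x
    have "emeasure (P x) (- A) + emeasure (P x) A = 1"
      using prob_space.emeasure_space_1[OF prob_space_P, of x]
      by (subst plus_emeasure) auto
    then show "indicator (- A) x = emeasure (P x) (- A) * indicator (- A) x + emeasure (P x) A * indicator (- A) x"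
      by (simp add: indicator_def)
  qed
  ultimately have "emeasure \<pi> (- A) = emeasure \<pi> (- A) + (\<integral>\<^sup>+x. emeasure (P x) A * indicator (- A) x \<partial>\<pi>)"
    by (simp add: nn_integral_add)
  then have "(\<integral>\<^sup>+x. emeasure (P x) A * indicator (- A) x \<partial>\<pi>) = 0"
    using emeasure_finite[of "- A"] by (metis add.right_neutral ennreal_add_left_cancel infinity_ennreal_def)
  then have "AE x in \<pi>. emeasure (P x) A * indicator (- A) x = 0"
    by (subst (asm) nn_integral_0_iff_AE) auto
  then have closed': "AE x in \<pi>. x \<in> - A \<longrightarrow> emeasure (P x) (- (- A)) = 0"
    by eventually_elim (auto simp: indicator_def)
  obtain \<phi> where \<phi>: "sets \<phi> = sets borel" "emeasure \<phi> UNIV > 0"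
    "\<And>x A. A \<in> sets borel \<Longrightarrow> emeasure \<phi> A > 0 \<Longrightarrow> \<exists>n\<ge>1. emeasure (kernel_pow P n x) A > 0"
    using irr unfolding phi_irreducible_def by metis
  have "\<exists>x. \<forall>n. emeasure (kernel_pow P n x) (- A) = 0"
  proof (rule ccontr)
    assume "\<not> ?thesis"
    then have "AE x in \<pi>. x \<notin> A"
      using closed_set_confines[OF A closed] by (auto elim!: eventually_mono)
    then show False using nB by simp
  qed
  then have 1: "emeasure \<phi> (- A) = 0" using \<phi>(3)[of "- A"] by (metis \<open>- A \<in> sets borel\<close> not_gr_zero)
  have "\<exists>x. \<forall>n. emeasure (kernel_pow P n x) A = 0"
  proof (rule ccontr)
    assume "\<not> ?thesis"
    then have "AE x in \<pi>. x \<in> A"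
      using closed_set_confines[OF _ closed'] by (auto elim!: eventually_mono)
    then show False using nA by simp
  qed
  then have 2: "emeasure \<phi> A = 0" using \<phi>(3)[OF A] by (metis not_gr_zero)
  have "emeasure \<phi> UNIV = emeasure \<phi> (A \<union> - A)" by simp
  also have "\<dots> \<le> emeasure \<phi> A + emeasure \<phi> (- A)"
    using \<phi>(1) by (intro emeasure_subadditive) auto
  finally show False using 1 2 \<phi>(2) by simp
qed

text \<open>
  If \<open>v \<le> P v\<close>, then \<open>u = (v - c)\<^sup>+\<close> satisfies \<open>u \<le> P u\<close> too, and equality holds almost surely because both
  sides have the same integral. So from a point with \<open>v \<le> c\<close> the chain cannot reach \<open>{v > c}\<close>: every
  sublevel set is almost surely closed, and the zero-one law applies. The subtraction of \<open>ennreal\<close>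
  is truncated at \<open>0\<close>, which makes \<open>v x - c\<close> the positive part.
\<close>

lemma subinvariant_trivial:
  fixes v :: "'a \<Rightarrow> ennreal"
  assumes irr: "phi_irreducible P"
    and v [measurable]: "v \<in> borel_measurable borel" and C: "\<And>x. v x \<le> C" "C < \<infinity>"
    and sub: "\<And>x. v x \<le> (\<integral>\<^sup>+y. v y \<partial>P x)" and c: "c < \<infinity>"
  shows "(AE x in \<pi>. v x \<le> c) \<or> (AE x in \<pi>. c < v x)"
proof -
  define u where "u = (\<lambda>x. v x - c)"
  have [measurable]: "u \<in> borel_measurable borel" unfolding u_def by measurable
  have subu: "u x \<le> (\<integral>\<^sup>+y. u y \<partial>P x)" for x
  proof -
    have "v y \<le> u y + c" for y
      unfolding u_def
      by (cases "c \<le> v y") (auto simp: diff_add_cancel_ennreal intro: order_trans[of _ c])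
    then have "v x \<le> (\<integral>\<^sup>+y. u y + c \<partial>P x)"
      by (rule order_trans[OF sub nn_integral_mono])
    also have "\<dots> = (\<integral>\<^sup>+y. u y \<partial>P x) + c"
      using prob_space.emeasure_space_1[OF prob_space_P, of x] by (subst nn_integral_add) auto
    finally show ?thesis using c unfolding u_def by (auto simp: ennreal_minus_le_iff add.commute)
  qed
  have uC: "u x \<le> C" for x
    unfolding u_def using C(1)[of x] by (meson diff_le_self_ennreal order_trans)
  have fin: "(\<integral>\<^sup>+x. u x \<partial>\<pi>) < \<infinity>"
  proof -
    have "(\<integral>\<^sup>+x. u x \<partial>\<pi>) \<le> (\<integral>\<^sup>+x. C \<partial>\<pi>)" by (intro nn_integral_mono uC)
    also have "\<dots> = C" using emeasure_space_1 by simp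
    finally show ?thesis using C(2) by (rule order.strict_trans1)
  qed
  have "(\<integral>\<^sup>+x. (\<integral>\<^sup>+y. u y \<partial>P x) - u x \<partial>\<pi>) = (\<integral>\<^sup>+x. \<integral>\<^sup>+y. u y \<partial>P x \<partial>\<pi>) - (\<integral>\<^sup>+x. u x \<partial>\<pi>)"
    using fin subu by (intro nn_integral_diff) auto
  also have "\<dots> = 0" using fin by (simp add: nn_integral_pi_P)
  finally have "AE x in \<pi>. (\<integral>\<^sup>+y. u y \<partial>P x) - u x = 0"
    by (subst (asm) nn_integral_0_iff_AE) auto
  then have closed: "AE x in \<pi>. x \<in> {x. v x \<le> c} \<longrightarrow> emeasure (P x) (- {x. v x \<le> c}) = 0"
  proof eventually_elim
    case (elim x)
    show ?case
    proof
      assume "x \<in> {x. v x \<le> c}"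
      then have "u x = 0"
        using c by (auto simp: u_def intro!: diff_eq_0_ennreal elim: order.strict_trans1)
      then have "(\<integral>\<^sup>+y. u y \<partial>P x) = 0" using elim by simp
      then have "AE y in P x. u y = 0" by (subst (asm) nn_integral_0_iff_AE) auto
      then have "AE y in P x. v y \<le> c"
        by eventually_elim (use c in \<open>auto simp: u_def diff_eq_0_iff_ennreal\<close>)
      then have "emeasure (P x) {y \<in> space (P x). \<not> v y \<le> c} = 0"
        by (subst (asm) AE_iff_measurable[OF _ refl]) auto
      then show "emeasure (P x) (- {x. v x \<le> c}) = 0" by (simp add: Compl_eq)
    qed
  qed
  have "{x. v x \<le> c} \<in> sets borel" by measurable
  from zero_one_law[OF irr this closed] show ?thesis by (auto simp: not_le)
qed

definition kernel_op :: "('a \<Rightarrow> real) \<Rightarrow> 'a \<Rightarrow> real" where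
  "kernel_op u x = (\<integral>y. u y \<partial>P x)"

definition bdd_measurable :: "('a \<Rightarrow> real) \<Rightarrow> bool" where
  "bdd_measurable u \<longleftrightarrow> u \<in> borel_measurable borel \<and> (\<exists>C. \<forall>x. \<bar>u x\<bar> \<le> C)"

lemma bdd_measurableI: "u \<in> borel_measurable borel \<Longrightarrow> (\<And>x. \<bar>u x\<bar> \<le> C) \<Longrightarrow> bdd_measurable u"
  by (auto simp: bdd_measurable_def)

lemma bdd_measurable_measurable: "bdd_measurable u \<Longrightarrow> u \<in> borel_measurable borel"
  by (simp add: bdd_measurable_def)

lemma bdd_measurable_integrable:
  assumes "bdd_measurable u" shows "integrable (P x) u" "integrable \<pi> u"
proof -
  obtain C where C: "\<And>x. \<bar>u x\<bar> \<le> C" and [measurable]: "u \<in> borel_measurable borel"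
    using assms by (auto simp: bdd_measurable_def)
  interpret Px: prob_space "P x" by (rule prob_space_P)
  show "integrable (P x) u" by (rule Px.integrable_const_bound[of _ C]) (auto simp: C)
  show "integrable \<pi> u" by (rule integrable_const_bound[of _ C]) (auto simp: C)
qed

lemma bdd_measurable_add: "bdd_measurable u \<Longrightarrow> bdd_measurable v \<Longrightarrow> bdd_measurable (\<lambda>x. u x + v x)"
  unfolding bdd_measurable_def by (auto intro!: exI abs_triangle_ineq[THEN order_trans] add_mono)

lemma bdd_measurable_cmult: "bdd_measurable u \<Longrightarrow> bdd_measurable (\<lambda>x. c * u x)"
  unfolding bdd_measurable_def by (auto simp: abs_mult intro!: mult_left_mono exI)

lemma bdd_measurable_const: "bdd_measurable (\<lambda>x. c)"
  unfolding bdd_measurable_def by auto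

lemma bdd_measurable_diff: "bdd_measurable u \<Longrightarrow> bdd_measurable v \<Longrightarrow> bdd_measurable (\<lambda>x. u x - v x)"
  using bdd_measurable_add[of u "\<lambda>x. -1 * v x"] bdd_measurable_cmult[of v "-1"] by simp

lemma bdd_measurable_max: "bdd_measurable u \<Longrightarrow> bdd_measurable v \<Longrightarrow> bdd_measurable (\<lambda>x. max (u x) (v x))"
proof -
  assume "bdd_measurable u" "bdd_measurable v"
  then obtain C D where "\<And>x. \<bar>u x\<bar> \<le> C" "\<And>x. \<bar>v x\<bar> \<le> D"
    and [measurable]: "u \<in> borel_measurable borel" "v \<in> borel_measurable borel" by (auto simp: bdd_measurable_def)
  then have "\<bar>max (u x) (v x)\<bar> \<le> max C D" for x
    by (smt (verit) max_def)
  then show ?thesis by (auto simp: bdd_measurable_def)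
qed

lemma bdd_measurable_sum: "(\<And>i. i \<in> I \<Longrightarrow> bdd_measurable (u i)) \<Longrightarrow> bdd_measurable (\<lambda>x. \<Sum>i\<in>I. u i x)"
  by (induction I rule: infinite_finite_induct) (auto intro: bdd_measurable_add bdd_measurable_const)

lemma kernel_op_abs_le:
  assumes "u \<in> borel_measurable borel" "\<And>x. \<bar>u x\<bar> \<le> C" shows "\<bar>kernel_op u x\<bar> \<le> C"
proof -
  interpret Px: prob_space "P x" by (rule prob_space_P)
  have "\<bar>kernel_op u x\<bar> \<le> (\<integral>y. \<bar>u y\<bar> \<partial>P x)" unfolding kernel_op_def by (rule integral_abs_bound)
  also have "\<dots> \<le> (\<integral>y. C \<partial>P x)"
    using bdd_measurable_integrable(1)[OF bdd_measurableI[OF assms], of x] assms(2) by (intro integral_mono) auto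
  also have "\<dots> = C" by (simp add: Px.prob_space[unfolded space_P])
  finally show ?thesis .
qed

lemma kernel_op_measurable [measurable]:
  assumes [measurable]: "u \<in> borel_measurable borel" shows "kernel_op u \<in> borel_measurable borel"
  unfolding kernel_op_def[abs_def] by measurable

lemma kernel_op_bdd_measurable: "bdd_measurable u \<Longrightarrow> bdd_measurable (kernel_op u)"
  by (metis bdd_measurable_def kernel_op_abs_le kernel_op_measurable)

lemma kernel_op_pow_bdd_measurable: "bdd_measurable u \<Longrightarrow> bdd_measurable ((kernel_op ^^ k) u)"
  by (induction k) (auto intro: kernel_op_bdd_measurable)

lemma kernel_op_add: "bdd_measurable u \<Longrightarrow> bdd_measurable v \<Longrightarrow> kernel_op (\<lambda>x. u x + v x) x = kernel_op u x + kernel_op v x"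
  unfolding kernel_op_def by (intro Bochner_Integration.integral_add bdd_measurable_integrable)

lemma kernel_op_cmult: "kernel_op (\<lambda>x. c * u x) x = c * kernel_op u x"
  unfolding kernel_op_def by simp

lemma kernel_op_const [simp]: "kernel_op (\<lambda>x. c) x = c"
proof -
  interpret Px: prob_space "P x" by (rule prob_space_P)
  show ?thesis unfolding kernel_op_def by (simp add: Px.prob_space[unfolded space_P])
qed

lemma kernel_op_sum: "(\<And>i. i \<in> I \<Longrightarrow> bdd_measurable (u i)) \<Longrightarrow> kernel_op (\<lambda>x. \<Sum>i\<in>I. u i x) x = (\<Sum>i\<in>I. kernel_op (u i) x)"
  unfolding kernel_op_def by (intro Bochner_Integration.integral_sum bdd_measurable_integrable) auto

lemma kernel_op_mono: "bdd_measurable u \<Longrightarrow> bdd_measurable v \<Longrightarrow> (\<And>x. u x \<le> v x) \<Longrightarrow> kernel_op u x \<le> kernel_op v x"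
  unfolding kernel_op_def by (intro integral_mono bdd_measurable_integrable) auto

lemma integral_kernel_op:
  assumes "bdd_measurable u" shows "(\<integral>x. kernel_op u x \<partial>\<pi>) = (\<integral>x. u x \<partial>\<pi>)"
proof -
  obtain C where C: "\<And>x. \<bar>u x\<bar> \<le> C" and u: "u \<in> borel_measurable borel"
    using assms by (auto simp: bdd_measurable_def)
  have "(\<integral>x. u x \<partial>(\<pi> \<bind> P)) = (\<integral>x. \<integral>y. u y \<partial>P x \<partial>\<pi>)"
    by (rule integral_bind[where K = borel and B = C and B' = 1])
      (use C u in \<open>auto simp: prob_space.emeasure_space_1[OF prob_space_P, simplified] finite_measure_axioms\<close>)
  then show ?thesis by (simp add: bind_pi kernel_op_def)
qed

definition orbit_sum :: "('a \<Rightarrow> real) \<Rightarrow> nat \<Rightarrow> 'a \<Rightarrow> real" where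
  "orbit_sum g n x = (\<Sum>k<n. (kernel_op ^^ k) g x)"

lemma orbit_sum_bdd_measurable: "bdd_measurable g \<Longrightarrow> bdd_measurable (orbit_sum g n)"
  unfolding orbit_sum_def[abs_def] by (intro bdd_measurable_sum kernel_op_pow_bdd_measurable)

lemma orbit_sum_Suc: "bdd_measurable g \<Longrightarrow> orbit_sum g (Suc n) x = g x + kernel_op (orbit_sum g n) x"
  unfolding orbit_sum_def[abs_def]
  by (subst kernel_op_sum) (auto simp: sum.lessThan_Suc_shift kernel_op_pow_bdd_measurable simp del: sum.lessThan_Suc)

lemma integral_orbit_sum: "bdd_measurable g \<Longrightarrow> (\<integral>x. orbit_sum g n x \<partial>\<pi>) = real n * (\<integral>x. g x \<partial>\<pi>)"
proof -
  assume g: "bdd_measurable g"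
  have "(\<integral>x. (kernel_op ^^ k) g x \<partial>\<pi>) = (\<integral>x. g x \<partial>\<pi>)" for k
    by (induction k) (auto simp: integral_kernel_op kernel_op_pow_bdd_measurable g)
  then show ?thesis
    unfolding orbit_sum_def by (subst Bochner_Integration.integral_sum) (auto intro!: bdd_measurable_integrable kernel_op_pow_bdd_measurable g)
qed

lemma orbit_sum_add_const: "bdd_measurable g \<Longrightarrow> orbit_sum (\<lambda>x. g x + c) n x = orbit_sum g n x + real n * c"
proof -
  assume g: "bdd_measurable g"
  have "(kernel_op ^^ k) (\<lambda>x. g x + c) = (\<lambda>x. (kernel_op ^^ k) g x + c)" for k
    by (induction k) (auto simp: kernel_op_add kernel_op_pow_bdd_measurable g bdd_measurable_const)
  then show ?thesis by (simp add: orbit_sum_def sum.distrib)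
qed

lemma kernel_op_pow_abs_le:
  assumes "u \<in> borel_measurable borel" "\<And>x. \<bar>u x\<bar> \<le> C"
  shows "\<bar>(kernel_op ^^ k) u x\<bar> \<le> C"
proof (induction k arbitrary: x)
  case (Suc k)
  have "(kernel_op ^^ k) u \<in> borel_measurable borel"
    using kernel_op_pow_bdd_measurable[OF bdd_measurableI[OF assms]] by (rule bdd_measurable_measurable)
  from kernel_op_abs_le[OF this Suc] show ?case by simp
qed (simp add: assms)

lemma orbit_sum_abs_le:
  assumes "u \<in> borel_measurable borel" "\<And>x. \<bar>u x\<bar> \<le> C"
  shows "\<bar>orbit_sum u n x\<bar> \<le> real n * C"
  unfolding orbit_sum_def using sum_bounded_above[of "{..<n}" "\<lambda>k. \<bar>(kernel_op ^^ k) u x\<bar>" C] kernel_op_pow_abs_le[OF assms]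
  by (intro order_trans[OF sum_abs]) auto

text \<open>
  Garsia's argument. Instead of the running maximum of the partial sums it uses the larger functions
  \<open>m\<^sub>n\<^sub>+\<^sub>1 = max 0 (g + P m\<^sub>n)\<close>, which satisfy the same estimate: where \<open>m\<^sub>n\<^sub>+\<^sub>1 > 0\<close> one has
  \<open>g \<ge> m\<^sub>n\<^sub>+\<^sub>1 - P m\<^sub>n\<^sub>+\<^sub>1\<close>, elsewhere the right-hand side is at most \<open>0\<close>, and its integral vanishes.
\<close>

lemma maximal_ergodic:
  assumes g: "bdd_measurable g" and pos: "AE x in \<pi>. \<exists>n. orbit_sum g n x > 0"
  shows "0 \<le> (\<integral>x. g x \<partial>\<pi>)"
proof -
  define m where "m = rec_nat (\<lambda>_. 0) (\<lambda>_ u x. max 0 (g x + kernel_op u x))"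
  have m0: "m 0 = (\<lambda>_. 0)" and mS: "m (Suc n) = (\<lambda>x. max 0 (g x + kernel_op (m n) x))" for n
    by (simp_all add: m_def)
  have bm: "bdd_measurable (m n)" for n
    by (induction n) (auto simp: m0 mS intro!: bdd_measurable_max bdd_measurable_const bdd_measurable_add kernel_op_bdd_measurable g)
  have m_nonneg: "0 \<le> m n x" for n x by (cases n) (auto simp: m0 mS)
  have m_mono: "m n x \<le> m (Suc n) x" for n x
  proof (induction n arbitrary: x)
    case (Suc n)
    have "kernel_op (m n) x \<le> kernel_op (m (Suc n)) x" by (rule kernel_op_mono[OF bm bm Suc])
    then show ?case by (simp add: mS[of "Suc n"] mS[of n] max.coboundedI2)
  qed (simp add: m0 m_nonneg)
  have orbit_sum_le: "orbit_sum g n x \<le> m n x" for n x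
  proof (induction n arbitrary: x)
    case (Suc n)
    have "kernel_op (orbit_sum g n) x \<le> kernel_op (m n) x" by (rule kernel_op_mono[OF orbit_sum_bdd_measurable[OF g] bm Suc])
    then show ?case by (simp add: orbit_sum_Suc[OF g] mS)
  qed (simp add: m0 orbit_sum_def)
  have [measurable]: "g \<in> borel_measurable borel" "m n \<in> borel_measurable borel" for n
    using g bm by (auto intro: bdd_measurable_measurable)
  let ?I = "\<lambda>n x. indicator {x. 0 < m (Suc n) x} x * g x"
  have key: "0 \<le> (\<integral>x. ?I n x \<partial>\<pi>)" for n
  proof -
    have "0 = (\<integral>x. m (Suc n) x - kernel_op (m (Suc n)) x \<partial>\<pi>)"
      by (subst Bochner_Integration.integral_diff) (auto intro!: bdd_measurable_integrable bm kernel_op_bdd_measurable simp: integral_kernel_op[OF bm])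
    also have "\<dots> \<le> (\<integral>x. ?I n x \<partial>\<pi>)"
    proof (rule integral_mono)
      show "integrable \<pi> (\<lambda>x. m (Suc n) x - kernel_op (m (Suc n)) x)"
        by (intro bdd_measurable_integrable bdd_measurable_diff bm kernel_op_bdd_measurable)
      show "integrable \<pi> (?I n)"
        using bdd_measurable_integrable(2)[OF g] by (intro integrable_mult_indicator[where 'b = real, simplified]) auto
      fix x
      have 1: "kernel_op (m n) x \<le> kernel_op (m (Suc n)) x" by (rule kernel_op_mono[OF bm bm m_mono])
      have 2: "0 \<le> kernel_op (m (Suc n)) x"
        using kernel_op_mono[OF bdd_measurable_const bm, of 0 "Suc n" x] m_nonneg by simp
      have 3: "m (Suc n) x = max 0 (g x + kernel_op (m n) x)" by (simp add: mS)
      show "m (Suc n) x - kernel_op (m (Suc n)) x \<le> ?I n x"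
        using 1 2 3 m_nonneg[of "Suc n" x] by (auto simp: indicator_def max_def split: if_splits)
    qed
    finally show ?thesis .
  qed
  have lim: "(\<lambda>n. \<integral>x. ?I n x \<partial>\<pi>) \<longlonglongrightarrow> (\<integral>x. g x \<partial>\<pi>)"
  proof (rule integral_dominated_convergence[where w = "\<lambda>x. \<bar>g x\<bar>"])
    show "integrable \<pi> (\<lambda>x. \<bar>g x\<bar>)" using bdd_measurable_integrable(2)[OF g] by simp
    show "AE x in \<pi>. (\<lambda>n. ?I n x) \<longlonglongrightarrow> g x"
      using pos
    proof eventually_elim
      case (elim x)
      then obtain n where "0 < orbit_sum g n x" by auto
      then have n: "0 < m n x" using orbit_sum_le[of n x] by simp
      have "incseq (\<lambda>n. m n x)" by (rule incseq_SucI) (rule m_mono)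
      then have "0 < m (Suc k) x" if "n \<le> k" for k
        using n that incseqD[of "\<lambda>n. m n x" n "Suc k"] by simp
      then have "eventually (\<lambda>k. ?I k x = g x) sequentially"
        unfolding eventually_sequentially by (intro exI[of _ n]) (simp add: indicator_def)
      then show ?case by (rule tendsto_eventually)
    qed
  qed (auto simp: indicator_def)
  show ?thesis by (rule LIMSEQ_le_const[OF lim]) (use key in auto)
qed

text \<open>
  The upper limit \<open>v\<close> of the averages satisfies \<open>v \<le> P v\<close> by the reversed Fatou lemma, so it cannot
  straddle a level. If it exceeded the level \<open>c > \<pi>(g)\<close>, the partial sums of \<open>g - c\<close> would become positive
  almost everywhere, and the maximal inequality would give \<open>\<pi>(g) \<ge> c\<close>.
\<close>

lemma limsup_average_le:
  assumes irr: "phi_irreducible P" and g: "g \<in> borel_measurable borel"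
    and C: "\<And>x. 0 \<le> g x" "\<And>x. g x \<le> C"
  shows "AE x in \<pi>. limsup (\<lambda>n. ennreal (orbit_sum g n x / real n)) \<le> ennreal (\<integral>x. g x \<partial>\<pi>)"
proof -
  have gC: "\<bar>g x\<bar> \<le> C" for x using C[of x] by simp
  have C0: "0 \<le> C" using C(1) C(2) order_trans by blast
  have bg: "bdd_measurable g" by (rule bdd_measurableI[OF g gC])
  have [measurable]: "orbit_sum g n \<in> borel_measurable borel" for n
    by (rule bdd_measurable_measurable[OF orbit_sum_bdd_measurable[OF bg]])
  define v where "v = (\<lambda>x. limsup (\<lambda>n. ennreal (orbit_sum g n x / real n)))"
  have [measurable]: "v \<in> borel_measurable borel" unfolding v_def by measurable
  have bound: "orbit_sum g n x / real n \<le> C" for n x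
    using orbit_sum_abs_le[OF g gC, of n x] C0 by (auto simp: field_simps abs_le_iff divide_le_eq)
  have kpos: "0 \<le> (kernel_op ^^ k) g x" for k x
  proof (induction k arbitrary: x)
    case (Suc k)
    show ?case using kernel_op_mono[OF bdd_measurable_const kernel_op_pow_bdd_measurable[OF bg, of k] Suc, of x] by simp
  qed (simp add: C)
  have pos: "0 \<le> orbit_sum g n x" for n x
    by (simp add: orbit_sum_def sum_nonneg kpos)
  have vC: "v x \<le> ennreal C" for x
    unfolding v_def by (rule Limsup_bounded) (auto intro!: always_eventually ennreal_leI bound)
  have sub: "v x \<le> (\<integral>\<^sup>+y. v y \<partial>P x)" for x
  proof -
    interpret Px: prob_space "P x" by (rule prob_space_P)
    have "v x \<le> limsup (\<lambda>n. \<integral>\<^sup>+y. ennreal (orbit_sum g n y / real n) \<partial>P x)"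
      unfolding v_def
    proof (rule limsup_le_perturb)
      show "(\<lambda>n. ennreal (C / real n)) \<longlonglongrightarrow> 0"
        using tendsto_ennrealI[OF lim_const_over_n[of C]] by simp
      fix n
      have eq: "(\<integral>\<^sup>+y. ennreal (orbit_sum g n y / real n) \<partial>P x) = ennreal (kernel_op (orbit_sum g n) x / real n)"
        unfolding kernel_op_def using bdd_measurable_integrable(1)[OF orbit_sum_bdd_measurable[OF bg]] pos
        by (subst nn_integral_eq_integral) auto
      have "orbit_sum g n x \<le> g x + kernel_op (orbit_sum g n) x"
      proof -
        have "0 \<le> (kernel_op ^^ n) g x" by (rule kpos)
        moreover have "orbit_sum g (Suc n) x = g x + kernel_op (orbit_sum g n) x" by (rule orbit_sum_Suc[OF bg])
        ultimately show ?thesis by (simp add: orbit_sum_def)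
      qed
      then have "orbit_sum g n x / real n \<le> kernel_op (orbit_sum g n) x / real n + C / real n"
        using C(2)[of x] by (simp add: divide_right_mono flip: add_divide_distrib)
      moreover have "0 \<le> kernel_op (orbit_sum g n) x"
        using kernel_op_mono[OF bdd_measurable_const orbit_sum_bdd_measurable[OF bg] pos, of x n] by simp
      ultimately show "ennreal (orbit_sum g n x / real n) \<le>
          (\<integral>\<^sup>+y. ennreal (orbit_sum g n y / real n) \<partial>P x) + ennreal (C / real n)"
        unfolding eq using C0 by (simp add: ennreal_plus[symmetric] ennreal_leI del: ennreal_plus)
    qed
    also have "\<dots> \<le> (\<integral>\<^sup>+y. v y \<partial>P x)"
      unfolding v_def
      by (rule nn_integral_limsup[where w = "\<lambda>_. ennreal C"])
        (auto intro!: ennreal_leI bound simp: Px.emeasure_space_1[simplified])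
    finally show ?thesis .
  qed
  have le: "AE x in \<pi>. v x \<le> ennreal ((\<integral>x. g x \<partial>\<pi>) + e)" if "0 < e" for e
  proof (rule ccontr)
    let ?c = "(\<integral>x. g x \<partial>\<pi>) + e"
    assume "\<not> (AE x in \<pi>. v x \<le> ennreal ?c)"
    then have "AE x in \<pi>. ennreal ?c < v x"
      using subinvariant_trivial[OF irr _ vC _ sub, of "ennreal ?c"] by auto
    then have "AE x in \<pi>. \<exists>n. orbit_sum (\<lambda>x. g x + - ?c) n x > 0"
    proof eventually_elim
      case (elim x)
      then obtain n where n: "ennreal ?c < ennreal (orbit_sum g n x / real n)"
        unfolding v_def using Limsup_obtain by blast
      have c0: "0 < ?c" using that C(1) by (simp add: add_nonneg_pos)
      then have "?c < orbit_sum g n x / real n" using n by (simp add: ennreal_less_iff)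
      moreover have "n \<noteq> 0" using calculation c0 by (cases "n = 0") auto
      ultimately have "0 < orbit_sum g n x + real n * - ?c" by (simp add: field_simps)
      then show ?case by (intro exI[of _ n]) (simp add: orbit_sum_add_const[OF bg])
    qed
    from maximal_ergodic[OF bdd_measurable_add[OF bg bdd_measurable_const] this]
    have "0 \<le> (\<integral>x. g x + - ?c \<partial>\<pi>)" .
    also have "\<dots> = (\<integral>x. g x \<partial>\<pi>) + - ?c"
      using bdd_measurable_integrable(2)[OF bg] by (subst Bochner_Integration.integral_add) (auto simp: prob_space[simplified])
    finally show False using that by simp
  qed
  have "AE x in \<pi>. \<forall>n. v x \<le> ennreal ((\<integral>x. g x \<partial>\<pi>) + 1 / real (Suc n))"
    by (subst AE_all_countable) (intro allI le, simp)
  then show ?thesis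
  proof eventually_elim
    case (elim x)
    have "(\<lambda>n. ennreal ((\<integral>x. g x \<partial>\<pi>) + 1 / real (Suc n))) \<longlonglongrightarrow> ennreal ((\<integral>x. g x \<partial>\<pi>) + 0)"
      by (intro tendsto_ennrealI tendsto_add tendsto_const LIMSEQ_Suc lim_const_over_n)
    then have "v x \<le> ennreal ((\<integral>x. g x \<partial>\<pi>) + 0)"
      by (rule LIMSEQ_le_const) (use elim in blast)
    then show ?case by (simp add: v_def)
  qed
qed

text \<open>
  The averages have integral \<open>\<pi>(g)\<close>, hence the \<open>L\<^sup>1\<close> distance to \<open>\<pi>(g)\<close> is twice the integral of the positive
  part of the difference. The one-sided bound on the upper limit therefore suffices.
\<close>

lemma mean_ergodic_operator:
  assumes irr: "phi_irreducible P" and g: "bdd_measurable g"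
  shows "(\<lambda>n. \<integral>x. \<bar>orbit_sum g n x / real n - (\<integral>x. g x \<partial>\<pi>)\<bar> \<partial>\<pi>) \<longlonglongrightarrow> 0"
proof -
  obtain C where C: "\<And>x. \<bar>g x\<bar> \<le> C" and gm [measurable]: "g \<in> borel_measurable borel"
    using g by (auto simp: bdd_measurable_def)
  have C0: "0 \<le> C" using C abs_ge_zero order_trans by blast
  (* the one-sided bound is stated for nonnegative functions *)
  define f where "f = (\<lambda>x. g x + C)"
  have bf: "bdd_measurable f" unfolding f_def by (intro bdd_measurable_add g bdd_measurable_const)
  have f: "f \<in> borel_measurable borel" "0 \<le> f x" "f x \<le> 2 * C" "\<bar>f x\<bar> \<le> 2 * C" for x
    using C[of x] by (auto simp: f_def abs_le_iff)
  have [measurable]: "orbit_sum f n \<in> borel_measurable borel" for n by (rule bdd_measurable_measurable[OF orbit_sum_bdd_measurable[OF bf]])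
  have intf: "(\<integral>x. f x \<partial>\<pi>) = (\<integral>x. g x \<partial>\<pi>) + C"
    unfolding f_def using bdd_measurable_integrable(2)[OF g]
    by (subst Bochner_Integration.integral_add) (auto simp: prob_space[simplified])
  let ?c = "\<integral>x. f x \<partial>\<pi>"
  let ?pos = "\<lambda>n x. max 0 (orbit_sum f n x / real n - ?c)"
  have avgb: "\<bar>orbit_sum f n x / real n\<bar> \<le> 2 * C" for n x
    using orbit_sum_abs_le[OF f(1) f(4), of n x] C0 by (auto simp: field_simps abs_divide divide_le_eq)
  have bavg: "bdd_measurable (\<lambda>x. orbit_sum f n x / real n - ?c)" for n
    using bdd_measurable_diff[OF bdd_measurable_cmult[OF orbit_sum_bdd_measurable[OF bf], of "1 / real n"] bdd_measurable_const] by simp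
  have c0: "0 \<le> ?c" using f by simp
  have lim: "(\<lambda>n. \<integral>x. ?pos n x \<partial>\<pi>) \<longlonglongrightarrow> (\<integral>x. 0 \<partial>\<pi>)"
  proof (rule integral_dominated_convergence[where w = "\<lambda>x. 2 * C"])
    show "AE x in \<pi>. (\<lambda>n. ?pos n x) \<longlonglongrightarrow> 0"
      using limsup_average_le[OF irr f(1,2,3)]
    proof eventually_elim
      case (elim x)
      show ?case
      proof (rule order_tendstoI)
        fix e :: real assume "0 < e"
        have "ennreal ?c < ennreal (?c + e)" using \<open>0 < e\<close> c0 by (simp add: ennreal_less_iff)
        then have "limsup (\<lambda>n. ennreal (orbit_sum f n x / real n)) < ennreal (?c + e)"
          using elim by (rule order.strict_trans1[rotated])
        then have "eventually (\<lambda>n. ennreal (orbit_sum f n x / real n) < ennreal (?c + e)) sequentially"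
          by (rule Limsup_lessD)
        then show "eventually (\<lambda>n. ?pos n x < e) sequentially"
        proof eventually_elim
          case (elim n)
          then have "orbit_sum f n x / real n < ?c + e" by (metis ennreal_leI not_le)
          then show ?case using \<open>0 < e\<close> by simp
        qed
      qed (auto intro: always_eventually less_le_trans)
    qed
    show "AE x in \<pi>. norm (?pos n x) \<le> 2 * C" for n
    proof (rule AE_I2)
      fix x
      have "orbit_sum f n x / real n \<le> 2 * C" using avgb[of n x] by (simp only: abs_le_iff)
      then show "norm (?pos n x) \<le> 2 * C" using c0 C0 by (simp add: max_def)
    qed
  qed auto
  have eq: "(\<integral>x. \<bar>orbit_sum f n x / real n - ?c\<bar> \<partial>\<pi>) = 2 * (\<integral>x. ?pos n x \<partial>\<pi>)" if "n \<ge> 1" for n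
  proof -
    have 0: "(\<integral>x. orbit_sum f n x / real n - ?c \<partial>\<pi>) = 0"
      using that bdd_measurable_integrable(2)[OF orbit_sum_bdd_measurable[OF bf]] integral_orbit_sum[OF bf]
      by (subst Bochner_Integration.integral_diff) (auto simp: prob_space[simplified])
    have "(\<integral>x. \<bar>orbit_sum f n x / real n - ?c\<bar> \<partial>\<pi>) = (\<integral>x. 2 * ?pos n x - (orbit_sum f n x / real n - ?c) \<partial>\<pi>)"
      by (intro Bochner_Integration.integral_cong) (auto simp: max_def abs_if)
    also have "\<dots> = (\<integral>x. 2 * ?pos n x \<partial>\<pi>) - (\<integral>x. orbit_sum f n x / real n - ?c \<partial>\<pi>)"
      by (intro Bochner_Integration.integral_diff bdd_measurable_integrable bavg bdd_measurable_cmult bdd_measurable_max bdd_measurable_const)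
    finally show ?thesis using 0 by simp
  qed
  have "(\<lambda>n. 2 * (\<integral>x. ?pos n x \<partial>\<pi>)) \<longlonglongrightarrow> 0"
    using tendsto_mult_right_zero[OF lim[simplified], of 2] by simp
  then have "(\<lambda>n. \<integral>x. \<bar>orbit_sum f n x / real n - ?c\<bar> \<partial>\<pi>) \<longlonglongrightarrow> 0"
    by (rule Lim_transform_eventually) (auto intro!: eventually_sequentiallyI[of 1] eq[symmetric])
  moreover have "orbit_sum f n x / real n - ?c = orbit_sum g n x / real n - (\<integral>x. g x \<partial>\<pi>)" if "n \<ge> 1" for n x
    using that unfolding intf unfolding f_def orbit_sum_add_const[OF g] by (simp add: field_simps)
  ultimately show ?thesis
    by (elim Lim_transform_eventually) (auto intro!: eventually_sequentiallyI[of 1])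
qed

end

section \<open>The ergodic theorem along the chain\<close>

lemma norm_integral_le:
  fixes f :: "'b \<Rightarrow> 'c::{banach, second_countable_topology}"
  assumes "f \<in> borel_measurable M" "integrable M g" "\<And>x. norm (f x) \<le> g x"
  shows "norm (\<integral>x. f x \<partial>M) \<le> (\<integral>x. g x \<partial>M)"
proof -
  have "norm (f x) \<le> norm (g x)" for x
    using assms(3)[of x] by simp
  then have "integrable M f"
    using assms(1,2) by (intro Bochner_Integration.integrable_bound[of M g f]) auto
  then have "norm (\<integral>x. f x \<partial>M) \<le> (\<integral>x. norm (f x) \<partial>M)" by simp
  also have "\<dots> \<le> (\<integral>x. g x \<partial>M)"
    using \<open>integrable M f\<close> assms by (intro integral_mono) auto
  finally show ?thesis .
qed

text \<open>
  Supplies the truncation levels for functions that are merely integrable.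
\<close>

lemma integrable_tail_small:
  fixes f :: "'b \<Rightarrow> real"
  assumes f: "integrable M f" and "0 < r"
  shows "\<exists>K\<ge>0. (\<integral>x. \<bar>f x\<bar> * of_bool (K < \<bar>f x\<bar>) \<partial>M) < r"
proof -
  have [measurable]: "f \<in> borel_measurable M" using f by (rule borel_measurable_integrable)
  have "(\<lambda>n. \<integral>x. \<bar>f x\<bar> * of_bool (real n < \<bar>f x\<bar>) \<partial>M) \<longlonglongrightarrow> (\<integral>x. 0 \<partial>M)"
  proof (rule integral_dominated_convergence[where w = "\<lambda>x. \<bar>f x\<bar>"])
    show "AE x in M. (\<lambda>n. \<bar>f x\<bar> * of_bool (real n < \<bar>f x\<bar>)) \<longlonglongrightarrow> 0"
    proof (rule AE_I2)
      fix x
      obtain N where "\<bar>f x\<bar> \<le> real N" using real_arch_simple by blast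
      then show "(\<lambda>n. \<bar>f x\<bar> * of_bool (real n < \<bar>f x\<bar>)) \<longlonglongrightarrow> 0"
        by (intro tendsto_eventually eventually_sequentiallyI[of N]) auto
    qed
  qed (use f in auto)
  then have "eventually (\<lambda>n. (\<integral>x. \<bar>f x\<bar> * of_bool (real n < \<bar>f x\<bar>) \<partial>M) < r) sequentially"
    using \<open>0 < r\<close> by (intro order_tendstoD(2)) auto
  then obtain n where "(\<integral>x. \<bar>f x\<bar> * of_bool (real n < \<bar>f x\<bar>) \<partial>M) < r"
    using eventually_happens'[OF sequentially_bot] by blast
  then show ?thesis by (intro exI[of _ "real n"]) simp
qed

context stationary_chain
begin

lemma integrable_X:
  fixes f :: "'a \<Rightarrow> real"
  assumes "integrable \<pi> f" shows "integrable M (\<lambda>\<omega>. f (X n \<omega>))"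
  using assms unfolding distr_X[of n, symmetric]
  by (rule integrable_distr[OF X_measurable])

lemma integral_X:
  fixes f :: "'a \<Rightarrow> real"
  assumes [measurable]: "f \<in> borel_measurable borel"
  shows "(\<integral>\<omega>. f (X n \<omega>) \<partial>M) = (\<integral>x. f x \<partial>\<pi>)"
  unfolding distr_X[of n, symmetric] by (subst integral_distr) auto

lemma markov_expectation:
  fixes G :: "(nat \<Rightarrow> 'a) \<Rightarrow> 'a \<Rightarrow> real"
  assumes G [measurable]: "(\<lambda>(\<xi>, y). G \<xi> y) \<in> borel_measurable (path_space \<Otimes>\<^sub>M borel)"
    and C: "\<And>\<xi> y. \<bar>G \<xi> y\<bar> \<le> C"
  shows "(\<integral>\<omega>. G (stop_at n (path \<omega>)) (X (Suc n) \<omega>) \<partial>M) =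
    (\<integral>\<omega>. \<integral>y. G (stop_at n (path \<omega>)) y \<partial>P (X n \<omega>) \<partial>M)"
proof -
  have pos: "0 \<le> G \<xi> y + C" for \<xi> y using C[of \<xi> y] by simp
  have C0: "0 \<le> C" using C abs_ge_zero order_trans by blast
  have G1 [measurable]: "G \<xi> \<in> borel_measurable borel" for \<xi>
    using measurable_compose[OF measurable_Pair1'[of \<xi> path_space borel] G] by (simp add: space_PiM)
  have G2 [measurable]: "(\<lambda>\<omega>. G (stop_at n (path \<omega>)) (X (Suc n) \<omega>)) \<in> borel_measurable M"
    using measurable_compose[OF _ G, of "\<lambda>\<omega>. (stop_at n (path \<omega>), X (Suc n) \<omega>)" M] by simp
  have G3 [measurable]: "(\<lambda>(\<omega>, y). G (stop_at n (path \<omega>)) y) \<in> borel_measurable (M \<Otimes>\<^sub>M borel)"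
    using measurable_compose[OF _ G, of "\<lambda>z. (stop_at n (path (fst z)), snd z)" "M \<Otimes>\<^sub>M borel"]
    by (simp add: split_beta')
  have intP: "integrable (P x) (G \<xi>)" for x \<xi> by (rule bdd_measurable_integrable(1)[OF bdd_measurableI[OF G1 C]])
  have inner: "(\<integral>\<^sup>+y. ennreal (G \<xi> y + C) \<partial>P x) = ennreal ((\<integral>y. G \<xi> y \<partial>P x) + C)" for \<xi> x
  proof -
    interpret Px: prob_space "P x" by (rule prob_space_P)
    show ?thesis
      using intP pos by (subst nn_integral_eq_integral) (auto simp: Px.prob_space[unfolded space_P])
  qed
  have "\<bar>kernel_op (G \<xi>) x\<bar> \<le> C" for \<xi> x by (rule kernel_op_abs_le[OF G1 C])
  then have kb: "\<bar>\<integral>y. G \<xi> y \<partial>P x\<bar> \<le> C" for \<xi> x by (simp add: kernel_op_def)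
  have Gl: "- C \<le> G \<xi> y" for \<xi> y using C[of \<xi> y] by linarith
  have kl: "- C \<le> (\<integral>y. G \<xi> y \<partial>P x)" for \<xi> x using kb[of x \<xi>] by linarith
  have kl': "0 \<le> (\<integral>y. G \<xi> y \<partial>P x) + C" for \<xi> x using kl[of x \<xi>] by linarith
  have meas: "(\<lambda>\<omega>. \<integral>y. G (stop_at n (path \<omega>)) y \<partial>P (X n \<omega>)) \<in> borel_measurable M"
  proof -
    have "(\<integral>y. G \<xi> y \<partial>P x) = enn2real (\<integral>\<^sup>+y. ennreal (G \<xi> y + C) \<partial>P x) - C" for \<xi> x
    by (simp add: inner enn2real_ennreal[OF kl'])
    moreover have "(\<lambda>\<omega>. \<integral>\<^sup>+y. ennreal (G (stop_at n (path \<omega>)) y + C) \<partial>P (X n \<omega>)) \<in> borel_measurable M"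
      by (rule nn_integral_measurable_subprob_algebra2[where N = borel]) measurable
    ultimately show ?thesis by simp
  qed
  have i1: "integrable M (\<lambda>\<omega>. G (stop_at n (path \<omega>)) (X (Suc n) \<omega>))"
    by (rule M.integrable_const_bound[of _ C]) (auto simp: C)
  have i2: "integrable M (\<lambda>\<omega>. \<integral>y. G (stop_at n (path \<omega>)) y \<partial>P (X n \<omega>))"
    by (rule M.integrable_const_bound[of _ C]) (auto simp: kb meas)
  have "ennreal ((\<integral>\<omega>. G (stop_at n (path \<omega>)) (X (Suc n) \<omega>) \<partial>M) + C)
      = ennreal (\<integral>\<omega>. G (stop_at n (path \<omega>)) (X (Suc n) \<omega>) + C \<partial>M)"
    using i1 by (simp add: M.prob_space)
  also have "\<dots> = (\<integral>\<^sup>+\<omega>. ennreal (G (stop_at n (path \<omega>)) (X (Suc n) \<omega>) + C) \<partial>M)"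
    using i1 pos by (intro nn_integral_eq_integral[symmetric]) auto
  also have "\<dots> = (\<integral>\<^sup>+\<omega>. \<integral>\<^sup>+y. ennreal (G (stop_at n (path \<omega>)) y + C) \<partial>P (X n \<omega>) \<partial>M)"
    by (rule markov_property[of "\<lambda>\<xi> y. ennreal (G \<xi> y + C)"]) measurable
  also have "\<dots> = (\<integral>\<^sup>+\<omega>. ennreal ((\<integral>y. G (stop_at n (path \<omega>)) y \<partial>P (X n \<omega>)) + C) \<partial>M)"
    by (simp only: inner)
  also have "\<dots> = ennreal (\<integral>\<omega>. (\<integral>y. G (stop_at n (path \<omega>)) y \<partial>P (X n \<omega>)) + C \<partial>M)"
    using i2 by (intro nn_integral_eq_integral) (auto intro!: AE_I2 kl')
  also have "\<dots> = ennreal ((\<integral>\<omega>. \<integral>y. G (stop_at n (path \<omega>)) y \<partial>P (X n \<omega>) \<partial>M) + C)"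
    using i2 by (simp add: M.prob_space)
  finally have eq: "ennreal ((\<integral>\<omega>. G (stop_at n (path \<omega>)) (X (Suc n) \<omega>) \<partial>M) + C)
    = ennreal ((\<integral>\<omega>. \<integral>y. G (stop_at n (path \<omega>)) y \<partial>P (X n \<omega>) \<partial>M) + C)" .
  have "- C \<le> (\<integral>\<omega>. G (stop_at n (path \<omega>)) (X (Suc n) \<omega>) \<partial>M)"
    using i1 by (intro M.integral_ge_const) (auto simp: Gl)
  moreover have "- C \<le> (\<integral>\<omega>. \<integral>y. G (stop_at n (path \<omega>)) y \<partial>P (X n \<omega>) \<partial>M)"
    using i2 by (intro M.integral_ge_const) (auto simp: kl)
  ultimately show ?thesis using eq by (subst (asm) ennreal_inj) auto
qed

lemma martingale_second_moment:
  fixes d :: "'a \<Rightarrow> 'a \<Rightarrow> real"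
  assumes d [measurable]: "(\<lambda>(x, y). d x y) \<in> borel_measurable (borel \<Otimes>\<^sub>M borel)"
    and C: "\<And>x y. \<bar>d x y\<bar> \<le> C" and mart: "\<And>x. (\<integral>y. d x y \<partial>P x) = 0"
  shows "(\<integral>\<omega>. (\<Sum>k<n. d (X k \<omega>) (X (Suc k) \<omega>))\<^sup>2 \<partial>M) \<le> real n * C\<^sup>2"
proof (induction n)
  case (Suc n)
  let ?D = "\<lambda>k \<omega>. d (X k \<omega>) (X (Suc k) \<omega>)"
  let ?S = "\<lambda>\<omega>. \<Sum>k<n. ?D k \<omega>"
  have Dm [measurable]: "?D k \<in> borel_measurable M" for k
    using measurable_compose[OF _ d, of "\<lambda>\<omega>. (X k \<omega>, X (Suc k) \<omega>)" M] by simp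
  have dm: "(\<lambda>\<xi>. d (\<xi> k) (\<xi> l)) \<in> borel_measurable path_space" for k l :: nat
    using measurable_compose[OF _ d, of "\<lambda>\<xi>. (\<xi> k, \<xi> l)" path_space] by simp
  have Sb: "\<bar>\<Sum>k<n. d (\<xi> k) (\<xi> (Suc k))\<bar> \<le> real n * C" for \<xi>
    using sum_bounded_above[of "{..<n}" "\<lambda>k. \<bar>d (\<xi> k) (\<xi> (Suc k))\<bar>" C] C
    by (intro order_trans[OF sum_abs]) auto
  have C0: "0 \<le> C" using C abs_ge_zero order_trans by blast
  have orth: "(\<integral>\<omega>. ?S \<omega> * ?D n \<omega> \<partial>M) = 0"
  proof -
    define G where "G = (\<lambda>\<xi> y. (\<Sum>k<n. d (\<xi> k) (\<xi> (Suc k))) * d (\<xi> n) y)"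
    have meas: "(\<lambda>(\<xi>, y). G \<xi> y) \<in> borel_measurable (path_space \<Otimes>\<^sub>M borel)"
    proof -
      have "(\<lambda>z. d (fst z n) (snd z)) \<in> borel_measurable (path_space \<Otimes>\<^sub>M borel)"
        using measurable_compose[OF _ d, of "\<lambda>z. (fst z n, snd z)" "path_space \<Otimes>\<^sub>M borel"] by simp
      moreover have "(\<lambda>z. \<Sum>k<n. d (fst z k) (fst z (Suc k))) \<in> borel_measurable (path_space \<Otimes>\<^sub>M borel)"
        by (intro borel_measurable_sum measurable_compose[OF measurable_fst dm])
      ultimately show ?thesis unfolding G_def split_beta' by (intro borel_measurable_times)
    qed
    have bound: "\<bar>G \<xi> y\<bar> \<le> real n * C * C" for \<xi> y
      unfolding G_def abs_mult using Sb C C0 by (intro mult_mono) auto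
    have "(\<integral>\<omega>. ?S \<omega> * ?D n \<omega> \<partial>M) = (\<integral>\<omega>. G (stop_at n (path \<omega>)) (X (Suc n) \<omega>) \<partial>M)"
      unfolding G_def by (intro Bochner_Integration.integral_cong refl) (simp add: Suc_le_eq cong: sum.cong_simp)
    also have "\<dots> = (\<integral>\<omega>. \<integral>y. G (stop_at n (path \<omega>)) y \<partial>P (X n \<omega>) \<partial>M)"
      by (rule markov_expectation[OF meas bound])
    also have "\<dots> = 0" by (simp add: G_def mart)
    finally show ?thesis .
  qed
  have Sb': "\<bar>?S \<omega>\<bar> \<le> real n * C" for \<omega> using Sb[of "path \<omega>"] by simp
  have "(?S \<omega>)\<^sup>2 \<le> (real n * C)\<^sup>2" for \<omega>
    using Sb'[of \<omega>] C0 by (intro iffD1[OF abs_le_square_iff]) simp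
  then have i1: "integrable M (\<lambda>\<omega>. (?S \<omega>)\<^sup>2)"
    by (intro M.integrable_const_bound[of _ "(real n * C)\<^sup>2"]) auto
  have "\<bar>?S \<omega> * ?D n \<omega>\<bar> \<le> real n * C * C" for \<omega>
    unfolding abs_mult using C0 by (intro mult_mono Sb' C) auto
  then have i2: "integrable M (\<lambda>\<omega>. ?S \<omega> * ?D n \<omega>)"
    by (intro M.integrable_const_bound[of _ "real n * C * C"]) auto
  have Db: "(?D n \<omega>)\<^sup>2 \<le> C\<^sup>2" for \<omega>
    using C[of "X n \<omega>" "X (Suc n) \<omega>"] C0 by (intro iffD1[OF abs_le_square_iff]) simp
  have i3: "integrable M (\<lambda>\<omega>. (?D n \<omega>)\<^sup>2)"
    by (rule M.integrable_const_bound[of _ "C\<^sup>2"]) (auto simp: Db)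
  have "(\<integral>\<omega>. (\<Sum>k<Suc n. ?D k \<omega>)\<^sup>2 \<partial>M) = (\<integral>\<omega>. (?S \<omega>)\<^sup>2 + 2 * (?S \<omega> * ?D n \<omega>) + (?D n \<omega>)\<^sup>2 \<partial>M)"
    by (simp add: power2_sum algebra_simps)
  also have "\<dots> = (\<integral>\<omega>. (?S \<omega>)\<^sup>2 \<partial>M) + (\<integral>\<omega>. (?D n \<omega>)\<^sup>2 \<partial>M)"
    using i1 i2 i3 orth by simp
  also have "\<dots> \<le> real n * C\<^sup>2 + C\<^sup>2"
  proof (rule add_mono[OF Suc])
    have "(\<integral>\<omega>. (?D n \<omega>)\<^sup>2 \<partial>M) \<le> (\<integral>\<omega>. C\<^sup>2 \<partial>M)"
      by (intro integral_mono i3) (auto simp: Db)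
    then show "(\<integral>\<omega>. (?D n \<omega>)\<^sup>2 \<partial>M) \<le> C\<^sup>2" by (simp add: M.prob_space)
  qed
  finally show ?case by (simp add: algebra_simps)
qed simp

lemma martingale_first_moment:
  fixes d :: "'a \<Rightarrow> 'a \<Rightarrow> real"
  assumes d [measurable]: "(\<lambda>(x, y). d x y) \<in> borel_measurable (borel \<Otimes>\<^sub>M borel)"
    and C: "\<And>x y. \<bar>d x y\<bar> \<le> C" and mart: "\<And>x. (\<integral>y. d x y \<partial>P x) = 0"
  shows "(\<integral>\<omega>. \<bar>\<Sum>k<n. d (X k \<omega>) (X (Suc k) \<omega>)\<bar> \<partial>M) \<le> C * sqrt (real n)"
proof -
  let ?D = "\<lambda>k \<omega>. d (X k \<omega>) (X (Suc k) \<omega>)"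
  let ?S = "\<lambda>\<omega>. \<Sum>k<n. ?D k \<omega>"
  have [measurable]: "?D k \<in> borel_measurable M" for k
    using measurable_compose[OF _ d, of "\<lambda>\<omega>. (X k \<omega>, X (Suc k) \<omega>)" M] by simp
  have Sb: "\<bar>?S \<omega>\<bar> \<le> real n * C" for \<omega>
    using sum_bounded_above[of "{..<n}" "\<lambda>k. \<bar>?D k \<omega>\<bar>" C] C
    by (intro order_trans[OF sum_abs]) auto
  have C0: "0 \<le> C" using C abs_ge_zero order_trans by blast
  have i: "integrable M (\<lambda>\<omega>. \<bar>?S \<omega>\<bar>)"
    by (rule M.integrable_const_bound[of _ "real n * C"]) (use Sb in simp_all)
  have "(?S \<omega>)\<^sup>2 \<le> (real n * C)\<^sup>2" for \<omega>
    using Sb[of \<omega>] C0 by (intro iffD1[OF abs_le_square_iff]) simp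
  then have i2: "integrable M (\<lambda>\<omega>. (?S \<omega>)\<^sup>2)"
    by (intro M.integrable_const_bound[of _ "(real n * C)\<^sup>2"]) simp_all
  have "(\<integral>\<omega>. \<bar>?S \<omega>\<bar> \<partial>M)\<^sup>2 \<le> (\<integral>\<omega>. \<bar>?S \<omega>\<bar>\<^sup>2 \<partial>M)"
  proof -
    have "integrable M (\<lambda>\<omega>. \<bar>?S \<omega>\<bar>\<^sup>2)" using i2 by (simp only: power2_abs)
    from M.variance_eq[OF i this] M.variance_positive[of "\<lambda>\<omega>. \<bar>?S \<omega>\<bar>"] show ?thesis by linarith
  qed
  also have "\<dots> \<le> real n * C\<^sup>2"
    using martingale_second_moment[OF assms, of n] by (simp only: power2_abs)
  also have "\<dots> = (C * sqrt (real n))\<^sup>2" by (simp only: power_mult_distrib real_sqrt_pow2[OF of_nat_0_le_iff] mult.commute)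
  finally show ?thesis by (rule power2_le_imp_le) (simp add: C0)
qed

text \<open>
  An approximate solution \<open>u\<close> of the Poisson equation splits \<open>g\<close> into \<open>u - P u\<close>, whose sum along the
  chain is a martingale up to boundary terms and hence of order \<open>\<surd>n\<close>, and a remainder \<open>P (A\<^sub>m g)\<close>, which
  is small in \<open>L\<^sup>1(\<pi>)\<close> by the ergodic theorem for the operator averages \<open>A\<^sub>m\<close>.
\<close>

lemma ergodic_average_bounded:
  assumes irr: "phi_irreducible P" and g: "bdd_measurable g" and g0: "(\<integral>x. g x \<partial>\<pi>) = 0"
  shows "(\<lambda>n. \<integral>\<omega>. \<bar>\<Sum>k<n. g (X k \<omega>)\<bar> / real n \<partial>M) \<longlonglongrightarrow> 0"
proof (rule LIMSEQ_I)
  fix r :: real assume r: "0 < r"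
  have "(\<lambda>n. \<integral>x. \<bar>orbit_sum g n x / real n\<bar> \<partial>\<pi>) \<longlonglongrightarrow> 0"
    using mean_ergodic_operator[OF irr g] by (simp add: g0)
  then have "eventually (\<lambda>n. (\<integral>x. \<bar>orbit_sum g n x / real n\<bar> \<partial>\<pi>) < r / 2 \<and> 0 < n) sequentially"
    using r by (intro eventually_conj order_tendstoD(2) eventually_gt_at_top) auto
  then obtain m where m: "(\<integral>x. \<bar>orbit_sum g m x / real m\<bar> \<partial>\<pi>) < r / 2" and "0 < m"
    using eventually_happens'[OF sequentially_bot] by blast
  (* the Cesaro mean of the partial sums solves g = u - P u up to the averaged iterate b *)
  define u where "u = (\<lambda>x. (1 / real m) * (\<Sum>j<m. orbit_sum g (Suc j) x))"
  define b where "b = (\<lambda>x. kernel_op (\<lambda>x. orbit_sum g m x / real m) x)"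
  have bavg: "bdd_measurable (\<lambda>x. orbit_sum g m x / real m)"
    using bdd_measurable_cmult[OF orbit_sum_bdd_measurable[OF g], of "1 / real m" m] by simp
  have bb: "bdd_measurable b" unfolding b_def by (rule kernel_op_bdd_measurable[OF bavg])
  have bu: "bdd_measurable u" unfolding u_def by (intro bdd_measurable_cmult bdd_measurable_sum orbit_sum_bdd_measurable g)
  have poisson: "g x = u x - kernel_op u x + b x" for x
  proof -
    have "kernel_op u x = (1 / real m) * (\<Sum>j<m. kernel_op (orbit_sum g (Suc j)) x)"
      unfolding u_def by (subst kernel_op_cmult, subst kernel_op_sum) (auto intro: orbit_sum_bdd_measurable g)
    also have "(\<Sum>j<m. kernel_op (orbit_sum g (Suc j)) x) = (\<Sum>j<m. orbit_sum g (Suc j) x - g x + (kernel_op ^^ Suc j) g x)"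
      using orbit_sum_Suc[OF g] by (intro sum.cong refl) (simp add: orbit_sum_def eq_diff_eq[symmetric])
    also have "\<dots> = (\<Sum>j<m. orbit_sum g (Suc j) x) - real m * g x + (\<Sum>j<m. (kernel_op ^^ Suc j) g x)"
      by (simp add: sum.distrib sum_subtractf)
    also have "(\<Sum>j<m. (kernel_op ^^ Suc j) g x) = real m * b x"
    proof -
      have "b x = (1 / real m) * kernel_op (orbit_sum g m) x"
        unfolding b_def using kernel_op_cmult[of "1 / real m" "orbit_sum g m" x] by simp
      also have "kernel_op (orbit_sum g m) x = (\<Sum>j<m. (kernel_op ^^ Suc j) g x)"
        unfolding orbit_sum_def[abs_def] by (subst kernel_op_sum) (auto intro: kernel_op_pow_bdd_measurable g)
      finally show ?thesis using \<open>0 < m\<close> by simp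
    qed
    finally show ?thesis using \<open>0 < m\<close> by (simp add: u_def field_simps)
  qed
  obtain U where U: "\<And>x. \<bar>u x\<bar> \<le> U" and um [measurable]: "u \<in> borel_measurable borel"
    using bu by (auto simp: bdd_measurable_def)
  have bm [measurable]: "b \<in> borel_measurable borel" using bb by (rule bdd_measurable_measurable)
  have gm [measurable]: "g \<in> borel_measurable borel" using g by (rule bdd_measurable_measurable)
  define d where "d = (\<lambda>x y. u y - kernel_op u x)"
  have dm: "(\<lambda>(x, y). d x y) \<in> borel_measurable (borel \<Otimes>\<^sub>M borel)"
    unfolding d_def by measurable
  have dC: "\<bar>d x y\<bar> \<le> 2 * U" for x y
    unfolding d_def using U[of y] kernel_op_abs_le[OF um U, of x] by simp
  have mart: "(\<integral>y. d x y \<partial>P x) = 0" for x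
  proof -
    have "(\<integral>y. u y - kernel_op u x \<partial>P x) = (\<integral>y. u y \<partial>P x) - kernel_op (\<lambda>_. kernel_op u x) x"
      unfolding kernel_op_def[of "\<lambda>_. kernel_op u x"]
      by (intro Bochner_Integration.integral_diff bdd_measurable_integrable bu bdd_measurable_const)
    then show ?thesis by (simp add: d_def kernel_op_def[of u, symmetric])
  qed
  let ?S = "\<lambda>n \<omega>. \<Sum>k<n. g (X k \<omega>)"
  let ?D = "\<lambda>n \<omega>. \<Sum>k<n. d (X k \<omega>) (X (Suc k) \<omega>)"
  have split: "?S n \<omega> = (u (X 0 \<omega>) - u (X n \<omega>)) + ?D n \<omega> + (\<Sum>k<n. b (X k \<omega>))" for n \<omega>
    by (induction n) (auto simp: d_def poisson)
  have "U \<ge> 0" using U abs_ge_zero order_trans by blast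
  have iD: "integrable M (\<lambda>\<omega>. \<bar>?D n \<omega>\<bar>)" for n
    by (intro integrable_abs Bochner_Integration.integrable_sum M.integrable_const_bound[of _ "2 * U"])
      (auto simp: dC, auto simp: d_def)
  have ib: "integrable M (\<lambda>\<omega>. \<Sum>k<n. \<bar>b (X k \<omega>)\<bar>)" for n
    by (intro Bochner_Integration.integrable_sum integrable_abs integrable_X bdd_measurable_integrable bb)
  have iS: "integrable M (\<lambda>\<omega>. \<bar>?S n \<omega>\<bar>)" for n
    by (intro integrable_abs Bochner_Integration.integrable_sum integrable_X bdd_measurable_integrable g)
  have b_le: "(\<integral>x. \<bar>b x\<bar> \<partial>\<pi>) \<le> (\<integral>x. \<bar>orbit_sum g m x / real m\<bar> \<partial>\<pi>)"
  proof -
    let ?a = "\<lambda>x. orbit_sum g m x / real m"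
    have ba: "bdd_measurable (\<lambda>x. \<bar>?a x\<bar>)"
      using bavg unfolding bdd_measurable_def by (auto intro: borel_measurable_abs simp del: abs_divide)
    have "\<bar>b x\<bar> \<le> kernel_op (\<lambda>x. \<bar>?a x\<bar>) x" for x
      unfolding b_def kernel_op_def by (rule integral_abs_bound)
    then have "(\<integral>x. \<bar>b x\<bar> \<partial>\<pi>) \<le> (\<integral>x. kernel_op (\<lambda>x. \<bar>?a x\<bar>) x \<partial>\<pi>)"
      by (intro integral_mono integrable_abs bdd_measurable_integrable bb kernel_op_bdd_measurable ba)
    also have "\<dots> = (\<integral>x. \<bar>?a x\<bar> \<partial>\<pi>)" by (rule integral_kernel_op[OF ba])
    finally show ?thesis .
  qed
  have b_half: "(\<integral>x. \<bar>b x\<bar> \<partial>\<pi>) \<le> r / 2" using b_le m by linarith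
  have bound: "(\<integral>\<omega>. \<bar>?S n \<omega>\<bar> / real n \<partial>M) \<le> (2 * U) / real n + 2 * U / sqrt (real n) + r / 2" if "0 < n" for n
  proof -
    have "(\<integral>\<omega>. \<bar>?S n \<omega>\<bar> \<partial>M) \<le> (\<integral>\<omega>. 2 * U + \<bar>?D n \<omega>\<bar> + (\<Sum>k<n. \<bar>b (X k \<omega>)\<bar>) \<partial>M)"
    proof (rule integral_mono[OF iS])
      show "integrable M (\<lambda>\<omega>. 2 * U + \<bar>?D n \<omega>\<bar> + (\<Sum>k<n. \<bar>b (X k \<omega>)\<bar>))"
        by (intro Bochner_Integration.integrable_add iD ib) simp
      fix \<omega>
      show "\<bar>?S n \<omega>\<bar> \<le> 2 * U + \<bar>?D n \<omega>\<bar> + (\<Sum>k<n. \<bar>b (X k \<omega>)\<bar>)"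
        unfolding split using U[of "X 0 \<omega>"] U[of "X n \<omega>"] sum_abs[of "\<lambda>k. b (X k \<omega>)" "{..<n}"] by linarith
    qed
    also have "\<dots> = 2 * U + (\<integral>\<omega>. \<bar>?D n \<omega>\<bar> \<partial>M) + (\<integral>\<omega>. (\<Sum>k<n. \<bar>b (X k \<omega>)\<bar>) \<partial>M)"
      using iD ib by (simp add: M.prob_space)
    also have "(\<integral>\<omega>. (\<Sum>k<n. \<bar>b (X k \<omega>)\<bar>) \<partial>M) = real n * (\<integral>x. \<bar>b x\<bar> \<partial>\<pi>)"
    proof -
      have "(\<integral>\<omega>. (\<Sum>k<n. \<bar>b (X k \<omega>)\<bar>) \<partial>M) = (\<Sum>k<n. \<integral>\<omega>. \<bar>b (X k \<omega>)\<bar> \<partial>M)"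
        by (intro Bochner_Integration.integral_sum integrable_abs integrable_X bdd_measurable_integrable bb)
      also have "\<dots> = (\<Sum>k<n. \<integral>x. \<bar>b x\<bar> \<partial>\<pi>)"
        by (intro sum.cong refl integral_X[of "\<lambda>x. \<bar>b x\<bar>"]) measurable
      finally show ?thesis by simp
    qed
    also have "2 * U + (\<integral>\<omega>. \<bar>?D n \<omega>\<bar> \<partial>M) + real n * (\<integral>x. \<bar>b x\<bar> \<partial>\<pi>) \<le> 2 * U + 2 * U * sqrt (real n) + real n * (r / 2)"
      using b_half by (intro add_mono mult_left_mono order.refl martingale_first_moment[OF dm dC mart]) auto
    finally have "(\<integral>\<omega>. \<bar>?S n \<omega>\<bar> \<partial>M) / real n \<le> (2 * U + 2 * U * sqrt (real n) + real n * (r / 2)) / real n"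
      by (intro divide_right_mono) auto
    also have "\<dots> = (2 * U) / real n + 2 * U / sqrt (real n) + r / 2"
    proof -
      have "sqrt (real n) / real n = 1 / sqrt (real n)"
        by (simp add: sqrt_divide_self_eq inverse_eq_divide)
      then have "2 * U * sqrt (real n) / real n = 2 * U / sqrt (real n)"
        by (metis times_divide_eq_right mult.right_neutral)
      then show ?thesis using that by (simp add: add_divide_distrib)
    qed
    finally show ?thesis by simp
  qed
  have "(\<lambda>n. (2 * U) / real n + 2 * U / sqrt (real n) + r / 2) \<longlonglongrightarrow> 0 + 0 + r / 2"
    by (intro tendsto_add tendsto_const lim_const_over_n
      tendsto_divide_0[OF tendsto_const] filterlim_at_top_imp_at_infinity
      filterlim_compose[OF sqrt_at_top filterlim_real_sequentially])
  then have "eventually (\<lambda>n. (2 * U) / real n + 2 * U / sqrt (real n) + r / 2 < r) sequentially"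
    by (rule order_tendstoD(2)) (use r in simp)
  then have "eventually (\<lambda>n. (2 * U) / real n + 2 * U / sqrt (real n) + r / 2 < r \<and> 0 < n) sequentially"
    by (rule eventually_conj[OF _ eventually_gt_at_top])
  then obtain N where N: "\<And>n. n \<ge> N \<Longrightarrow> (2 * U) / real n + 2 * U / sqrt (real n) + r / 2 < r \<and> 0 < n"
    by (auto simp: eventually_sequentially)
  have "norm ((\<integral>\<omega>. \<bar>?S n \<omega>\<bar> / real n \<partial>M) - 0) < r" if "N \<le> n" for n
  proof -
    have "0 \<le> (\<integral>\<omega>. \<bar>?S n \<omega>\<bar> / real n \<partial>M)" by (intro integral_nonneg_AE) auto
    then show ?thesis using bound[of n] N[OF that] by auto
  qed
  then show "\<exists>no. \<forall>n\<ge>no. norm ((\<integral>\<omega>. \<bar>?S n \<omega>\<bar> / real n \<partial>M) - 0) < r" by blast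
qed

lemma ergodic_average:
  fixes f :: "'a \<Rightarrow> real"
  assumes irr: "phi_irreducible P" and f: "integrable \<pi> f"
  shows "(\<lambda>n. \<integral>\<omega>. \<bar>(\<Sum>k<n. f (X k \<omega>)) / real n - (\<integral>x. f x \<partial>\<pi>)\<bar> \<partial>M) \<longlonglongrightarrow> 0"
proof (rule LIMSEQ_I)
  fix r :: real assume r: "0 < r"
  have fm [measurable]: "f \<in> borel_measurable borel" using f by (auto dest: borel_measurable_integrable)
  obtain K where K: "0 \<le> K" "(\<integral>x. \<bar>f x\<bar> * of_bool (K < \<bar>f x\<bar>) \<partial>\<pi>) < r / 4"
    using integrable_tail_small[OF f, of "r / 4"] r by auto
  define t where "t = (\<lambda>x. f x * of_bool (\<bar>f x\<bar> \<le> K))"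
  define e where "e = (\<lambda>x. f x * of_bool (K < \<bar>f x\<bar>))"
  have fte: "f x = t x + e x" for x by (simp add: t_def e_def)
  have [measurable]: "t \<in> borel_measurable borel" "e \<in> borel_measurable borel"
    unfolding t_def e_def by measurable
  have bt: "bdd_measurable t" by (rule bdd_measurableI[of _ K]) (use K in \<open>auto simp: t_def\<close>)
  have it: "integrable \<pi> t" by (rule bdd_measurable_integrable[OF bt])
  have ie: "integrable \<pi> e"
    by (rule Bochner_Integration.integrable_bound[OF f]) (auto simp: e_def)
  have e_small: "(\<integral>x. \<bar>e x\<bar> \<partial>\<pi>) < r / 4"
    using K(2) by (simp add: e_def abs_mult)
  define g where "g = (\<lambda>x. t x - (\<integral>x. t x \<partial>\<pi>))"
  have bg: "bdd_measurable g" unfolding g_def by (intro bdd_measurable_diff bt bdd_measurable_const)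
  have [measurable]: "g \<in> borel_measurable borel" unfolding g_def by measurable
  have g0: "(\<integral>x. g x \<partial>\<pi>) = 0"
    unfolding g_def using it by (simp add: prob_space[simplified])
  have "eventually (\<lambda>n. (\<integral>\<omega>. \<bar>\<Sum>k<n. g (X k \<omega>)\<bar> / real n \<partial>M) < r / 4 \<and> 0 < n) sequentially"
    using ergodic_average_bounded[OF irr bg g0] r
    by (intro eventually_conj order_tendstoD(2) eventually_gt_at_top) auto
  then obtain N where N: "\<And>n. n \<ge> N \<Longrightarrow> (\<integral>\<omega>. \<bar>\<Sum>k<n. g (X k \<omega>)\<bar> / real n \<partial>M) < r / 4 \<and> 0 < n"
    by (auto simp: eventually_sequentially)
  have "norm ((\<integral>\<omega>. \<bar>(\<Sum>k<n. f (X k \<omega>)) / real n - (\<integral>x. f x \<partial>\<pi>)\<bar> \<partial>M) - 0) < r" if "N \<le> n" for n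
  proof -
    have n: "0 < n" and small: "(\<integral>\<omega>. \<bar>\<Sum>k<n. g (X k \<omega>)\<bar> / real n \<partial>M) < r / 4" using N[OF that] by auto
    have intf: "(\<integral>x. f x \<partial>\<pi>) = (\<integral>x. t x \<partial>\<pi>) + (\<integral>x. e x \<partial>\<pi>)" using it ie by (simp add: fte)
    have i1: "integrable M (\<lambda>\<omega>. \<bar>\<Sum>k<n. g (X k \<omega>)\<bar> / real n)"
      by (intro integrable_divide integrable_abs Bochner_Integration.integrable_sum integrable_X bdd_measurable_integrable bg)
    have i2: "integrable M (\<lambda>\<omega>. (\<Sum>k<n. \<bar>e (X k \<omega>)\<bar>) / real n)"
      by (intro integrable_divide Bochner_Integration.integrable_sum integrable_abs integrable_X ie)
    have "(\<integral>\<omega>. \<bar>(\<Sum>k<n. f (X k \<omega>)) / real n - (\<integral>x. f x \<partial>\<pi>)\<bar> \<partial>M)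
      \<le> (\<integral>\<omega>. \<bar>\<Sum>k<n. g (X k \<omega>)\<bar> / real n + (\<Sum>k<n. \<bar>e (X k \<omega>)\<bar>) / real n + (\<integral>x. \<bar>e x\<bar> \<partial>\<pi>) \<partial>M)"
    proof (rule integral_mono)
      show "integrable M (\<lambda>\<omega>. \<bar>(\<Sum>k<n. f (X k \<omega>)) / real n - (\<integral>x. f x \<partial>\<pi>)\<bar>)"
        by (intro integrable_abs Bochner_Integration.integrable_diff integrable_divide
          Bochner_Integration.integrable_sum integrable_X f) simp
      show "integrable M (\<lambda>\<omega>. \<bar>\<Sum>k<n. g (X k \<omega>)\<bar> / real n + (\<Sum>k<n. \<bar>e (X k \<omega>)\<bar>) / real n + (\<integral>x. \<bar>e x\<bar> \<partial>\<pi>))"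
        by (intro Bochner_Integration.integrable_add i1 i2) simp
      fix \<omega>
      have "(\<Sum>k<n. f (X k \<omega>)) / real n - (\<integral>x. f x \<partial>\<pi>)
        = (\<Sum>k<n. g (X k \<omega>)) / real n + (\<Sum>k<n. e (X k \<omega>)) / real n - (\<integral>x. e x \<partial>\<pi>)"
        using n unfolding intf g_def by (simp add: fte sum.distrib sum_subtractf field_simps)
      moreover have "\<bar>(\<Sum>k<n. e (X k \<omega>)) / real n\<bar> \<le> (\<Sum>k<n. \<bar>e (X k \<omega>)\<bar>) / real n"
        by (simp add: divide_right_mono)
      moreover have "\<bar>\<integral>x. e x \<partial>\<pi>\<bar> \<le> (\<integral>x. \<bar>e x\<bar> \<partial>\<pi>)" by (rule integral_abs_bound)
      moreover have "\<bar>(\<Sum>k<n. g (X k \<omega>)) / real n\<bar> = \<bar>\<Sum>k<n. g (X k \<omega>)\<bar> / real n" by simp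
      ultimately show "\<bar>(\<Sum>k<n. f (X k \<omega>)) / real n - (\<integral>x. f x \<partial>\<pi>)\<bar>
        \<le> \<bar>\<Sum>k<n. g (X k \<omega>)\<bar> / real n + (\<Sum>k<n. \<bar>e (X k \<omega>)\<bar>) / real n + (\<integral>x. \<bar>e x\<bar> \<partial>\<pi>)"
        by linarith
    qed
    also have "\<dots> = (\<integral>\<omega>. \<bar>\<Sum>k<n. g (X k \<omega>)\<bar> / real n \<partial>M) + (\<integral>\<omega>. (\<Sum>k<n. \<bar>e (X k \<omega>)\<bar>) / real n \<partial>M) + (\<integral>x. \<bar>e x\<bar> \<partial>\<pi>)"
      using Bochner_Integration.integral_add[OF Bochner_Integration.integrable_add[OF i1 i2], of "\<lambda>_. \<integral>x. \<bar>e x\<bar> \<partial>\<pi>"]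
        Bochner_Integration.integral_add[OF i1 i2] by (simp add: M.prob_space)
    also have "(\<integral>\<omega>. (\<Sum>k<n. \<bar>e (X k \<omega>)\<bar>) / real n \<partial>M) = (\<integral>x. \<bar>e x\<bar> \<partial>\<pi>)"
    proof -
      have "(\<integral>\<omega>. (\<Sum>k<n. \<bar>e (X k \<omega>)\<bar>) / real n \<partial>M) = (\<Sum>k<n. \<integral>\<omega>. \<bar>e (X k \<omega>)\<bar> \<partial>M) / real n"
        using ie by (subst Bochner_Integration.integral_sum[symmetric]) (auto intro!: integrable_abs integrable_X)
      also have "(\<Sum>k<n. \<integral>\<omega>. \<bar>e (X k \<omega>)\<bar> \<partial>M) = (\<Sum>k<n. \<integral>x. \<bar>e x\<bar> \<partial>\<pi>)"
        by (intro sum.cong refl integral_X[of "\<lambda>x. \<bar>e x\<bar>"]) measurable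
      finally show ?thesis using n by simp
    qed
    finally have "(\<integral>\<omega>. \<bar>(\<Sum>k<n. f (X k \<omega>)) / real n - (\<integral>x. f x \<partial>\<pi>)\<bar> \<partial>M) < r"
      using small e_small r by linarith
    moreover have "0 \<le> (\<integral>\<omega>. \<bar>(\<Sum>k<n. f (X k \<omega>)) / real n - (\<integral>x. f x \<partial>\<pi>)\<bar> \<partial>M)"
      by (intro integral_nonneg_AE) auto
    ultimately show ?thesis by simp
  qed
  then show "\<exists>no. \<forall>n\<ge>no. norm ((\<integral>\<omega>. \<bar>(\<Sum>k<n. f (X k \<omega>)) / real n - (\<integral>x. f x \<partial>\<pi>)\<bar> \<partial>M) - 0) < r" by blast
qed

end

section \<open>Perturbing the holding times\<close>

text \<open>
  Multiplied by \<open>N\<close>, the error of the linearisation of \<open>exp(i u / N)\<close> is at most \<open>u\<^sup>2 / N\<close>, which is useful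
  for small \<open>u\<close>, and at most \<open>2 \<bar>u\<bar>\<close>, which is all that is available in the tails of a function without
  second moment. The level \<open>K\<close> separates the two regimes.
\<close>

lemma iexp_linear_error:
  fixes u x y K N :: real
  assumes u: "\<bar>u\<bar> \<le> x + y" and K: "0 \<le> K" and xy: "0 \<le> x" "0 \<le> y" and N: "0 < N"
  shows "cmod (of_real N * (iexp (u / N) - 1) - \<i> * u) \<le>
    4 * K\<^sup>2 / N + 4 * (x * of_bool (K < x)) + 4 * (y * of_bool (K < y))"
proof -
  let ?th = "u / N"
  have eq: "of_real N * (iexp ?th - 1) - \<i> * u = of_real N * (iexp ?th - (\<Sum>k \<le> 1. (\<i> * ?th)^k / fact k))"
    using N by (simp add: algebra_simps)
  have n: "cmod (of_real N * (iexp ?th - 1) - \<i> * u) = N * cmod (iexp ?th - (\<Sum>k \<le> 1. (\<i> * ?th)^k / fact k))"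
    unfolding eq norm_mult using N by simp
  have 1: "cmod (of_real N * (iexp ?th - 1) - \<i> * u) \<le> u\<^sup>2 / N"
  proof -
    have "N * cmod (iexp ?th - (\<Sum>k \<le> 1. (\<i> * ?th)^k / fact k)) \<le> N * (\<bar>?th\<bar>^(Suc 1) / fact (Suc 1))"
      using N by (intro mult_left_mono iexp_approx1) auto
    also have "\<dots> = (u\<^sup>2 / N) / 2" using N by (simp add: power2_eq_square field_simps)
    also have "\<dots> \<le> u\<^sup>2 / N"
    proof -
      have "a / 2 \<le> a" if "0 \<le> a" for a :: real using that by simp
      then show ?thesis using N by (meson divide_nonneg_pos zero_le_power2)
    qed
    finally show ?thesis unfolding n .
  qed
  have 2: "cmod (of_real N * (iexp ?th - 1) - \<i> * u) \<le> 2 * \<bar>u\<bar>"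
  proof -
    have "N * cmod (iexp ?th - (\<Sum>k \<le> 1. (\<i> * ?th)^k / fact k)) \<le> N * (2 * \<bar>?th\<bar>^1 / fact 1)"
      using N by (intro mult_left_mono iexp_approx2) auto
    also have "\<dots> = 2 * \<bar>u\<bar>" using N by (simp add: abs_divide)
    finally show ?thesis unfolding n .
  qed
  show ?thesis
  proof (cases "x \<le> K \<and> y \<le> K")
    case True
    then have "u\<^sup>2 \<le> (2 * K)\<^sup>2" using u K by (intro iffD1[OF abs_le_square_iff]) simp
    then have "u\<^sup>2 / N \<le> 4 * K\<^sup>2 / N" using N by (simp add: power_mult_distrib divide_right_mono)
    then show ?thesis using 1 True by simp
  next
    case False
    then have "2 * (x + y) \<le> 4 * (x * of_bool (K < x)) + 4 * (y * of_bool (K < y))"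
      using xy by (auto simp: not_le)
    moreover have "0 \<le> 4 * K\<^sup>2 / N" using N by simp
    moreover have "2 * \<bar>u\<bar> \<le> 2 * (x + y)" using u by simp
    ultimately have "2 * \<bar>u\<bar> \<le> 4 * K\<^sup>2 / N + (4 * (x * of_bool (K < x)) + 4 * (y * of_bool (K < y)))"
      by (intro order_trans[of "2 * \<bar>u\<bar>", OF _ add_increasing]) auto
    with 2 show ?thesis by (simp only: add.assoc)
  qed
qed

lemma cmod_iexp_minus_1_le: "cmod (iexp x - 1) \<le> \<bar>x\<bar>"
  using iexp_approx1[of x 0] by simp

text \<open>
  The inserted step contributes the diagonal term; the delay pushes the last term out of the sum.
\<close>

lemma sum_insert_hold:
  fixes \<beta> :: "'a \<Rightarrow> 'a \<Rightarrow> real"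
  assumes "k < n"
  shows "(\<Sum>j<n. \<beta> (insert_hold k \<xi> j) (insert_hold k \<xi> (Suc j))) =
    (\<Sum>j<n. \<beta> (\<xi> j) (\<xi> (Suc j))) + \<beta> (\<xi> k) (\<xi> k) - \<beta> (\<xi> (n - 1)) (\<xi> n)"
  using Suc_leI[OF assms]
proof (induction n rule: dec_induct)
  case base
  have "(\<Sum>j<k. \<beta> (insert_hold k \<xi> j) (insert_hold k \<xi> (Suc j))) = (\<Sum>j<k. \<beta> (\<xi> j) (\<xi> (Suc j)))"
    by (intro sum.cong refl) (simp add: insert_hold_def)
  then show ?case by (simp add: insert_hold_def)
next
  case (step n)
  then show ?case by (simp add: insert_hold_def)
qed

text \<open>
  The weight \<open>w\<close> says how strongly holding in each state is perturbed. The argument \<open>t\<close> of the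
  characteristic function is fixed; the strength \<open>s\<close> of the perturbation varies.
\<close>

locale hold_perturbation = stationary_chain P \<pi> M X
  for P :: "'a::polish_space \<Rightarrow> 'a measure" and \<pi> and M :: "'w measure" and X +
  fixes h w :: "'a \<Rightarrow> real" and C t :: real
  assumes irr: "phi_irreducible P"
    and h_integrable: "integrable \<pi> h" and h_mean: "(\<integral>x. h x \<partial>\<pi>) = 0"
    and w_measurable [measurable]: "w \<in> borel_measurable borel" and w_bound: "\<And>x. \<bar>w x\<bar> \<le> C"
begin

lemma h_measurable [measurable]: "h \<in> borel_measurable borel"
  using borel_measurable_integrable[OF h_integrable] by simp

lemma C_nonneg: "0 \<le> C"
  using w_bound abs_ge_zero order_trans by blast

definition \<phi> :: "'a \<Rightarrow> real" where
  "\<phi> x = w x * holding_prob P x"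

text \<open>
  For \<open>\<bar>s\<bar>\<close> small, \<open>1 + s \<zeta>(x, y)\<close> is the density, relative to \<open>P\<close>, of a kernel that holds slightly longer or shorter
  than \<open>P\<close> but moves to the same states. Thus \<open>\<zeta>\<close> is the score of a change of speed.
\<close>

definition \<zeta> :: "'a \<Rightarrow> 'a \<Rightarrow> real" where
  "\<zeta> x y = w x * (of_bool (y = x) - holding_prob P x)"

definition \<beta> :: "real \<Rightarrow> 'a \<Rightarrow> 'a \<Rightarrow> real" where
  "\<beta> s x y = t * h x + s * \<zeta> x y"

definition W :: "nat \<Rightarrow> real \<Rightarrow> (nat \<Rightarrow> 'a) \<Rightarrow> real" where
  "W n s \<xi> = (\<Sum>k<n. \<beta> s (\<xi> k) (\<xi> (Suc k))) / sqrt (real n)"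

definition Z :: "nat \<Rightarrow> (nat \<Rightarrow> 'a) \<Rightarrow> real" where
  "Z n \<xi> = (\<Sum>k<n. \<zeta> (\<xi> k) (\<xi> (Suc k))) / sqrt (real n)"

definition J :: "nat \<Rightarrow> real \<Rightarrow> complex" where
  "J n s = (\<integral>\<omega>. iexp (W n s (path \<omega>)) \<partial>M)"

definition J' :: "nat \<Rightarrow> real \<Rightarrow> complex" where
  "J' n s = (\<integral>\<omega>. \<i> * of_real (Z n (path \<omega>)) * iexp (W n s (path \<omega>)) \<partial>M)"

text \<open>
  With \<open>S\<^sub>n\<close> and \<open>Z\<^sub>n\<close> the sums of \<open>h\<close> and \<open>\<zeta>\<close> along the path, these are the limits of \<open>E[S\<^sub>n Z\<^sub>n] / n\<close>
  and \<open>E[Z\<^sub>n\<^sup>2] / n\<close>. The first is the rate at which a change of speed moves the mean of \<open>h\<close>.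
\<close>

definition cov :: real where "cov = (\<integral>x. \<phi> x * h x \<partial>\<pi>)"

definition var :: real where "var = (\<integral>x. \<phi> x * \<zeta> x x \<partial>\<pi>)"

text \<open>
  A common integrable bound for the increments \<open>\<beta> s x y\<close> with \<open>\<bar>s\<bar> \<le> R\<close>.
\<close>

definition H :: "real \<Rightarrow> 'a \<Rightarrow> real" where
  "H R x = \<bar>t\<bar> * \<bar>h x\<bar> + R * C"

definition tail :: "real \<Rightarrow> real \<Rightarrow> real" where
  "tail R K = (\<integral>x. H R x * of_bool (K < H R x) \<partial>\<pi>)"

lemma \<phi>_measurable [measurable]: "\<phi> \<in> borel_measurable borel"
  unfolding \<phi>_def[abs_def] by measurable

lemma \<zeta>_diag: "\<zeta> x x = w x * moving_prob P x"
  by (simp add: \<zeta>_def moving_prob_def)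

lemma \<zeta>_measurable: "(\<lambda>(x, y). \<zeta> x y) \<in> borel_measurable (borel \<Otimes>\<^sub>M borel)"
  unfolding \<zeta>_def[abs_def] by measurable

lemma \<zeta>_measurable' [measurable (raw)]:
  assumes [measurable]: "f \<in> N \<rightarrow>\<^sub>M borel" "g \<in> N \<rightarrow>\<^sub>M borel"
  shows "(\<lambda>z. \<zeta> (f z) (g z)) \<in> borel_measurable N"
  unfolding \<zeta>_def[abs_def] by measurable

lemma \<beta>_measurable' [measurable (raw)]:
  assumes [measurable]: "f \<in> N \<rightarrow>\<^sub>M borel" "g \<in> N \<rightarrow>\<^sub>M borel"
  shows "(\<lambda>z. \<beta> s (f z) (g z)) \<in> borel_measurable N"
  unfolding \<beta>_def[abs_def] by measurable

lemma H_measurable [measurable]: "H R \<in> borel_measurable borel"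
  unfolding H_def[abs_def] by measurable

lemma W_measurable [measurable]: "W n s \<in> borel_measurable path_space"
  unfolding W_def[abs_def] by measurable

lemma Z_measurable [measurable]: "Z n \<in> borel_measurable path_space"
  unfolding Z_def[abs_def] by measurable

lemma \<phi>_bound: "\<bar>\<phi> x\<bar> \<le> C"
  using w_bound[of x] C_nonneg mult_mono[of "\<bar>w x\<bar>" C "holding_prob P x" 1]
  by (simp add: \<phi>_def abs_mult)

lemma \<zeta>_bound: "\<bar>\<zeta> x y\<bar> \<le> C"
proof -
  have "\<bar>of_bool (y = x) - holding_prob P x\<bar> \<le> 1"
    by (auto simp: abs_le_iff intro: order_trans[OF holding_prob_le_1] order_trans[OF _ holding_prob_nonneg])
  then have "\<bar>w x\<bar> * \<bar>of_bool (y = x) - holding_prob P x\<bar> \<le> C * 1"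
    using w_bound C_nonneg by (intro mult_mono) auto
  then show ?thesis by (simp add: \<zeta>_def abs_mult)
qed

lemma \<beta>_bound: "\<bar>s\<bar> \<le> R \<Longrightarrow> \<bar>\<beta> s x y\<bar> \<le> H R x"
  unfolding \<beta>_def H_def abs_mult[symmetric]
  using \<zeta>_bound[of x y] C_nonneg mult_mono[of "\<bar>s\<bar>" R "\<bar>\<zeta> x y\<bar>" C]
  by (intro order_trans[OF abs_triangle_ineq] add_mono) (auto simp: abs_mult)

lemma H_nonneg: "0 \<le> R \<Longrightarrow> 0 \<le> H R x"
  by (simp add: H_def C_nonneg)

lemma H_integrable: "integrable \<pi> (H R)"
  unfolding H_def[abs_def] using h_integrable by simp

lemma tail_integrable: "integrable \<pi> (\<lambda>x. H R x * of_bool (K < H R x))"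
  by (rule Bochner_Integration.integrable_bound[OF H_integrable[of R]]) (auto simp: of_bool_def)

lemma integral_H_X: "(\<integral>\<omega>. H R (X k \<omega>) \<partial>M) = (\<integral>x. H R x \<partial>\<pi>)"
  by (rule integral_X) measurable

lemma integral_tail_X: "(\<integral>\<omega>. H R (X k \<omega>) * of_bool (K < H R (X k \<omega>)) \<partial>M) = tail R K"
  unfolding tail_def by (rule integral_X[of "\<lambda>x. H R x * of_bool (K < H R x)"]) measurable

lemma \<zeta>_mean: "(\<integral>y. \<zeta> x y \<partial>P x) = 0"
proof -
  interpret Px: prob_space "P x" by (rule prob_space_P)
  have "(\<integral>y. \<zeta> x y \<partial>P x) = w x * ((\<integral>y. indicator {x} y \<partial>P x) - holding_prob P x)"
  proof -
    have "\<zeta> x = (\<lambda>y. w x * (indicator {x} y - holding_prob P x))"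
      by (auto simp: \<zeta>_def indicator_def fun_eq_iff)
    moreover have "(\<integral>y. indicator {x} y - holding_prob P x \<partial>P x) = (\<integral>y. indicator {x} y \<partial>P x) - (\<integral>y. holding_prob P x \<partial>P x)"
      by (intro Bochner_Integration.integral_diff bdd_measurable_integrable bdd_measurable_const bdd_measurableI[of _ 1])
        (auto simp: indicator_def)
    moreover have "(\<integral>y. holding_prob P x \<partial>P x) = holding_prob P x"
      using kernel_op_const[of "holding_prob P x" x] by (simp only: kernel_op_def)
    ultimately show ?thesis by simp
  qed
  then show ?thesis by (simp add: holding_prob_def)
qed

text \<open>
  The change of the exponent caused by an insertion at time \<open>k\<close>.
\<close>

abbreviation jump :: "nat \<Rightarrow> real \<Rightarrow> nat \<Rightarrow> 'w \<Rightarrow> real" where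
  "jump n s k \<omega> \<equiv> (\<beta> s (X k \<omega>) (X k \<omega>) - \<beta> s (X (n - 1) \<omega>) (X n \<omega>)) / sqrt (real n)"

text \<open>
  Since \<open>\<zeta>(X\<^sub>k, X\<^sub>k\<^sub>+\<^sub>1) = w(X\<^sub>k) 1[X\<^sub>k\<^sub>+\<^sub>1 = X\<^sub>k] - \<phi>(X\<^sub>k)\<close>, inserting a step turns the first part into the second
  one, with the exponent evaluated on the modified path.
\<close>

lemma noise_identity:
  assumes k: "k < n"
  shows "(\<integral>\<omega>. of_real (\<zeta> (X k \<omega>) (X (Suc k) \<omega>)) * iexp (W n s (path \<omega>)) \<partial>M) =
    (\<integral>\<omega>. of_real (\<phi> (X k \<omega>)) * (iexp (jump n s k \<omega>) - 1)
      * iexp (W n s (path \<omega>)) \<partial>M)"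
proof -
  let ?u = "jump n s k"
  let ?F = "\<lambda>\<omega>. iexp (W n s (path \<omega>))"
  have W_ins: "W n s (insert_hold k (path \<omega>)) = W n s (path \<omega>) + ?u \<omega>" for \<omega>
    unfolding W_def sum_insert_hold[OF k] by (simp add: add_divide_distrib diff_divide_distrib)
  have ins: "insert_hold k \<xi> k = \<xi> k" for \<xi> :: "nat \<Rightarrow> 'a" by (simp add: insert_hold_def)
  have wm: "(\<lambda>\<xi>. w (\<xi> k) *\<^sub>R iexp (W n s \<xi>)) \<in> borel_measurable path_space" by measurable
  have wmM [measurable]: "(\<lambda>\<omega>. w (X k \<omega>) *\<^sub>R iexp (W n s (path \<omega>))) \<in> borel_measurable M"
    using measurable_compose[OF path_measurable wm] by simp
  have "\<bar>of_bool b * w x\<bar> \<le> C" for b x using w_bound[of x] C_nonneg by (auto simp: of_bool_def)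
  then have i1: "integrable M (\<lambda>\<omega>. held k \<omega> *\<^sub>R (w (X k \<omega>) *\<^sub>R ?F \<omega>))"
    by (intro M.integrable_const_bound[of _ C]) (auto simp: abs_mult[symmetric])
  have i2: "integrable M (\<lambda>\<omega>. of_real (\<phi> (X k \<omega>)) * ?F \<omega>)"
    by (intro M.integrable_const_bound[of _ C]) (auto simp: norm_mult \<phi>_bound)
  have i3: "integrable M (\<lambda>\<omega>. of_real (\<phi> (X k \<omega>)) * (iexp (?u \<omega>) * ?F \<omega>))"
    by (intro M.integrable_const_bound[of _ C]) (auto simp: norm_mult \<phi>_bound)
  have "(\<integral>\<omega>. of_real (\<zeta> (X k \<omega>) (X (Suc k) \<omega>)) * ?F \<omega> \<partial>M)
      = (\<integral>\<omega>. held k \<omega> *\<^sub>R (w (X k \<omega>) *\<^sub>R ?F \<omega>) - of_real (\<phi> (X k \<omega>)) * ?F \<omega> \<partial>M)"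
    by (intro Bochner_Integration.integral_cong refl) (simp add: \<zeta>_def \<phi>_def scaleR_conv_of_real algebra_simps)
  also have "\<dots> = (\<integral>\<omega>. held k \<omega> *\<^sub>R (w (X k \<omega>) *\<^sub>R ?F \<omega>) \<partial>M) - (\<integral>\<omega>. of_real (\<phi> (X k \<omega>)) * ?F \<omega> \<partial>M)"
    by (rule Bochner_Integration.integral_diff[OF i1 i2])
  also have "(\<integral>\<omega>. held k \<omega> *\<^sub>R (w (X k \<omega>) *\<^sub>R ?F \<omega>) \<partial>M) =
      (\<integral>\<omega>. of_real (\<phi> (X k \<omega>)) * (iexp (?u \<omega>) * ?F \<omega>) \<partial>M)"
    using hold_insertion[OF wm, of k]
    by (simp add: W_ins ins \<phi>_def scaleR_conv_of_real ring_distribs exp_add mult_ac)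
  also have "\<dots> - (\<integral>\<omega>. of_real (\<phi> (X k \<omega>)) * ?F \<omega> \<partial>M) =
     (\<integral>\<omega>. of_real (\<phi> (X k \<omega>)) * (iexp (?u \<omega>) * ?F \<omega>) - of_real (\<phi> (X k \<omega>)) * ?F \<omega> \<partial>M)"
    by (rule Bochner_Integration.integral_diff[OF i3 i2, symmetric])
  also have "\<dots> = (\<integral>\<omega>. of_real (\<phi> (X k \<omega>)) * (iexp (?u \<omega>) - 1) * ?F \<omega> \<partial>M)"
    by (intro Bochner_Integration.integral_cong refl) (simp add: algebra_simps)
  finally show ?thesis .
qed

lemma J_derivative: "(J n has_vector_derivative J' n s) (at s)"
proof (cases "n = 0")
  case True
  then show ?thesis by (simp add: J_def[abs_def] J'_def W_def Z_def)
next
  case False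
  define B where "B = real n * C / sqrt (real n)"
  have ZB: "\<bar>Z n \<xi>\<bar> \<le> B" for \<xi>
    using sum_bounded_above[of "{..<n}" "\<lambda>k. \<bar>\<zeta> (\<xi> k) (\<xi> (Suc k))\<bar>" C] \<zeta>_bound
    unfolding Z_def B_def abs_divide by (auto intro!: divide_right_mono order_trans[OF sum_abs])
  have W_add: "W n (s + e) \<xi> = W n s \<xi> + e * Z n \<xi>" for e \<xi>
    unfolding W_def Z_def \<beta>_def by (simp add: algebra_simps sum.distrib sum_distrib_left add_divide_distrib)
  have bound: "cmod (J n (s + e) - J n s - e *\<^sub>R J' n s) \<le> e\<^sup>2 * B\<^sup>2" for e
  proof -
    let ?F = "\<lambda>\<omega>. iexp (W n s (path \<omega>))"
    let ?z = "\<lambda>\<omega>. Z n (path \<omega>)"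
    have i0: "integrable M (\<lambda>\<omega>. iexp (W n r (path \<omega>)))" for r
      by (intro M.integrable_const_bound[of _ 1]) auto
    have i1: "integrable M (\<lambda>\<omega>. e *\<^sub>R (\<i> * of_real (?z \<omega>) * ?F \<omega>))"
      by (intro integrable_scaleR_right M.integrable_const_bound[of _ B]) (auto simp: norm_mult ZB)
    have "J n (s + e) - J n s - e *\<^sub>R J' n s =
      (\<integral>\<omega>. iexp (W n (s + e) (path \<omega>)) - ?F \<omega> - e *\<^sub>R (\<i> * of_real (?z \<omega>) * ?F \<omega>) \<partial>M)"
      unfolding J_def J'_def
      by (subst integral_scaleR_right[symmetric],
        subst Bochner_Integration.integral_diff[symmetric, OF i0 i0],
        subst Bochner_Integration.integral_diff[symmetric, OF Bochner_Integration.integrable_diff[OF i0 i0] i1])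
        (rule refl)
    also have "cmod \<dots> \<le> (\<integral>\<omega>. e\<^sup>2 * B\<^sup>2 \<partial>M)"
    proof (rule norm_integral_le)
      show "(\<lambda>\<omega>. iexp (W n (s + e) (path \<omega>)) - ?F \<omega> - e *\<^sub>R (\<i> * of_real (?z \<omega>) * ?F \<omega>)) \<in> borel_measurable M"
        by (intro borel_measurable_integrable Bochner_Integration.integrable_diff i0 i1)
      fix \<omega>
      have "iexp (W n (s + e) (path \<omega>)) - ?F \<omega> - e *\<^sub>R (\<i> * of_real (?z \<omega>) * ?F \<omega>)
        = ?F \<omega> * (iexp (e * ?z \<omega>) - (\<Sum>k\<le>1. (\<i> * (e * ?z \<omega>))^k / fact k))"
        unfolding W_add by (simp add: exp_add algebra_simps scaleR_conv_of_real)
      then have "cmod (iexp (W n (s + e) (path \<omega>)) - ?F \<omega> - e *\<^sub>R (\<i> * of_real (?z \<omega>) * ?F \<omega>))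
        = cmod (iexp (e * ?z \<omega>) - (\<Sum>k\<le>1. (\<i> * (e * ?z \<omega>))^k / fact k))"
        by (simp only: norm_mult norm_exp_i_times mult_1_left)
      also have "\<dots> \<le> \<bar>e * ?z \<omega>\<bar>^(Suc 1) / fact (Suc 1)" using iexp_approx1[of "e * ?z \<omega>" 1] by simp
      also have "\<dots> \<le> e\<^sup>2 * B\<^sup>2"
      proof -
        have "(?z \<omega>)\<^sup>2 \<le> B\<^sup>2" using ZB[of "path \<omega>"] by (intro iffD1[OF abs_le_square_iff]) linarith
        then have "e\<^sup>2 * (?z \<omega>)\<^sup>2 \<le> e\<^sup>2 * B\<^sup>2" by (intro mult_left_mono) auto
        moreover have "\<bar>e * ?z \<omega>\<bar>^(Suc 1) / fact (Suc 1) = e\<^sup>2 * (?z \<omega>)\<^sup>2 / 2"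
          by (simp only: Suc_1 power2_abs power_mult_distrib) simp
        moreover have "0 \<le> e\<^sup>2 * (?z \<omega>)\<^sup>2" by simp
        ultimately show ?thesis by linarith
      qed
      finally show "cmod (iexp (W n (s + e) (path \<omega>)) - ?F \<omega> - e *\<^sub>R (\<i> * of_real (?z \<omega>) * ?F \<omega>)) \<le> e\<^sup>2 * B\<^sup>2" .
    qed simp
    finally show ?thesis by (simp add: M.prob_space)
  qed
  show ?thesis unfolding has_vector_derivative_def
  proof (rule has_derivativeI_sandwich[where e = 1 and H = "\<lambda>y. \<bar>y - s\<bar> * B\<^sup>2"])
    show "bounded_linear (\<lambda>x. x *\<^sub>R J' n s)" by (rule bounded_linear_scaleR_left)
    show "((\<lambda>y. \<bar>y - s\<bar> * B\<^sup>2) \<longlongrightarrow> 0) (at s)"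
      by (auto intro!: tendsto_eq_intros)
    fix y assume "y \<noteq> s"
    then show "cmod (J n y - J n s - (y - s) *\<^sub>R J' n s) / norm (y - s) \<le> \<bar>y - s\<bar> * B\<^sup>2"
      using bound[of "y - s"] by (simp add: divide_le_eq power2_eq_square mult_ac flip: abs_mult)
  qed simp
qed

lemma shift_path_integral:
  fixes F :: "(nat \<Rightarrow> 'a) \<Rightarrow> real"
  assumes [measurable]: "F \<in> borel_measurable path_space"
  shows "(\<integral>\<omega>. F (\<lambda>i. X (i + m) \<omega>) \<partial>M) = (\<integral>\<omega>. F (path \<omega>) \<partial>M)"
proof (induction m)
  case 0
  then show ?case by (simp add: path_def)
next
  case (Suc m)
  have [measurable]: "(\<lambda>\<xi> i. \<xi> (i + m)) \<in> path_space \<rightarrow>\<^sub>M (path_space :: (nat \<Rightarrow> 'a) measure)"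
    by (rule measurable_PiM_single') auto
  have "(\<integral>\<omega>. F (\<lambda>i. X (i + Suc m) \<omega>) \<partial>M) = (\<integral>\<omega>. (\<lambda>\<xi>. F (\<lambda>i. \<xi> (i + m))) (shift_path (path \<omega>)) \<partial>M)"
    by (simp add: shift_path_def path_def)
  also have "\<dots> = (\<integral>\<omega>. (\<lambda>\<xi>. F (\<lambda>i. \<xi> (i + m))) (path \<omega>) \<partial>M)"
    by (rule shift_integral) measurable
  finally show ?case using Suc by (simp add: path_def)
qed

section \<open>Stationarity removes the end term\<close>

abbreviation B :: "real \<Rightarrow> nat \<Rightarrow> 'w \<Rightarrow> real" where
  "B s k \<omega> \<equiv> \<beta> s (X k \<omega>) (X (Suc k) \<omega>)"

abbreviation F :: "nat \<Rightarrow> real \<Rightarrow> 'w \<Rightarrow> complex" where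
  "F n s \<omega> \<equiv> iexp (W n s (path \<omega>))"

abbreviation deviation :: "('a \<Rightarrow> real) \<Rightarrow> nat \<Rightarrow> real" where
  "deviation f n \<equiv> (\<integral>\<omega>. \<bar>(\<Sum>k<n. f (X k \<omega>)) / real n - (\<integral>x. f x \<partial>\<pi>)\<bar> \<partial>M)"

lemma F_measurable [measurable]: "F n s \<in> borel_measurable M"
  by measurable

lemma B_integrable: "integrable M (B s k)"
proof (rule Bochner_Integration.integrable_bound[OF integrable_X[OF H_integrable[of "\<bar>s\<bar>"], of k]])
  show "AE \<omega> in M. norm (B s k \<omega>) \<le> norm (H \<bar>s\<bar> (X k \<omega>))"
    using \<beta>_bound[of s "\<bar>s\<bar>"] by (auto intro!: AE_I2 order_trans[OF _ abs_ge_self])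
qed measurable

lemma BF_integrable: "integrable M (\<lambda>\<omega>. of_real (B s k \<omega>) * F n s \<omega>)"
  by (rule Bochner_Integration.integrable_bound[OF B_integrable[of s k]]) (auto simp: norm_mult)

lemma W_shift_path:
  "W n s (shift_path \<xi>) = W n s \<xi> + (\<beta> s (\<xi> n) (\<xi> (Suc n)) - \<beta> s (\<xi> 0) (\<xi> (Suc 0))) / sqrt (real n)"
  unfolding W_def shift_path_def
  using sum.lessThan_Suc_shift[of "\<lambda>k. \<beta> s (\<xi> k) (\<xi> (Suc k))" n]
  by (simp add: add_divide_distrib[symmetric] diff_divide_distrib[symmetric])

text \<open>
  By stationarity the two integrals differ only in that the exponent is evaluated on the shifted
  path, which replaces a single summand of order \<open>1 / \<surd>n\<close>.
\<close>

lemma shift_error: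
  assumes n: "0 < n" and s: "\<bar>s\<bar> \<le> R" and K: "0 \<le> K"
  shows "cmod ((\<integral>\<omega>. of_real (B s (Suc j) \<omega>) * F n s \<omega> \<partial>M) - (\<integral>\<omega>. of_real (B s j \<omega>) * F n s \<omega> \<partial>M))
    \<le> 2 * K * (\<integral>x. H R x \<partial>\<pi>) / sqrt (real n) + 2 * tail R K"
proof -
  have R: "0 \<le> R" using s by simp
  have n': "0 < sqrt (real n)" using n by simp
  let ?\<Phi> = "\<lambda>\<xi>. of_real (\<beta> s (\<xi> j) (\<xi> (Suc j))) * iexp (W n s \<xi>)"
  let ?d = "\<lambda>\<omega>. (B s n \<omega> - B s 0 \<omega>) / sqrt (real n)"
  have [measurable]: "?\<Phi> \<in> borel_measurable path_space" by measurable
  have sh: "(\<integral>\<omega>. of_real (B s j \<omega>) * F n s \<omega> \<partial>M) = (\<integral>\<omega>. of_real (B s (Suc j) \<omega>) * iexp (W n s (path \<omega>) + ?d \<omega>) \<partial>M)"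
    using shift_integral[of ?\<Phi>] by (simp add: W_shift_path)
  have i2: "integrable M (\<lambda>\<omega>. of_real (B s (Suc j) \<omega>) * iexp (W n s (path \<omega>) + ?d \<omega>))"
    by (rule Bochner_Integration.integrable_bound[OF B_integrable[of s "Suc j"]]) (auto simp: norm_mult)
  have "cmod ((\<integral>\<omega>. of_real (B s (Suc j) \<omega>) * F n s \<omega> \<partial>M) - (\<integral>\<omega>. of_real (B s j \<omega>) * F n s \<omega> \<partial>M))
     = cmod (\<integral>\<omega>. of_real (B s (Suc j) \<omega>) * F n s \<omega> - of_real (B s (Suc j) \<omega>) * iexp (W n s (path \<omega>) + ?d \<omega>) \<partial>M)"
    unfolding sh by (subst Bochner_Integration.integral_diff[OF BF_integrable i2]) (rule refl)
  also have "\<dots> \<le> (\<integral>\<omega>. K * (H R (X n \<omega>) + H R (X 0 \<omega>)) / sqrt (real n) +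
      2 * (H R (X (Suc j) \<omega>) * of_bool (K < H R (X (Suc j) \<omega>))) \<partial>M)"
  proof (rule norm_integral_le)
    show "integrable M (\<lambda>\<omega>. K * (H R (X n \<omega>) + H R (X 0 \<omega>)) / sqrt (real n) +
      2 * (H R (X (Suc j) \<omega>) * of_bool (K < H R (X (Suc j) \<omega>))))"
      using integrable_X[OF H_integrable] integrable_X[OF tail_integrable] by auto
    fix \<omega>
    let ?x = "H R (X (Suc j) \<omega>)"
    have x0: "0 \<le> ?x" by (rule H_nonneg[OF R])
    have b: "\<bar>B s (Suc j) \<omega>\<bar> \<le> ?x" by (rule \<beta>_bound[OF s])
    have d: "\<bar>?d \<omega>\<bar> \<le> (H R (X n \<omega>) + H R (X 0 \<omega>)) / sqrt (real n)"
      unfolding abs_divide using \<beta>_bound[OF s, of "X n \<omega>" "X (Suc n) \<omega>"] \<beta>_bound[OF s, of "X 0 \<omega>" "X (Suc 0) \<omega>"]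
      by (auto intro!: divide_right_mono)
    have "of_real (B s (Suc j) \<omega>) * F n s \<omega> - of_real (B s (Suc j) \<omega>) * iexp (W n s (path \<omega>) + ?d \<omega>)
      = - (of_real (B s (Suc j) \<omega>) * F n s \<omega> * (iexp (?d \<omega>) - 1))"
      by (simp add: exp_add ring_distribs)
    then have eq: "cmod (of_real (B s (Suc j) \<omega>) * F n s \<omega> - of_real (B s (Suc j) \<omega>) * iexp (W n s (path \<omega>) + ?d \<omega>))
      = \<bar>B s (Suc j) \<omega>\<bar> * cmod (iexp (?d \<omega>) - 1)"
      by (simp only: norm_minus_cancel norm_mult norm_exp_i_times norm_of_real mult_1_right)
    have e1: "cmod (iexp (?d \<omega>) - 1) \<le> (H R (X n \<omega>) + H R (X 0 \<omega>)) / sqrt (real n)"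
      by (rule order_trans[OF cmod_iexp_minus_1_le d])
    have e2: "cmod (iexp (?d \<omega>) - 1) \<le> 2"
      using norm_triangle_ineq4[of "iexp (?d \<omega>)" 1] by (simp only: norm_exp_i_times norm_one one_add_one)
    have r0: "0 \<le> (H R (X n \<omega>) + H R (X 0 \<omega>)) / sqrt (real n)"
      using H_nonneg[OF R] by simp
    show "cmod (of_real (B s (Suc j) \<omega>) * F n s \<omega> - of_real (B s (Suc j) \<omega>) * iexp (W n s (path \<omega>) + ?d \<omega>))
      \<le> K * (H R (X n \<omega>) + H R (X 0 \<omega>)) / sqrt (real n) + 2 * (?x * of_bool (K < ?x))"
    proof (cases "K < ?x")
      case True
      have "\<bar>B s (Suc j) \<omega>\<bar> * cmod (iexp (?d \<omega>) - 1) \<le> ?x * 2"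
        using b e2 x0 by (intro mult_mono) auto
      moreover have "0 \<le> K * ((H R (X n \<omega>) + H R (X 0 \<omega>)) / sqrt (real n))"
        by (intro mult_nonneg_nonneg K r0)
      ultimately show ?thesis using True unfolding eq by simp
    next
      case False
      have "\<bar>B s (Suc j) \<omega>\<bar> * cmod (iexp (?d \<omega>) - 1) \<le> K * ((H R (X n \<omega>) + H R (X 0 \<omega>)) / sqrt (real n))"
        using b e1 False K by (intro mult_mono) auto
      then show ?thesis using False unfolding eq by simp
    qed
    show "(\<lambda>\<omega>. of_real (B s (Suc j) \<omega>) * F n s \<omega> - of_real (B s (Suc j) \<omega>) * iexp (W n s (path \<omega>) + ?d \<omega>)) \<in> borel_measurable M"
      by measurable
  qed
  also have "\<dots> = 2 * K * (\<integral>x. H R x \<partial>\<pi>) / sqrt (real n) + 2 * tail R K"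
  proof -
    have iH: "integrable M (\<lambda>\<omega>. H R (X k \<omega>))" for k by (rule integrable_X[OF H_integrable])
    have iT: "integrable M (\<lambda>\<omega>. H R (X k \<omega>) * of_bool (K < H R (X k \<omega>)))" for k
      using integrable_X[OF tail_integrable] .
    show ?thesis using iH iT by (simp add: integral_H_X integral_tail_X)
  qed
  finally show ?thesis .
qed

lemma shift_error_iterate:
  assumes n: "0 < n" and s: "\<bar>s\<bar> \<le> R" and K: "0 \<le> K"
  shows "cmod ((\<integral>\<omega>. of_real (B s (j + m) \<omega>) * F n s \<omega> \<partial>M) - (\<integral>\<omega>. of_real (B s j \<omega>) * F n s \<omega> \<partial>M))
    \<le> real m * (2 * K * (\<integral>x. H R x \<partial>\<pi>) / sqrt (real n) + 2 * tail R K)"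
proof (induction m)
  case (Suc m)
  let ?I = "\<lambda>k. \<integral>\<omega>. of_real (B s k \<omega>) * F n s \<omega> \<partial>M"
  have "cmod (?I (j + Suc m) - ?I j) \<le> cmod (?I (Suc (j + m)) - ?I (j + m)) + cmod (?I (j + m) - ?I j)"
    using norm_triangle_ineq[of "?I (Suc (j + m)) - ?I (j + m)" "?I (j + m) - ?I j"] by simp
  also have "\<dots> \<le> (2 * K * (\<integral>x. H R x \<partial>\<pi>) / sqrt (real n) + 2 * tail R K) +
      real m * (2 * K * (\<integral>x. H R x \<partial>\<pi>) / sqrt (real n) + 2 * tail R K)"
    by (intro add_mono Suc shift_error assms)
  also have "\<dots> = real (Suc m) * (2 * K * (\<integral>x. H R x \<partial>\<pi>) / sqrt (real n) + 2 * tail R K)"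
    by (simp only: of_nat_Suc ring_distribs mult_1_left)
  finally show ?case .
qed simp

text \<open>
  After replacing the last increment by an average of the last \<open>L\<close> increments, the law of large numbers
  makes the term small. This is where \<open>\<pi>(h) = 0\<close> enters: a repeated step pushes an average step out of
  the window, and for a function of mean \<open>0\<close> that loss is negligible.
\<close>

lemma end_term_bound:
  assumes L: "0 < L" "L \<le> n" and s: "\<bar>s\<bar> \<le> R" and K: "0 \<le> K"
  shows "cmod (\<integral>\<omega>. of_real (B s (n - 1) \<omega>) * F n s \<omega> \<partial>M) \<le>
    \<bar>t\<bar> * deviation h L + R * C / sqrt (real L)
    + real L * (2 * K * (\<integral>x. H R x \<partial>\<pi>) / sqrt (real n) + 2 * tail R K)"
proof -
  let ?I = "\<lambda>k. \<integral>\<omega>. of_real (B s k \<omega>) * F n s \<omega> \<partial>M"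
  let ?\<eta> = "2 * K * (\<integral>x. H R x \<partial>\<pi>) / sqrt (real n) + 2 * tail R K"
  have n: "0 < n" and R: "0 \<le> R" using L s by auto
  have \<eta>: "0 \<le> ?\<eta>"
    using order_trans[OF norm_ge_zero shift_error[OF n s K, of 0]] .
  have 1: "cmod (?I (n - 1) - ?I (j + (n - L))) \<le> real L * ?\<eta>" if "j < L" for j
  proof -
    have e: "j + (n - L) + (L - 1 - j) = n - 1" using that L by simp
    have "cmod (?I (n - 1) - ?I (j + (n - L))) \<le> real (L - 1 - j) * ?\<eta>"
      using shift_error_iterate[OF n s K, of "j + (n - L)" "L - 1 - j"] unfolding e .
    also have "\<dots> \<le> real L * ?\<eta>" using \<eta> by (intro mult_right_mono) auto
    finally show ?thesis .
  qed
  have "cmod (\<Sum>j<L. ?I (n - 1) - ?I (j + (n - L))) \<le> real L * (real L * ?\<eta>)"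
    using sum_norm_le[of "{..<L}" "\<lambda>j. ?I (n - 1) - ?I (j + (n - L))" "\<lambda>_. real L * ?\<eta>"] 1 by simp
  then have 2: "cmod (real L * ?I (n - 1) - (\<Sum>j<L. ?I (j + (n - L)))) \<le> real L * (real L * ?\<eta>)"
    by (simp add: sum_subtractf)
  have iB: "integrable M (\<lambda>\<omega>. \<bar>\<Sum>j<L. B s j \<omega>\<bar>)"
    by (intro integrable_abs Bochner_Integration.integrable_sum B_integrable)
  have ih: "integrable M (\<lambda>\<omega>. \<bar>\<Sum>k<L. h (X k \<omega>)\<bar>)"
    by (intro integrable_abs Bochner_Integration.integrable_sum integrable_X h_integrable)
  have iz: "integrable M (\<lambda>\<omega>. \<bar>\<Sum>k<L. \<zeta> (X k \<omega>) (X (Suc k) \<omega>)\<bar>)"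
    by (intro integrable_abs Bochner_Integration.integrable_sum M.integrable_const_bound[of _ C])
      (auto simp: \<zeta>_bound)
  have "cmod (\<Sum>j<L. ?I (j + (n - L))) = cmod (\<integral>\<omega>. of_real (\<Sum>j<L. B s (j + (n - L)) \<omega>) * F n s \<omega> \<partial>M)"
    by (subst Bochner_Integration.integral_sum[symmetric, OF BF_integrable])
      (simp only: of_real_sum sum_distrib_right)
  also have "\<dots> \<le> (\<integral>\<omega>. \<bar>\<Sum>j<L. B s (j + (n - L)) \<omega>\<bar> \<partial>M)"
  proof (rule norm_integral_le)
    show "(\<lambda>\<omega>. of_real (\<Sum>j<L. B s (j + (n - L)) \<omega>) * F n s \<omega>) \<in> borel_measurable M"
      by measurable
    show "integrable M (\<lambda>\<omega>. \<bar>\<Sum>j<L. B s (j + (n - L)) \<omega>\<bar>)"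
      by (intro integrable_abs Bochner_Integration.integrable_sum B_integrable)
    show "cmod (of_real (\<Sum>j<L. B s (j + (n - L)) \<omega>) * F n s \<omega>) \<le> \<bar>\<Sum>j<L. B s (j + (n - L)) \<omega>\<bar>" for \<omega>
      by (simp only: norm_mult norm_exp_i_times norm_of_real mult_1_right order.refl)
  qed
  also have "\<dots> = (\<integral>\<omega>. \<bar>\<Sum>j<L. B s j \<omega>\<bar> \<partial>M)"
  proof -
    let ?G = "\<lambda>\<xi>. \<bar>\<Sum>j<L. \<beta> s (\<xi> j) (\<xi> (Suc j))\<bar>"
    have "?G \<in> borel_measurable path_space" by measurable
    from shift_path_integral[OF this, of "n - L"] show ?thesis by (simp only: path_apply add_Suc)
  qed
  also have "\<dots> \<le> (\<integral>\<omega>. \<bar>t\<bar> * \<bar>\<Sum>k<L. h (X k \<omega>)\<bar> + R * \<bar>\<Sum>k<L. \<zeta> (X k \<omega>) (X (Suc k) \<omega>)\<bar> \<partial>M)"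
  proof (rule integral_mono[OF iB])
    show "integrable M (\<lambda>\<omega>. \<bar>t\<bar> * \<bar>\<Sum>k<L. h (X k \<omega>)\<bar> + R * \<bar>\<Sum>k<L. \<zeta> (X k \<omega>) (X (Suc k) \<omega>)\<bar>)"
      using ih iz by (intro Bochner_Integration.integrable_add integrable_mult_right) auto
    fix \<omega>
    have "(\<Sum>j<L. B s j \<omega>) = t * (\<Sum>k<L. h (X k \<omega>)) + s * (\<Sum>k<L. \<zeta> (X k \<omega>) (X (Suc k) \<omega>))"
      by (simp add: \<beta>_def sum.distrib sum_distrib_left)
    also have "\<bar>\<dots>\<bar> \<le> \<bar>t\<bar> * \<bar>\<Sum>k<L. h (X k \<omega>)\<bar> + \<bar>s\<bar> * \<bar>\<Sum>k<L. \<zeta> (X k \<omega>) (X (Suc k) \<omega>)\<bar>"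
      unfolding abs_mult[symmetric] by (rule abs_triangle_ineq)
    also have "\<dots> \<le> \<bar>t\<bar> * \<bar>\<Sum>k<L. h (X k \<omega>)\<bar> + R * \<bar>\<Sum>k<L. \<zeta> (X k \<omega>) (X (Suc k) \<omega>)\<bar>"
      using s by (intro add_left_mono mult_right_mono) auto
    finally show "\<bar>\<Sum>j<L. B s j \<omega>\<bar> \<le> \<bar>t\<bar> * \<bar>\<Sum>k<L. h (X k \<omega>)\<bar> + R * \<bar>\<Sum>k<L. \<zeta> (X k \<omega>) (X (Suc k) \<omega>)\<bar>" .
  qed
  also have "\<dots> = \<bar>t\<bar> * (\<integral>\<omega>. \<bar>\<Sum>k<L. h (X k \<omega>)\<bar> \<partial>M) + R * (\<integral>\<omega>. \<bar>\<Sum>k<L. \<zeta> (X k \<omega>) (X (Suc k) \<omega>)\<bar> \<partial>M)"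
    using ih iz by simp
  also have "(\<integral>\<omega>. \<bar>\<Sum>k<L. h (X k \<omega>)\<bar> \<partial>M) = real L * deviation h L"
    using L by (simp add: h_mean)
  also have "\<bar>t\<bar> * (real L * deviation h L) + R * (\<integral>\<omega>. \<bar>\<Sum>k<L. \<zeta> (X k \<omega>) (X (Suc k) \<omega>)\<bar> \<partial>M)
    \<le> \<bar>t\<bar> * (real L * deviation h L) + R * (C * sqrt (real L))"
    by (intro add_left_mono mult_left_mono R martingale_first_moment \<zeta>_measurable \<zeta>_bound \<zeta>_mean)
  finally have 3: "cmod (\<Sum>j<L. ?I (j + (n - L))) \<le> \<bar>t\<bar> * (real L * deviation h L) + R * (C * sqrt (real L))" .
  have "real L * cmod (?I (n - 1)) = cmod (real L * ?I (n - 1))" by (simp add: norm_mult)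
  also have "\<dots> \<le> cmod (real L * ?I (n - 1) - (\<Sum>j<L. ?I (j + (n - L)))) + cmod (\<Sum>j<L. ?I (j + (n - L)))"
    using norm_triangle_ineq[of "real L * ?I (n - 1) - (\<Sum>j<L. ?I (j + (n - L)))" "\<Sum>j<L. ?I (j + (n - L))"] by simp
  also have "\<dots> \<le> real L * (real L * ?\<eta>) + (\<bar>t\<bar> * (real L * deviation h L) + R * (C * sqrt (real L)))"
    by (rule add_mono[OF 2 3])
  also have "\<dots> = real L * (\<bar>t\<bar> * deviation h L + R * C / sqrt (real L) + real L * ?\<eta>)"
  proof -
    have e: "real L / sqrt (real L) = sqrt (real L)" by (rule real_div_sqrt) simp
    have "R * (C * (real L / sqrt (real L))) = real L * (R * C / sqrt (real L))"
      by (simp only: times_divide_eq_right mult_ac)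
    then have q: "R * (C * sqrt (real L)) = real L * (R * C / sqrt (real L))"
      unfolding e .
    have alg: "l * (l * e) + (T * (l * d) + l * x) = l * (T * d + x + l * e)" for l e T d x :: real
      by (simp add: algebra_simps)
    show ?thesis unfolding q by (rule alg)
  qed
  finally show ?thesis using L by (simp only: mult_le_cancel_left_pos of_nat_0_less_iff)
qed

section \<open>The approximate differential equation\<close>

lemma \<phi>_bdd_measurable: "bdd_measurable \<phi>"
  by (rule bdd_measurableI[of _ C]) (auto simp: \<phi>_bound)

lemma \<phi>h_integrable: "integrable \<pi> (\<lambda>x. \<phi> x * h x)"
proof (rule Bochner_Integration.integrable_bound[of _ "\<lambda>x. C * h x"])
  show "AE x in \<pi>. norm (\<phi> x * h x) \<le> norm (C * h x)"
    using \<phi>_bound C_nonneg by (intro AE_I2) (auto simp: abs_mult intro!: mult_right_mono)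
qed (use h_integrable in auto)

lemma \<phi>\<zeta>_bdd_measurable: "bdd_measurable (\<lambda>x. \<phi> x * \<zeta> x x)"
proof (rule bdd_measurableI)
  show "\<bar>\<phi> x * \<zeta> x x\<bar> \<le> C * C" for x
    unfolding abs_mult using C_nonneg by (intro mult_mono \<phi>_bound \<zeta>_bound) auto
qed measurable

abbreviation T :: "real \<Rightarrow> real \<Rightarrow> nat \<Rightarrow> 'w \<Rightarrow> real" where
  "T R K k \<omega> \<equiv> H R (X k \<omega>) * of_bool (K < H R (X k \<omega>))"

lemma J'_eq:
  assumes n: "0 < n"
  shows "J' n s = (\<integral>\<omega>. (\<Sum>k<n. \<i> / sqrt (real n) * (of_real (\<phi> (X k \<omega>)) *
      (iexp (jump n s k \<omega>) - 1) * F n s \<omega>)) \<partial>M)"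
proof -
  let ?D = "\<lambda>k \<omega>. of_real (\<phi> (X k \<omega>)) *
      (iexp (jump n s k \<omega>) - 1) * F n s \<omega>"
  let ?z = "\<lambda>k \<omega>. of_real (\<zeta> (X k \<omega>) (X (Suc k) \<omega>)) * F n s \<omega>"
  have iD: "integrable M (?D k)" for k
  proof (rule M.integrable_const_bound[of _ "C * 2"])
    have "cmod (iexp u - 1) \<le> 2" for u
      using norm_triangle_ineq4[of "iexp u" 1] by (simp only: norm_exp_i_times norm_one one_add_one)
    then show "AE \<omega> in M. cmod (?D k \<omega>) \<le> C * 2"
      using C_nonneg \<phi>_bound by (intro AE_I2) (auto simp only: norm_mult norm_exp_i_times norm_of_real mult_1_right intro!: mult_mono norm_ge_zero)
  qed measurable
  have iz: "integrable M (?z k)" for k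
    by (rule M.integrable_const_bound[of _ C]) (auto simp: norm_mult \<zeta>_bound)
  have "J' n s = (\<integral>\<omega>. (\<Sum>k<n. \<i> / sqrt (real n) * ?z k \<omega>) \<partial>M)"
    unfolding J'_def Z_def
    by (intro Bochner_Integration.integral_cong refl) (simp add: sum_distrib_left sum_distrib_right sum_divide_distrib mult.assoc)
  also have "\<dots> = (\<Sum>k<n. \<i> / sqrt (real n) * (\<integral>\<omega>. ?z k \<omega> \<partial>M))"
    by (subst Bochner_Integration.integral_sum) (intro integrable_mult_right iz, simp)
  also have "\<dots> = (\<Sum>k<n. \<i> / sqrt (real n) * (\<integral>\<omega>. ?D k \<omega> \<partial>M))"
    by (intro sum.cong refl arg_cong2[where f = "(*)"] noise_identity) simp
  also have "\<dots> = (\<integral>\<omega>. (\<Sum>k<n. \<i> / sqrt (real n) * ?D k \<omega>) \<partial>M)"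
    by (subst Bochner_Integration.integral_sum) (intro integrable_mult_right iD, simp)
  finally show ?thesis .
qed

text \<open>
  Four errors: linearising the exponential, replacing the averages of \<open>\<phi> h\<close> and \<open>\<phi> \<zeta>\<close> by their means,
  replacing the average of \<open>\<phi>\<close> in front of the end term by its mean, and the end term itself.
\<close>

lemma derivative_error:
  assumes L: "0 < L" "L \<le> n" and s: "\<bar>s\<bar> \<le> R" and K: "0 \<le> K"
  shows "cmod (J' n s + of_real (t * cov + s * var) * J n s) \<le>
    C * (4 * K\<^sup>2 / sqrt (real n) + 8 * tail R K)
    + (\<bar>t\<bar> * deviation (\<lambda>x. \<phi> x * h x) n + R * deviation (\<lambda>x. \<phi> x * \<zeta> x x) n)
    + (K * deviation \<phi> n + 2 * C * tail R K)
    + C * (\<bar>t\<bar> * deviation h L + R * C / sqrt (real L)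
      + real L * (2 * K * (\<integral>x. H R x \<partial>\<pi>) / sqrt (real n) + 2 * tail R K))"
proof -
  have n: "0 < n" and R: "0 \<le> R" using L s by auto
  define N where "N = sqrt (real n)"
  have N: "0 < N" "N * N = real n" using n by (auto simp: N_def)
  define b where "b = B s (n - 1)"
  have b_eq: "b \<omega> = \<beta> s (X (n - 1) \<omega>) (X n \<omega>)" for \<omega> using n by (simp add: b_def)
  define u where "u = (\<lambda>k \<omega>. \<beta> s (X k \<omega>) (X k \<omega>) - b \<omega>)"
  define p where "p = (\<integral>x. \<phi> x \<partial>\<pi>)"
  (* Q1: linearisation; Q2: averages against their means; A: fluctuation of the speed.
     The minus sign in Q2 comes from multiplying two factors \<i>. *)
  define Q1 where "Q1 = (\<lambda>\<omega>. \<Sum>k<n. (\<i> / real n) * of_real (\<phi> (X k \<omega>)) * (of_real N * (iexp (u k \<omega> / N) - 1) - \<i> * u k \<omega>))"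
  define Q2 where "Q2 = (\<lambda>\<omega>. (t * cov + s * var) - (\<Sum>k<n. \<phi> (X k \<omega>) * \<beta> s (X k \<omega>) (X k \<omega>)) / real n)"
  define A where "A = (\<lambda>\<omega>. (\<Sum>k<n. \<phi> (X k \<omega>)) / real n - p)"
  let ?D = "\<lambda>k \<omega>. of_real (\<phi> (X k \<omega>)) * (iexp (jump n s k \<omega>) - 1) * F n s \<omega>"
  let ?m = "\<lambda>\<omega>. (Q1 \<omega> + of_real (Q2 \<omega>) + of_real (A \<omega> * b \<omega>)) * F n s \<omega>"
  have bm [measurable]: "b \<in> borel_measurable M" unfolding b_def by measurable
  have um [measurable]: "u k \<in> borel_measurable M" for k unfolding u_def by measurable
  have Q1m [measurable]: "Q1 \<in> borel_measurable M" unfolding Q1_def by measurable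
  have Q2m [measurable]: "Q2 \<in> borel_measurable M" unfolding Q2_def by measurable
  have Am [measurable]: "A \<in> borel_measurable M" unfolding A_def by measurable
  have dec: "(\<Sum>k<n. \<i> / sqrt (real n) * ?D k \<omega>) + of_real (t * cov + s * var) * F n s \<omega>
     = ?m \<omega> + of_real p * (of_real (b \<omega>) * F n s \<omega>)" for \<omega>
  proof -
    let ?a = "\<lambda>k. \<i> / N * (of_real (\<phi> (X k \<omega>)) * (iexp (u k \<omega> / N) - 1))"
    let ?S = "\<Sum>k<n. ?a k"
    have term_eq: "?a k =
        (\<i> / real n) * of_real (\<phi> (X k \<omega>)) * (of_real N * (iexp (u k \<omega> / N) - 1) - \<i> * u k \<omega>)
        - of_real (\<phi> (X k \<omega>) * \<beta> s (X k \<omega>) (X k \<omega>) / real n) + of_real (\<phi> (X k \<omega>) / real n * b \<omega>)" for k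
    proof -
      have "\<i> / N = \<i> / real n * N" using N n by (simp add: field_simps flip: of_real_mult)
      then have "?a k =
        (\<i> / real n) * of_real (\<phi> (X k \<omega>)) * (of_real N * (iexp (u k \<omega> / N) - 1))"
        by (simp only: mult_ac)
      moreover have "(\<i> / real n) * of_real (\<phi> (X k \<omega>)) * (\<i> * u k \<omega>) =
        - of_real (\<phi> (X k \<omega>) * \<beta> s (X k \<omega>) (X k \<omega>) / real n) + of_real (\<phi> (X k \<omega>) / real n * b \<omega>)"
        by (simp add: u_def algebra_simps diff_divide_distrib add_divide_distrib)
      ultimately show ?thesis by (simp only: right_diff_distrib) simp
    qed
    have "?S
      = Q1 \<omega> - of_real ((\<Sum>k<n. \<phi> (X k \<omega>) * \<beta> s (X k \<omega>) (X k \<omega>)) / real n) + of_real ((\<Sum>k<n. \<phi> (X k \<omega>)) / real n * b \<omega>)"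
      unfolding term_eq Q1_def
      by (simp add: sum.distrib sum_subtractf sum_divide_distrib sum_distrib_right)
    then have f1: "?S + of_real (t * cov + s * var)
      = (Q1 \<omega> + of_real (Q2 \<omega>) + of_real (A \<omega> * b \<omega>)) + of_real p * of_real (b \<omega>)"
      by (simp add: Q2_def A_def left_diff_distrib)
    have f2: "(\<Sum>k<n. \<i> / sqrt (real n) * ?D k \<omega>) = ?S * F n s \<omega>"
      by (simp only: u_def b_eq N_def sum_distrib_right mult.assoc)
    have "(\<Sum>k<n. \<i> / sqrt (real n) * ?D k \<omega>) + of_real (t * cov + s * var) * F n s \<omega>
      = (?S + of_real (t * cov + s * var)) * F n s \<omega>"
      unfolding f2 by (rule distrib_right[symmetric])
    also have "\<dots> = ((Q1 \<omega> + of_real (Q2 \<omega>) + of_real (A \<omega> * b \<omega>)) + of_real p * of_real (b \<omega>)) * F n s \<omega>"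
      unfolding f1 ..
    also have "\<dots> = ?m \<omega> + of_real p * (of_real (b \<omega>) * F n s \<omega>)"
      unfolding distrib_right[of _ "of_real p * of_real (b \<omega>)"] mult.assoc ..
    finally show ?thesis .
  qed
  let ?dh = "\<lambda>\<omega>. \<bar>(\<Sum>k<n. \<phi> (X k \<omega>) * h (X k \<omega>)) / real n - cov\<bar>"
  let ?dz = "\<lambda>\<omega>. \<bar>(\<Sum>k<n. \<phi> (X k \<omega>) * \<zeta> (X k \<omega>) (X k \<omega>)) / real n - var\<bar>"
  let ?e = "\<lambda>k \<omega>. 4 * K\<^sup>2 / N + 4 * T R K k \<omega> + 4 * T R K (n - 1) \<omega>"
  define G where "G = (\<lambda>\<omega>. C / real n * (\<Sum>k<n. ?e k \<omega>)
      + (\<bar>t\<bar> * ?dh \<omega> + R * ?dz \<omega>)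
      + (K * \<bar>A \<omega>\<bar> + 2 * C * T R K (n - 1) \<omega>))"
  have iT: "integrable M (T R K k)" for k using integrable_X[OF tail_integrable] .
  have idev: "integrable M (\<lambda>\<omega>. \<bar>(\<Sum>k<n. f (X k \<omega>)) / real n - c\<bar>)" if "integrable \<pi> f" for f c
    using that by (intro integrable_abs Bochner_Integration.integrable_diff integrable_divide
      Bochner_Integration.integrable_sum integrable_X) auto
  have i\<phi>: "integrable \<pi> \<phi>" by (rule bdd_measurable_integrable[OF \<phi>_bdd_measurable])
  have i\<phi>\<zeta>: "integrable \<pi> (\<lambda>x. \<phi> x * \<zeta> x x)" by (rule bdd_measurable_integrable[OF \<phi>\<zeta>_bdd_measurable])
  have iA: "integrable M (\<lambda>\<omega>. \<bar>A \<omega>\<bar>)" unfolding A_def by (rule idev[OF i\<phi>])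
  note parts = idev[OF \<phi>h_integrable, of cov] idev[OF i\<phi>\<zeta>, of var] iA
  have i1: "integrable M (\<lambda>\<omega>. C / real n * (\<Sum>k<n. ?e k \<omega>))"
    by (intro integrable_mult_right Bochner_Integration.integrable_sum Bochner_Integration.integrable_add iT) simp
  have i2: "integrable M (\<lambda>\<omega>. \<bar>t\<bar> * ?dh \<omega> + R * ?dz \<omega>)"
    using parts by (intro Bochner_Integration.integrable_add integrable_mult_right)
  have i3: "integrable M (\<lambda>\<omega>. K * \<bar>A \<omega>\<bar> + 2 * C * T R K (n - 1) \<omega>)"
    using parts iT by (intro Bochner_Integration.integrable_add integrable_mult_right)
  have iG: "integrable M G" unfolding G_def by (intro Bochner_Integration.integrable_add i1 i2 i3)
  have intG: "(\<integral>\<omega>. G \<omega> \<partial>M) = C * (4 * K\<^sup>2 / N + 8 * tail R K)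
    + (\<bar>t\<bar> * deviation (\<lambda>x. \<phi> x * h x) n + R * deviation (\<lambda>x. \<phi> x * \<zeta> x x) n)
    + (K * deviation \<phi> n + 2 * C * tail R K)"
  proof -
    have "(\<integral>\<omega>. C / real n * (\<Sum>k<n. ?e k \<omega>) \<partial>M)
      = C / real n * (\<Sum>k<n. \<integral>\<omega>. ?e k \<omega> \<partial>M)"
      by (subst integral_mult_right_zero, subst Bochner_Integration.integral_sum)
        (intro Bochner_Integration.integrable_add integrable_mult_right iT, simp_all)
    also have "(\<Sum>k<n. \<integral>\<omega>. ?e k \<omega> \<partial>M) = (\<Sum>k<n. 4 * K\<^sup>2 / N + 8 * tail R K)"
    proof (intro sum.cong refl)
      fix k
      have "(\<integral>\<omega>. ?e k \<omega> \<partial>M)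
        = (\<integral>\<omega>. 4 * K\<^sup>2 / N \<partial>M) + 4 * (\<integral>\<omega>. T R K k \<omega> \<partial>M) + 4 * (\<integral>\<omega>. T R K (n - 1) \<omega> \<partial>M)"
        using iT[of k] iT[of "n - 1"] by (simp only: Bochner_Integration.integral_add Bochner_Integration.integrable_add
          integrable_mult_right integral_mult_right_zero M.integrable_const)
      then show "(\<integral>\<omega>. ?e k \<omega> \<partial>M) = 4 * K\<^sup>2 / N + 8 * tail R K"
        by (simp only: integral_tail_X) (simp add: M.prob_space)
    qed
    also have "C / real n * (\<Sum>k<n. 4 * K\<^sup>2 / N + 8 * tail R K) = C * (4 * K\<^sup>2 / N + 8 * tail R K)"
      using n by simp
    finally have e1: "(\<integral>\<omega>. C / real n * (\<Sum>k<n. ?e k \<omega>) \<partial>M) = C * (4 * K\<^sup>2 / N + 8 * tail R K)" .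
    have e2: "(\<integral>\<omega>. \<bar>t\<bar> * ?dh \<omega> + R * ?dz \<omega> \<partial>M)
      = \<bar>t\<bar> * deviation (\<lambda>x. \<phi> x * h x) n + R * deviation (\<lambda>x. \<phi> x * \<zeta> x x) n"
      unfolding cov_def[symmetric] var_def[symmetric] using parts
      by (simp only: Bochner_Integration.integral_add integrable_mult_right integral_mult_right_zero)
    have e3: "(\<integral>\<omega>. K * \<bar>A \<omega>\<bar> + 2 * C * T R K (n - 1) \<omega> \<partial>M) = K * deviation \<phi> n + 2 * C * tail R K"
      using parts(3) iT[of "n - 1"]
      by (simp only: Bochner_Integration.integral_add integrable_mult_right integral_mult_right_zero integral_tail_X)
        (simp only: A_def p_def)
    show ?thesis unfolding G_def
      by (simp only: Bochner_Integration.integral_add i1 i2 i3 Bochner_Integration.integrable_add e1 e2 e3)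
  qed
  have bH: "\<bar>b \<omega>\<bar> \<le> H R (X (n - 1) \<omega>)" for \<omega> unfolding b_eq by (rule \<beta>_bound[OF s])
  have Ab: "\<bar>A \<omega>\<bar> \<le> 2 * C" for \<omega>
  proof -
    have "\<bar>\<Sum>k<n. \<phi> (X k \<omega>)\<bar> \<le> real n * C"
      using sum_bounded_above[of "{..<n}" "\<lambda>k. \<bar>\<phi> (X k \<omega>)\<bar>" C] \<phi>_bound by (intro order_trans[OF sum_abs]) auto
    then have "\<bar>(\<Sum>k<n. \<phi> (X k \<omega>)) / real n\<bar> \<le> C" using n by (simp add: abs_divide divide_le_eq mult.commute)
    moreover have "\<bar>p\<bar> \<le> C"
      using norm_integral_le[of \<phi> \<pi> "\<lambda>_. C"] \<phi>_bound by (simp add: p_def prob_space[simplified])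
    ultimately show ?thesis unfolding A_def by linarith
  qed
  have pC: "\<bar>p\<bar> \<le> C"
    using norm_integral_le[of \<phi> \<pi> "\<lambda>_. C"] \<phi>_bound by (simp add: p_def prob_space[simplified])
  have bound: "cmod (?m \<omega>) \<le> G \<omega>" for \<omega>
  proof -
    have q1: "cmod (Q1 \<omega>) \<le> C / real n * (\<Sum>k<n. ?e k \<omega>)"
      unfolding Q1_def sum_distrib_left
    proof (rule sum_norm_le)
      fix k
      have uk: "\<bar>u k \<omega>\<bar> \<le> H R (X k \<omega>) + H R (X (n - 1) \<omega>)"
        unfolding u_def using \<beta>_bound[OF s, of "X k \<omega>" "X k \<omega>"] bH[of \<omega>] by linarith
      have "cmod ((\<i> / real n) * of_real (\<phi> (X k \<omega>)) * (of_real N * (iexp (u k \<omega> / N) - 1) - \<i> * u k \<omega>))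
        = \<bar>\<phi> (X k \<omega>)\<bar> / real n * cmod (of_real N * (iexp (u k \<omega> / N) - 1) - \<i> * u k \<omega>)"
        by (simp add: norm_mult norm_divide)
      also have "\<dots> \<le> C / real n * (?e k \<omega>)"
        by (intro mult_mono divide_right_mono \<phi>_bound iexp_linear_error uk K H_nonneg R N(1)) (auto simp: C_nonneg)
      finally show "cmod ((\<i> / real n) * of_real (\<phi> (X k \<omega>)) * (of_real N * (iexp (u k \<omega> / N) - 1) - \<i> * u k \<omega>))
        \<le> C / real n * (?e k \<omega>)" .
    qed
    have q2: "\<bar>Q2 \<omega>\<bar> \<le> \<bar>t\<bar> * ?dh \<omega> + R * ?dz \<omega>"
    proof -
      let ?x = "(\<Sum>k<n. \<phi> (X k \<omega>) * h (X k \<omega>)) / real n - cov"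
      let ?y = "(\<Sum>k<n. \<phi> (X k \<omega>) * \<zeta> (X k \<omega>) (X k \<omega>)) / real n - var"
      have "(\<Sum>k<n. \<phi> (X k \<omega>) * \<beta> s (X k \<omega>) (X k \<omega>))
        = t * (\<Sum>k<n. \<phi> (X k \<omega>) * h (X k \<omega>)) + s * (\<Sum>k<n. \<phi> (X k \<omega>) * \<zeta> (X k \<omega>) (X k \<omega>))"
        unfolding \<beta>_def by (simp add: sum_distrib_left sum.distrib algebra_simps)
      then have "Q2 \<omega> = - (t * ?x + s * ?y)"
        unfolding Q2_def by (simp add: algebra_simps add_divide_distrib)
      then have "\<bar>Q2 \<omega>\<bar> \<le> \<bar>t\<bar> * \<bar>?x\<bar> + \<bar>s\<bar> * \<bar>?y\<bar>"
        unfolding abs_mult[symmetric] by (simp only: abs_minus_cancel) (rule abs_triangle_ineq)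
      also have "\<dots> \<le> \<bar>t\<bar> * \<bar>?x\<bar> + R * \<bar>?y\<bar>"
        by (intro add_left_mono mult_right_mono s) simp
      finally show ?thesis .
    qed
    have q3: "\<bar>A \<omega> * b \<omega>\<bar> \<le> K * \<bar>A \<omega>\<bar> + 2 * C * T R K (n - 1) \<omega>"
    proof (cases "K < H R (X (n - 1) \<omega>)")
      case True
      have "\<bar>A \<omega>\<bar> * \<bar>b \<omega>\<bar> \<le> 2 * C * H R (X (n - 1) \<omega>)"
        using C_nonneg by (intro mult_mono Ab bH) auto
      moreover have "0 \<le> K * \<bar>A \<omega>\<bar>" using K by simp
      ultimately show ?thesis using True by (simp add: abs_mult)
    next
      case False
      have "\<bar>A \<omega>\<bar> * \<bar>b \<omega>\<bar> \<le> \<bar>A \<omega>\<bar> * K"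
        using bH[of \<omega>] False by (intro mult_left_mono) auto
      then show ?thesis using False by (simp add: abs_mult mult.commute)
    qed
    have "cmod (?m \<omega>) = cmod (Q1 \<omega> + of_real (Q2 \<omega>) + of_real (A \<omega> * b \<omega>))"
      by (simp only: norm_mult norm_exp_i_times mult_1_right)
    also have "\<dots> \<le> cmod (Q1 \<omega>) + cmod (of_real (Q2 \<omega>)) + cmod (of_real (A \<omega> * b \<omega>))"
      by (intro order_trans[OF norm_triangle_ineq] add_right_mono norm_triangle_ineq)
    also have "\<dots> = cmod (Q1 \<omega>) + \<bar>Q2 \<omega>\<bar> + \<bar>A \<omega> * b \<omega>\<bar>" by (simp only: norm_of_real)
    also have "\<dots> \<le> G \<omega>" unfolding G_def by (intro add_mono q1 q2 q3)
    finally show ?thesis .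
  qed
  have iF: "integrable M (F n s)" by (rule M.integrable_const_bound[of _ 1]) auto
  have imain: "integrable M (\<lambda>\<omega>. ?m \<omega>)"
  proof (rule Bochner_Integration.integrable_bound[OF iG])
    show "AE \<omega> in M. cmod (?m \<omega>) \<le> norm (G \<omega>)"
    proof (rule AE_I2)
      fix \<omega>
      have "G \<omega> \<le> norm (G \<omega>)" by simp
      with bound[of \<omega>] show "cmod (?m \<omega>) \<le> norm (G \<omega>)"
        by (rule order_trans)
    qed
    show "(\<lambda>\<omega>. ?m \<omega>) \<in> borel_measurable M"
      by measurable
  qed
  have ibF: "integrable M (\<lambda>\<omega>. of_real p * (of_real (b \<omega>) * F n s \<omega>))"
    unfolding b_def by (intro integrable_mult_right BF_integrable)
  have icF: "integrable M (\<lambda>\<omega>. of_real (t * cov + s * var) * F n s \<omega>)"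
    by (intro integrable_mult_right iF)
  have isum: "integrable M (\<lambda>\<omega>. \<Sum>k<n. \<i> / sqrt (real n) * ?D k \<omega>)"
  proof -
    have "integrable M (\<lambda>\<omega>. (?m \<omega> + of_real p * (of_real (b \<omega>) * F n s \<omega>))
       - of_real (t * cov + s * var) * F n s \<omega>)"
      by (intro Bochner_Integration.integrable_diff Bochner_Integration.integrable_add imain ibF icF)
    then show ?thesis unfolding dec[symmetric] by (simp only: add_diff_cancel_right')
  qed
  have "J' n s + of_real (t * cov + s * var) * J n s
    = (\<integral>\<omega>. (\<Sum>k<n. \<i> / sqrt (real n) * ?D k \<omega>) + of_real (t * cov + s * var) * F n s \<omega> \<partial>M)"
    unfolding J'_eq[OF n] J_def
    by (subst Bochner_Integration.integral_add[OF isum icF]) (simp only: integral_mult_right_zero)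
  also have "\<dots> = (\<integral>\<omega>. ?m \<omega> \<partial>M) + of_real p * (\<integral>\<omega>. of_real (b \<omega>) * F n s \<omega> \<partial>M)"
    unfolding dec by (subst Bochner_Integration.integral_add[OF imain ibF]) (simp only: integral_mult_right_zero)
  finally have eq: "J' n s + of_real (t * cov + s * var) * J n s
    = (\<integral>\<omega>. ?m \<omega> \<partial>M) + of_real p * (\<integral>\<omega>. of_real (b \<omega>) * F n s \<omega> \<partial>M)" .
  have "cmod (J' n s + of_real (t * cov + s * var) * J n s) \<le> (\<integral>\<omega>. G \<omega> \<partial>M) + C * (\<bar>t\<bar> * deviation h L + R * C / sqrt (real L)
      + real L * (2 * K * (\<integral>x. H R x \<partial>\<pi>) / sqrt (real n) + 2 * tail R K))"
    unfolding eq
  proof (rule order_trans[OF norm_triangle_ineq add_mono])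
    show "cmod (\<integral>\<omega>. ?m \<omega> \<partial>M) \<le> (\<integral>\<omega>. G \<omega> \<partial>M)"
      by (rule norm_integral_le[OF _ iG bound]) measurable
    show "cmod (of_real p * (\<integral>\<omega>. of_real (b \<omega>) * F n s \<omega> \<partial>M)) \<le> C * (\<bar>t\<bar> * deviation h L + R * C / sqrt (real L)
      + real L * (2 * K * (\<integral>x. H R x \<partial>\<pi>) / sqrt (real n) + 2 * tail R K))"
      unfolding norm_mult norm_of_real b_def
      by (rule mult_mono[OF pC end_term_bound[OF L s K] C_nonneg norm_ge_zero])
  qed
  then show ?thesis unfolding intG N_def .
qed

text \<open>
  The bound does not depend on \<open>s\<close>. The parameters have to be chosen in the order \<open>L\<close>, \<open>K\<close>, \<open>n\<close>, because
  the tail term carries the factor \<open>L\<close> and the remaining terms carry \<open>L\<close> and \<open>K\<close>.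
\<close>

lemma uniform_derivative_error:
  assumes R: "0 \<le> R" and e: "0 < e"
  shows "eventually (\<lambda>n. \<forall>s. \<bar>s\<bar> \<le> R \<longrightarrow> cmod (J' n s + of_real (t * cov + s * var) * J n s) \<le> e) sequentially"
proof -
  have inv_sqrt: "(\<lambda>n. c / sqrt (real n)) \<longlonglongrightarrow> 0" for c
    by (intro tendsto_divide_0[OF tendsto_const] filterlim_at_top_imp_at_infinity
      filterlim_compose[OF sqrt_at_top filterlim_real_sequentially])
  have dev: "(\<lambda>n. deviation f n) \<longlonglongrightarrow> 0" if "integrable \<pi> f" for f
    by (rule ergodic_average[OF irr that])
  have "(\<lambda>L. C * (\<bar>t\<bar> * deviation h L + R * C / sqrt (real L))) \<longlonglongrightarrow> C * (\<bar>t\<bar> * 0 + 0)"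
    by (intro tendsto_mult tendsto_add tendsto_const inv_sqrt dev[OF h_integrable])
  then have "eventually (\<lambda>L. C * (\<bar>t\<bar> * deviation h L + R * C / sqrt (real L)) < e / 3) sequentially"
    by (rule order_tendstoD(2)) (use e in simp)
  from eventually_happens'[OF sequentially_bot eventually_conj[OF this eventually_gt_at_top[of 0]]]
  obtain L where L: "C * (\<bar>t\<bar> * deviation h L + R * C / sqrt (real L)) < e / 3" "0 < L" by blast
  (* the total factor of the tail term, increased by 1 to be positive *)
  define c where "c = 10 * C + 2 * C * real L + 1"
  have c: "0 < c" using C_nonneg by (simp add: c_def add_nonneg_pos)
  have "0 < e / 3 / c" using e c by simp
  from integrable_tail_small[OF H_integrable[of R] this]
  obtain K where K: "0 \<le> K" "(\<integral>x. \<bar>H R x\<bar> * of_bool (K < \<bar>H R x\<bar>) \<partial>\<pi>) < e / 3 / c" by blast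
  have "(\<integral>x. \<bar>H R x\<bar> * of_bool (K < \<bar>H R x\<bar>) \<partial>\<pi>) = tail R K"
    unfolding tail_def using H_nonneg[OF R]
    by (intro Bochner_Integration.integral_cong refl) simp
  then have "tail R K < e / 3 / c" using K(2) by simp
  then have "c * tail R K < e / 3" using c by (simp only: pos_less_divide_eq mult.commute)
  moreover have "0 \<le> tail R K" unfolding tail_def using H_nonneg[OF R] by (intro integral_nonneg_AE) auto
  ultimately have tl: "(10 * C + 2 * C * real L) * tail R K < e / 3"
    by (simp add: c_def distrib_right)
  define g where "g = (\<lambda>n. (C * (4 * K\<^sup>2)) / sqrt (real n)
    + (\<bar>t\<bar> * deviation (\<lambda>x. \<phi> x * h x) n + R * deviation (\<lambda>x. \<phi> x * \<zeta> x x) n)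
    + K * deviation \<phi> n + (C * real L * (2 * K * (\<integral>x. H R x \<partial>\<pi>))) / sqrt (real n))"
  have "g \<longlonglongrightarrow> 0 + (\<bar>t\<bar> * 0 + R * 0) + K * 0 + 0"
    unfolding g_def
    by (intro tendsto_add tendsto_mult tendsto_const inv_sqrt dev[OF \<phi>h_integrable]
      dev[OF bdd_measurable_integrable(2)[OF \<phi>\<zeta>_bdd_measurable]] dev[OF bdd_measurable_integrable(2)[OF \<phi>_bdd_measurable]])
  then have "eventually (\<lambda>n. g n < e / 3) sequentially"
    by (rule order_tendstoD(2)) (use e in simp)
  then show ?thesis
    using eventually_ge_at_top[of L]
  proof eventually_elim
    case (elim n)
    show ?case
    proof (intro allI impI)
      fix s assume s: "\<bar>s\<bar> \<le> R"
      have "cmod (J' n s + of_real (t * cov + s * var) * J n s)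
        \<le> g n + (10 * C + 2 * C * real L) * tail R K + C * (\<bar>t\<bar> * deviation h L + R * C / sqrt (real L))"
      proof -
        have alg: "c1 * (a / S + 8 * x) + T1 + (y + 2 * c1 * x) + c1 * (z1 + z2 + l * (b / S + 2 * x))
          = ((c1 * a) / S + T1 + y + (c1 * l * b) / S) + (10 * c1 + 2 * c1 * l) * x + c1 * (z1 + z2)"
          for c1 a S x T1 y z1 z2 l b :: real
          by (simp add: algebra_simps)
        show ?thesis
          using derivative_error[OF L(2) elim(2) s K(1)] unfolding g_def alg .
      qed
      also have "\<dots> \<le> e"
      proof -
        have "a + b + c \<le> e" if "a < e / 3" "b < e / 3" "c < e / 3" for a b c
          using that by linarith
        from this[OF elim(1) tl L(1)] show ?thesis .
      qed
      finally show "cmod (J' n s + of_real (t * cov + s * var) * J n s) \<le> e" .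
    qed
  qed
qed

text \<open>
  With the integrating factor \<open>exp(p(s))\<close>, where \<open>p' = t cov + s var\<close>, the approximate differential equation
  says that \<open>exp(p(s)) J\<^sub>n(s)\<close> is almost constant, and \<open>\<bar>J\<^sub>n(s)\<bar> \<le> 1\<close>.
\<close>

lemma characteristic_function_bound:
  assumes e: "0 < e"
  shows "eventually (\<lambda>n. cmod (J n 0) \<le> exp (t * s * cov + s\<^sup>2 * var / 2) + e) sequentially"
proof -
  define R where "R = \<bar>s\<bar>"
  define p where "p = (\<lambda>r. t * r * cov + r\<^sup>2 * var / 2)"
  define Q where "Q = R * \<bar>t * cov\<bar> + R\<^sup>2 * \<bar>var\<bar> / 2"
  (* Q bounds p on the segment from 0 to s; with this d the integrated error is at most e *)
  define d where "d = e / (exp Q * (R + 1))"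
  have R: "0 \<le> R" by (simp add: R_def)
  have d: "0 < d" using e R by (simp add: d_def)
  have pQ: "p r \<le> Q" if "\<bar>r\<bar> \<le> R" for r
  proof -
    have r: "r * x \<le> R * \<bar>x\<bar>" for x
      by (rule order_trans[OF abs_ge_self]) (simp add: that abs_mult mult_right_mono)
    have "r\<^sup>2 \<le> R\<^sup>2" using that R by (intro iffD1[OF abs_le_square_iff]) simp
    then have r2: "r\<^sup>2 * x \<le> R\<^sup>2 * \<bar>x\<bar>" for x
      by (intro order_trans[OF abs_ge_self[of "r\<^sup>2 * x"]]) (simp add: abs_mult mult_right_mono)
    have "p r = r * (t * cov) + (r\<^sup>2 * var) / 2" by (simp add: p_def)
    also have "\<dots> \<le> Q" unfolding Q_def
      by (intro add_mono divide_right_mono r r2) simp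
    finally show ?thesis .
  qed
  show ?thesis
    using uniform_derivative_error[OF R d]
  proof eventually_elim
    case (elim n)
    define G where "G = (\<lambda>r. exp (p r) *\<^sub>R J n r)"
    define G' where "G' = (\<lambda>r. exp (p r) *\<^sub>R (J' n r + of_real (t * cov + r * var) * J n r))"
    have der: "(G has_vector_derivative G' r) (at r within S)" for r S
    proof -
      have "(p has_real_derivative (t * cov + r * var)) (at r)"
        unfolding p_def by (auto intro!: derivative_eq_intros)
      from has_vector_derivative_scaleR[OF DERIV_fun_exp[OF this] J_derivative[of n r]]
      have "(G has_vector_derivative (exp (p r) *\<^sub>R J' n r + (exp (p r) * (t * cov + r * var)) *\<^sub>R J n r)) (at r)"
        unfolding G_def .
      also have "exp (p r) *\<^sub>R J' n r + (exp (p r) * (t * cov + r * var)) *\<^sub>R J n r = G' r"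
        unfolding G'_def by (simp add: scaleR_conv_of_real distrib_left)
      finally show ?thesis by (rule has_vector_derivative_at_within)
    qed
    have bound: "onorm (\<lambda>x. x *\<^sub>R G' r) \<le> exp Q * d" if "r \<in> {- R..R}" for r
    proof (rule onorm_bound)
      have "cmod (G' r) = exp (p r) * cmod (J' n r + of_real (t * cov + r * var) * J n r)"
        unfolding G'_def by simp
      also have "\<dots> \<le> exp Q * d"
        using elim pQ[of r] that by (intro mult_mono) (auto simp: abs_le_iff)
      finally have "cmod (G' r) \<le> exp Q * d" .
      then show "norm (x *\<^sub>R G' r) \<le> exp Q * d * norm x" for x :: real
        by (simp add: mult.commute mult_left_mono)
    qed (use d in simp)
    have "norm (G 0 - G s) \<le> exp Q * d * norm (0 - s)"
    proof (rule differentiable_bound[where S = "{- R..R}" and f' = "\<lambda>r x. x *\<^sub>R G' r"])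
      show "(G has_derivative (\<lambda>x. x *\<^sub>R G' r)) (at r within {- R..R})" for r
        using der[of r] by (simp add: has_vector_derivative_def)
    qed (auto simp: R_def bound[unfolded R_def])
    also have "\<dots> \<le> exp Q * d * (R + 1)"
      using d by (intro mult_left_mono) (auto simp: R_def)
    also have "\<dots> = e"
      using R by (simp add: d_def)
    finally have "norm (G 0 - G s) \<le> e" .
    moreover have "norm (G 0) \<le> norm (G s) + norm (G 0 - G s)"
      using norm_triangle_ineq[of "G s" "G 0 - G s"] by simp
    moreover have "norm (G 0) = cmod (J n 0)" by (simp add: G_def p_def)
    moreover have "norm (G s) \<le> exp (p s)"
    proof -
      have "cmod (J n s) \<le> (\<integral>\<omega>. 1 \<partial>M)"
        unfolding J_def by (rule norm_integral_le) auto
      then have "cmod (J n s) \<le> 1" by (simp add: M.prob_space)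
      then show ?thesis by (simp add: G_def mult_left_le)
    qed
    ultimately have "cmod (J n 0) \<le> exp (p s) + e" by linarith
    then show ?case by (simp only: p_def)
  qed
qed

lemma J_0_eq_char:
  "J n 0 = char (distr M borel (\<lambda>\<omega>. additive_functional h X n \<omega> / sqrt (real n))) t"
proof -
  have [measurable]: "(\<lambda>\<omega>. additive_functional h X n \<omega>) \<in> borel_measurable M"
    unfolding additive_functional_def by measurable
  have "W n 0 (path \<omega>) = t * (additive_functional h X n \<omega> / sqrt (real n))" for \<omega>
    by (simp add: W_def \<beta>_def additive_functional_def sum_distrib_left)
  then show ?thesis
    unfolding J_def char_def by (subst integral_distr) auto
qed

end

section \<open>The Gaussian bound on the characteristic function\<close>

context stationary_chain
begin

text \<open>
  The restriction keeps \<open>h / q\<close> bounded, as required of a perturbation weight. Only the weight is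
  truncated: the sums \<open>S\<^sub>n\<close> involve the original \<open>h\<close>, about which the hypotheses speak.
\<close>

definition truncated_variance :: "('a \<Rightarrow> real) \<Rightarrow> nat \<Rightarrow> real" where
  "truncated_variance h N = (\<integral>x. (h x)\<^sup>2 * (holding_prob P x / moving_prob P x) *
    indicator {x. \<bar>h x\<bar> \<le> real N \<and> 1 / real N \<le> moving_prob P x} x \<partial>\<pi>)"

lemma char_additive_functional_bound:
  assumes irr: "phi_irreducible P" and h: "integrable \<pi> h" "(\<integral>x. h x \<partial>\<pi>) = 0"
    and N: "0 < N" and e: "0 < e"
  shows "eventually (\<lambda>n. cmod (char (distr M borel (\<lambda>\<omega>. additive_functional h X n \<omega> / sqrt (real n))) t)
    \<le> exp (- (t\<^sup>2 * truncated_variance h N / 2)) + e) sequentially"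
proof -
  have [measurable]: "h \<in> borel_measurable borel"
    using borel_measurable_integrable[OF h(1)] by simp
  define D where "D = {x. \<bar>h x\<bar> \<le> real N \<and> 1 / real N \<le> moving_prob P x}"
  have [measurable]: "D \<in> sets borel" unfolding D_def by measurable
  (* the weight that maximises cov\<^sup>2 / var on D *)
  define w where "w = (\<lambda>x. h x / moving_prob P x * indicator D x)"
  have w: "\<bar>w x\<bar> \<le> real N * real N" for x
  proof (cases "x \<in> D")
    case True
    then have 1: "\<bar>h x\<bar> \<le> real N" and 2: "1 / real N \<le> moving_prob P x" by (auto simp: D_def)
    have "0 < 1 / real N" using N by simp
    then have q: "0 < moving_prob P x" using 2 by linarith
    have "1 / moving_prob P x \<le> real N" using 2 q N by (simp add: field_simps)
    then have "\<bar>h x\<bar> * (1 / moving_prob P x) \<le> real N * real N"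
      using 1 q by (intro mult_mono) auto
    then show ?thesis using True q by (simp add: w_def abs_mult abs_divide)
  qed (simp add: w_def)
  interpret hold_perturbation P \<pi> M X h w "real N * real N" t
    by unfold_locales (auto simp: irr h w, auto simp: w_def)
  have wq: "w x * moving_prob P x = h x * indicator D x" for x
    using N by (auto simp: w_def D_def indicator_def)
  have cov: "cov = truncated_variance h N"
    unfolding cov_def truncated_variance_def D_def[symmetric] \<phi>_def
    by (intro Bochner_Integration.integral_cong refl) (simp add: w_def power2_eq_square)
  have var: "var = truncated_variance h N"
    unfolding var_def truncated_variance_def D_def[symmetric] \<phi>_def \<zeta>_diag wq
    by (intro Bochner_Integration.integral_cong refl) (simp add: w_def power2_eq_square indicator_def)
  have exponent: "t * - t * v + (- t)\<^sup>2 * v / 2 = - (t\<^sup>2 * v / 2)" for v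
    by (simp add: power2_eq_square)
  show ?thesis
    using characteristic_function_bound[OF e, of "- t"]
    unfolding J_0_eq_char cov var exponent .
qed

end

section \<open>Consequences of tightness and of the central limit theorem\<close>

lemma char_normal_law:
  assumes "0 \<le> v"
  shows "char (normal_law 0 v) t = of_real (exp (- (t\<^sup>2 * v / 2)))"
proof (cases "v = 0")
  case True
  have "char (return borel 0) t = 1"
    unfolding char_def by (subst integral_return) auto
  then show ?thesis using True by (simp add: normal_law_def)
next
  case False
  define \<sigma> where "\<sigma> = sqrt v"
  have \<sigma>: "0 < \<sigma>" "\<sigma>\<^sup>2 = v" using assms False by (auto simp: \<sigma>_def)
  let ?S = "std_normal_distribution"
  interpret S: real_distribution ?S by (rule real_dist_normal_dist)
  have "distributed ?S lborel (\<lambda>x. (\<sigma> * x - 0) / \<sigma>) std_normal_density"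
    unfolding distributed_def using \<sigma> by (auto simp: distr_id2)
  then have "distributed ?S lborel (\<lambda>x. \<sigma> * x) (normal_density 0 \<sigma>)"
    using S.normal_standard_normal_convert[OF \<sigma>(1), of "\<lambda>x. \<sigma> * x" 0] by simp
  then have eq: "distr ?S lborel (\<lambda>x. \<sigma> * x) = density lborel (normal_density 0 \<sigma>)"
    by (rule distributed_distr_eq_density)
  have "char (normal_law 0 v) t = (\<integral>x. iexp (t * x) \<partial>density lborel (normal_density 0 \<sigma>))"
    using False by (simp add: char_def normal_law_def \<sigma>_def)
  also have "\<dots> = (\<integral>x. iexp ((t * \<sigma>) * x) \<partial>?S)"
    unfolding eq[symmetric] by (subst integral_distr) (auto simp: mult.assoc)
  also have "\<dots> = char ?S (t * \<sigma>)" by (simp only: char_def)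
  finally show ?thesis
    by (simp add: char_std_normal_distribution power_mult_distrib \<sigma>)
qed

lemma real_distribution_normal_law: "0 \<le> v \<Longrightarrow> real_distribution (normal_law 0 v)"
proof -
  assume v: "0 \<le> v"
  have "prob_space (normal_law 0 v)"
    using v by (auto simp: normal_law_def intro!: prob_space_return prob_space_normal_density)
  then show ?thesis
    by (auto simp: real_distribution_def real_distribution_axioms_def normal_law_def)
qed

text \<open>
  Each of the \<open>n\<close> summands is at most one of the first \<open>n\<close> terms of the geometric series.
\<close>

lemma geometric_derivative_bound:
  fixes r :: real
  assumes "0 \<le> r" "r < 1"
  shows "real n * r ^ n \<le> r / (1 - r)"
proof -
  have 1: "real n * r ^ n \<le> (\<Sum>k<n. r ^ Suc k)"
  proof -
    have "(\<Sum>k<n. r ^ n) \<le> (\<Sum>k<n. r ^ Suc k)"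
      using assms by (intro sum_mono power_decreasing) auto
    then show ?thesis by simp
  qed
  also have "(\<Sum>k<n. r ^ Suc k) = r * (\<Sum>k<n. r ^ k)" by (simp add: sum_distrib_left)
  also have "\<dots> = r * ((1 - r ^ n) / (1 - r))" using assms by (simp add: sum_gp_strict)
  also have "\<dots> \<le> r * (1 / (1 - r))"
    using assms by (intro mult_left_mono divide_right_mono) auto
  finally show ?thesis by simp
qed

context stationary_chain
begin

lemma holding_variance_le:
  fixes h :: "'a \<Rightarrow> real"
  assumes [measurable]: "h \<in> borel_measurable borel" and h: "integrable \<pi> h"
    and le: "\<And>N. 0 < N \<Longrightarrow> truncated_variance h N \<le> c"
  shows "(\<integral>\<^sup>+x\<in>{x. moving_prob P x > 0}.
    ennreal ((h x)\<^sup>2 * (holding_prob P x / moving_prob P x)) \<partial>\<pi>) \<le> ennreal c"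
proof -
  define D where "D = (\<lambda>N. {x. \<bar>h x\<bar> \<le> real N \<and> 1 / real N \<le> moving_prob P x})"
  define g where "g = (\<lambda>x. (h x)\<^sup>2 * (holding_prob P x / moving_prob P x))"
  have [measurable]: "D N \<in> sets borel" "g \<in> borel_measurable borel" for N
    unfolding D_def g_def by measurable
  have g0: "0 \<le> g x" for x by (simp add: g_def moving_prob_nonneg)
  (* the index starts at 1, because 1 / real 0 = 0 would admit q = 0 *)
  have D_mono: "D (Suc N) \<subseteq> D (Suc N')" if "N \<le> N'" for N N'
  proof -
    have "1 / real (Suc N') \<le> 1 / real (Suc N)" using that by (intro divide_left_mono) auto
    then show ?thesis using that unfolding D_def by (auto intro: order_trans)
  qed
  have inc: "incseq (\<lambda>N x. ennreal (g x) * indicator (D (Suc N)) x)"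
    unfolding incseq_def le_fun_def using D_mono by (auto simp: indicator_def)
  have "(SUP N. ennreal (g x) * indicator (D (Suc N)) x) = ennreal (g x) * indicator {x. moving_prob P x > 0} x" for x
  proof (cases "moving_prob P x > 0")
    case True
    obtain A :: nat where A: "\<bar>h x\<bar> \<le> real A" using real_arch_simple by blast
    obtain E :: nat where E: "1 / moving_prob P x \<le> real E" using real_arch_simple by blast
    let ?N = "max A E"
    have "1 / moving_prob P x \<le> real (Suc ?N)" using E by simp
    then have "1 / real (Suc ?N) \<le> moving_prob P x" using True by (simp add: field_simps)
    moreover have "\<bar>h x\<bar> \<le> real (Suc ?N)" using A by simp
    ultimately have x: "x \<in> D (Suc ?N)" unfolding D_def by blast
    show ?thesis
    proof (rule antisym)
      show "(SUP N. ennreal (g x) * indicator (D (Suc N)) x) \<le> ennreal (g x) * indicator {x. moving_prob P x > 0} x"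
        using True by (intro SUP_least) (auto simp: indicator_def)
      show "ennreal (g x) * indicator {x. moving_prob P x > 0} x \<le> (SUP N. ennreal (g x) * indicator (D (Suc N)) x)"
        using True x by (intro SUP_upper2[of ?N]) auto
    qed
  next
    case False
    have "x \<notin> D (Suc N)" for N
    proof
      assume "x \<in> D (Suc N)"
      then have "1 / real (Suc N) \<le> moving_prob P x" by (simp add: D_def)
      moreover have "0 < 1 / real (Suc N)" by simp
      ultimately show False using False by linarith
    qed
    then show ?thesis using False by simp
  qed
  then have "(\<integral>\<^sup>+x\<in>{x. moving_prob P x > 0}. ennreal (g x) \<partial>\<pi>)
      = (\<integral>\<^sup>+x. (SUP N. ennreal (g x) * indicator (D (Suc N)) x) \<partial>\<pi>)"
    by simp
  also have "\<dots> = (SUP N. \<integral>\<^sup>+x. ennreal (g x) * indicator (D (Suc N)) x \<partial>\<pi>)"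
    by (rule nn_integral_monotone_convergence_SUP[OF inc]) measurable
  also have "\<dots> \<le> ennreal c"
  proof (rule SUP_least)
    fix N
    have gb: "g x * indicator (D (Suc N)) x \<le> (real (Suc N))\<^sup>2 * real (Suc N)" for x
    proof (cases "x \<in> D (Suc N)")
      case True
      then have 1: "\<bar>h x\<bar> \<le> real (Suc N)" and 2: "1 / real (Suc N) \<le> moving_prob P x" by (auto simp: D_def)
      have "0 < 1 / real (Suc N)" by simp
      then have q: "0 < moving_prob P x" using 2 by linarith
      have "1 / moving_prob P x \<le> real (Suc N)" using 2 q by (simp add: field_simps)
      moreover have "holding_prob P x / moving_prob P x \<le> 1 / moving_prob P x"
        using q by (intro divide_right_mono) auto
      ultimately have "holding_prob P x / moving_prob P x \<le> real (Suc N)" by linarith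
      moreover have "(h x)\<^sup>2 \<le> (real (Suc N))\<^sup>2"
        using 1 by (intro iffD1[OF abs_le_square_iff]) simp
      ultimately have "g x \<le> (real (Suc N))\<^sup>2 * real (Suc N)"
        unfolding g_def by (intro mult_mono) (auto simp: moving_prob_nonneg)
      then show ?thesis using True by simp
    qed simp
    have int: "integrable \<pi> (\<lambda>x. g x * indicator (D (Suc N)) x)"
    proof (rule integrable_const_bound)
      show "AE x in \<pi>. norm (g x * indicator (D (Suc N)) x) \<le> (real (Suc N))\<^sup>2 * real (Suc N)"
      proof (rule AE_I2)
        fix x
        have "0 \<le> g x * indicator (D (Suc N)) x" using g0[of x] by simp
        then show "norm (g x * indicator (D (Suc N)) x) \<le> (real (Suc N))\<^sup>2 * real (Suc N)"
          using gb[of x] by (simp only: real_norm_def abs_of_nonneg)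
      qed
    qed measurable
    have "(\<integral>\<^sup>+x. ennreal (g x) * indicator (D (Suc N)) x \<partial>\<pi>) = (\<integral>\<^sup>+x. ennreal (g x * indicator (D (Suc N)) x) \<partial>\<pi>)"
      by (intro nn_integral_cong) (simp add: indicator_def)
    also have "\<dots> = ennreal (\<integral>x. g x * indicator (D (Suc N)) x \<partial>\<pi>)"
      using g0 by (intro nn_integral_eq_integral[OF int]) auto
    also have "\<dots> = ennreal (truncated_variance h (Suc N))"
      unfolding truncated_variance_def g_def D_def ..
    also have "\<dots> \<le> ennreal c" by (intro ennreal_leI le) simp
    finally show "(\<integral>\<^sup>+x. ennreal (g x) * indicator (D (Suc N)) x \<partial>\<pi>) \<le> ennreal c" .
  qed
  finally show ?thesis unfolding g_def .
qed

text \<open>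
  States with \<open>q = 0\<close> are absorbing, so any set of them is closed.
\<close>

lemma nonpositive_on_absorbing:
  fixes h :: "'a \<Rightarrow> real"
  assumes irr: "phi_irreducible P" and h: "integrable \<pi> h" and mean: "(\<integral>x. h x \<partial>\<pi>) = 0"
  shows "AE x in \<pi>. moving_prob P x = 0 \<longrightarrow> h x \<le> 0"
proof -
  have [measurable]: "h \<in> borel_measurable borel"
    using borel_measurable_integrable[OF h] by simp
  define A where "A = {x. moving_prob P x = 0 \<and> 0 < h x}"
  have A [measurable]: "A \<in> sets borel" unfolding A_def by measurable
  have closed: "AE x in \<pi>. x \<in> A \<longrightarrow> emeasure (P x) (- A) = 0"
  proof (intro AE_I2 impI)
    fix x assume "x \<in> A"
    interpret Px: prob_space "P x" by (rule prob_space_P)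
    have "Px.prob {x} = 1" using \<open>x \<in> A\<close> by (simp add: A_def moving_prob_def holding_prob_def)
    then have "Px.prob (- {x}) = 0" using Px.prob_compl[of "{x}"] by (simp add: Compl_eq_Diff_UNIV)
    then have "emeasure (P x) (- {x}) = 0" by (simp add: Px.emeasure_eq_measure)
    moreover have "emeasure (P x) (- A) \<le> emeasure (P x) (- {x})"
      using \<open>x \<in> A\<close> by (intro emeasure_mono) (auto simp: Compl_eq_Diff_UNIV)
    ultimately show "emeasure (P x) (- A) = 0" by simp
  qed
  from zero_one_law[OF irr A closed] show ?thesis
  proof
    assume "AE x in \<pi>. x \<in> A"
    then have pos: "AE x in \<pi>. 0 < h x" by eventually_elim (simp add: A_def)
    then have "AE x in \<pi>. 0 \<le> h x" by eventually_elim simp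
    then have "AE x in \<pi>. h x = 0"
      using integral_nonneg_eq_0_iff_AE[OF h] mean by simp
    with pos have "AE x in \<pi>. False" by eventually_elim simp
    then show ?thesis by simp
  next
    assume "AE x in \<pi>. x \<notin> A"
    then show ?thesis by eventually_elim (auto simp: A_def not_less)
  qed
qed

lemma zero_on_absorbing:
  fixes h :: "'a \<Rightarrow> real"
  assumes irr: "phi_irreducible P" and h: "integrable \<pi> h" and mean: "(\<integral>x. h x \<partial>\<pi>) = 0"
  shows "AE x in \<pi>. moving_prob P x = 0 \<longrightarrow> h x = 0"
proof -
  have "AE x in \<pi>. moving_prob P x = 0 \<longrightarrow> h x \<le> 0"
    by (rule nonpositive_on_absorbing[OF irr h mean])
  moreover have "AE x in \<pi>. moving_prob P x = 0 \<longrightarrow> - h x \<le> 0"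
    using h mean by (intro nonpositive_on_absorbing[OF irr]) auto
  ultimately show ?thesis by eventually_elim auto
qed

lemma holding_moment_limit:
  fixes h :: "'a \<Rightarrow> real"
  assumes h [measurable]: "h \<in> borel_measurable borel"
    and fin: "(\<integral>\<^sup>+x\<in>{x. moving_prob P x > 0}.
      ennreal ((h x)\<^sup>2 * (holding_prob P x / moving_prob P x)) \<partial>\<pi>) < \<infinity>"
    and zero: "AE x in \<pi>. moving_prob P x = 0 \<longrightarrow> h x = 0"
  shows "(\<lambda>n. of_nat n * (\<integral>\<^sup>+\<omega>. ennreal ((h (X 0 \<omega>))\<^sup>2 * holding_prob P (X 0 \<omega>) ^ n) \<partial>M)) \<longlonglongrightarrow> 0"
proof -
  define g where "g = (\<lambda>n x. ennreal (real n * ((h x)\<^sup>2 * holding_prob P x ^ n)))"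
  have [measurable]: "g n \<in> borel_measurable borel" for n unfolding g_def by measurable
  have eq: "of_nat n * (\<integral>\<^sup>+\<omega>. ennreal ((h (X 0 \<omega>))\<^sup>2 * holding_prob P (X 0 \<omega>) ^ n) \<partial>M) = (\<integral>\<^sup>+x. g n x \<partial>\<pi>)" for n
  proof -
    have "(\<integral>\<^sup>+x. g n x \<partial>\<pi>) = (\<integral>\<^sup>+\<omega>. g n (X 0 \<omega>) \<partial>M)"
      unfolding distr_X0[symmetric] by (subst nn_integral_distr) auto
    also have "\<dots> = (\<integral>\<^sup>+\<omega>. of_nat n * ennreal ((h (X 0 \<omega>))\<^sup>2 * holding_prob P (X 0 \<omega>) ^ n) \<partial>M)"
      unfolding g_def by (intro nn_integral_cong) (simp add: ennreal_mult ennreal_of_nat_eq_real_of_nat)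
    finally show ?thesis by (simp add: nn_integral_cmult)
  qed
  have hold: "holding_prob P x < 1" if "moving_prob P x > 0" for x
    using that by (simp add: moving_prob_def)
  have bound: "g n x \<le> ennreal ((h x)\<^sup>2 * (holding_prob P x / moving_prob P x))" if "moving_prob P x > 0" for n x
  proof -
    have "real n * holding_prob P x ^ n \<le> holding_prob P x / moving_prob P x"
      using geometric_derivative_bound[OF _ hold[OF that], of n] by (simp add: moving_prob_def)
    then have "(h x)\<^sup>2 * (real n * holding_prob P x ^ n) \<le> (h x)\<^sup>2 * (holding_prob P x / moving_prob P x)"
      by (intro mult_left_mono) auto
    then show ?thesis unfolding g_def by (intro ennreal_leI) (simp only: mult_ac)
  qed
  have "(\<lambda>n. \<integral>\<^sup>+x. g n x \<partial>\<pi>) \<longlonglongrightarrow> (\<integral>\<^sup>+x. 0 \<partial>\<pi>)"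
  proof (rule nn_integral_dominated_convergence[OF _ _ _ _ fin])
    show "AE x in \<pi>. g n x \<le> ennreal ((h x)\<^sup>2 * (holding_prob P x / moving_prob P x)) * indicator {x. moving_prob P x > 0} x" for n
      using zero
    proof eventually_elim
      case (elim x)
      show ?case
      proof (cases "moving_prob P x > 0")
        case True
        then show ?thesis using bound by simp
      next
        case False
        then have "moving_prob P x = 0" using moving_prob_nonneg[of x] by simp
        then show ?thesis using elim by (simp add: g_def)
      qed
    qed
    show "AE x in \<pi>. (\<lambda>n. g n x) \<longlonglongrightarrow> 0"
      using zero
    proof eventually_elim
      case (elim x)
      show ?case
      proof (cases "moving_prob P x > 0")
        case True
        have "(\<lambda>n. real n * holding_prob P x ^ n) \<longlonglongrightarrow> 0"
          using powser_times_n_limit_0[of "holding_prob P x"] hold[OF True] by simp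
        then have "(\<lambda>n. ennreal ((h x)\<^sup>2 * (real n * holding_prob P x ^ n))) \<longlonglongrightarrow> ennreal ((h x)\<^sup>2 * 0)"
          by (intro tendsto_ennrealI tendsto_mult tendsto_const)
        then show ?thesis unfolding g_def by (simp add: mult_ac)
      next
        case False
        then have "moving_prob P x = 0" using moving_prob_nonneg[of x] by simp
        then show ?thesis using elim by (simp add: g_def)
      qed
    qed
  qed measurable
  then show ?thesis by (simp add: eq)
qed

end

text \<open>
  At \<open>t = 1 / (4 N)\<close> the exponential stays within \<open>1/4\<close> of \<open>1\<close> on \<open>{\<bar>Y\<bar> < N}\<close>, and within \<open>2\<close> on the remaining
  event of probability at most \<open>1/8\<close>.
\<close>

lemma (in prob_space) char_ge_half:
  fixes Y :: "'a \<Rightarrow> real"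
  assumes Y [measurable]: "Y \<in> borel_measurable M" and N: "0 < N"
    and small: "measure M {\<omega> \<in> space M. N \<le> \<bar>Y \<omega>\<bar>} \<le> 1 / 8"
  shows "1 / 2 \<le> cmod (char (distr M borel Y) (1 / (4 * N)))"
proof -
  let ?t = "1 / (4 * N)"
  let ?E = "{\<omega> \<in> space M. N \<le> \<bar>Y \<omega>\<bar>}"
  have i: "integrable M (\<lambda>\<omega>. iexp (?t * Y \<omega>))" by (rule integrable_const_bound[of _ 1]) auto
  have iE: "integrable M (indicator ?E :: 'a \<Rightarrow> real)" by (intro integrable_real_indicator) (auto simp: emeasure_eq_measure)
  have "char (distr M borel Y) ?t = (\<integral>\<omega>. iexp (?t * Y \<omega>) \<partial>M)"
    unfolding char_def by (subst integral_distr) auto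
  then have "char (distr M borel Y) ?t - 1 = (\<integral>\<omega>. iexp (?t * Y \<omega>) - 1 \<partial>M)"
    using i by (simp add: prob_space)
  moreover have "cmod (\<integral>\<omega>. iexp (?t * Y \<omega>) - 1 \<partial>M) \<le> (\<integral>\<omega>. 1 / 4 + 2 * indicator ?E \<omega> \<partial>M)"
  proof -
    have "cmod (\<integral>\<omega>. iexp (?t * Y \<omega>) - 1 \<partial>M) \<le> (\<integral>\<omega>. cmod (iexp (?t * Y \<omega>) - 1) \<partial>M)"
      by (rule integral_norm_bound)
    also have "\<dots> \<le> (\<integral>\<omega>. 1 / 4 + 2 * indicator ?E \<omega> \<partial>M)"
    proof (rule integral_mono)
      show "integrable M (\<lambda>\<omega>. cmod (iexp (?t * Y \<omega>) - 1))"
        using i by (intro integrable_norm Bochner_Integration.integrable_diff) auto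
      show "integrable M (\<lambda>\<omega>. 1 / 4 + 2 * indicator ?E \<omega> :: real)"
        using iE by simp
      fix \<omega> assume \<omega>: "\<omega> \<in> space M"
      show "cmod (iexp (?t * Y \<omega>) - 1) \<le> 1 / 4 + 2 * indicator ?E \<omega>"
      proof (cases "N \<le> \<bar>Y \<omega>\<bar>")
        case True
        have "cmod (iexp (?t * Y \<omega>) - 1) \<le> 2"
          using norm_triangle_ineq4[of "iexp (?t * Y \<omega>)" 1] by (simp only: norm_exp_i_times norm_one one_add_one)
        then show ?thesis using True \<omega> by simp
      next
        case False
        have "\<bar>?t * Y \<omega>\<bar> \<le> 1 / 4" using False N by (simp add: abs_mult field_simps)
        from order_trans[OF cmod_iexp_minus_1_le this] show ?thesis using False by simp
      qed
    qed
    finally show ?thesis .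
  qed
  moreover have "(\<integral>\<omega>. 1 / 4 + 2 * indicator ?E \<omega> \<partial>M) = 1 / 4 + 2 * measure M ?E"
    using iE by (simp add: prob_space)
  ultimately have "cmod (char (distr M borel Y) ?t - 1) \<le> 1 / 2" using small by simp
  then show ?thesis
    using norm_triangle_ineq2[of 1 "1 - char (distr M borel Y) ?t"] by (simp add: norm_minus_commute)
qed

theorem theorem4p1:
  fixes P :: "'a::polish_space \<Rightarrow> 'a measure"
    and \<pi> :: "'a measure"
    and M :: "'w measure"
    and X :: "nat \<Rightarrow> 'w \<Rightarrow> 'a"
    and h :: "'a \<Rightarrow> real"
  assumes "markov_kernel P"
    and "stationary_distribution P \<pi>"
    and "ergodic_kernel P \<pi>"
    and "stationary_markov_chain M P \<pi> X"
    and "integrable \<pi> h"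
    and "(\<integral>x. h x \<partial>\<pi>) = 0"
  shows "(bounded_in_probability M (\<lambda>n \<omega>. additive_functional h X n \<omega> / sqrt (real n)) \<longrightarrow>
        (AE x in \<pi>. moving_prob P x = 0 \<longrightarrow> h x = 0) \<and>
        (\<integral>\<^sup>+x\<in>{x. moving_prob P x > 0}.
            ennreal ((h x)\<^sup>2 * (holding_prob P x / moving_prob P x)) \<partial>\<pi>) < \<infinity> \<and>
        (\<lambda>n. of_nat n * (\<integral>\<^sup>+\<omega>. ennreal ((h (X 0 \<omega>))\<^sup>2 * holding_prob P (X 0 \<omega>) ^ n) \<partial>M))
          \<longlonglongrightarrow> 0)
    \<and> (\<forall>\<sigma>2::real. 0 \<le> \<sigma>2 \<and>
          weak_conv_m (\<lambda>n. distr M borel (\<lambda>\<omega>. additive_functional h X n \<omega> / sqrt (real n)))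
            (normal_law 0 \<sigma>2) \<longrightarrow>
        (\<integral>\<^sup>+x\<in>{x. moving_prob P x > 0}.
            ennreal ((h x)\<^sup>2 * (holding_prob P x / moving_prob P x)) \<partial>\<pi>) \<le> ennreal \<sigma>2)"
proof -
  interpret stationary_chain P \<pi> M X
    using assms by unfold_locales
  have irr: "phi_irreducible P" using assms(3) by (simp add: ergodic_kernel_def)
  note h = assms(5,6)
  have hm [measurable]: "h \<in> borel_measurable borel"
    using borel_measurable_integrable[OF h(1)] by simp
  let ?Y = "\<lambda>n \<omega>. additive_functional h X n \<omega> / sqrt (real n)"
  let ?V = "\<integral>\<^sup>+x\<in>{x. moving_prob P x > 0}.
            ennreal ((h x)\<^sup>2 * (holding_prob P x / moving_prob P x)) \<partial>\<pi>"
  have Ym [measurable]: "?Y n \<in> borel_measurable M" for n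
    unfolding additive_functional_def by measurable
  note zero = zero_on_absorbing[OF irr h]
  show ?thesis
  proof (intro conjI impI allI)
    assume bdd: "bounded_in_probability M ?Y"
    show "AE x in \<pi>. moving_prob P x = 0 \<longrightarrow> h x = 0" by (rule zero)
    let ?p = "\<lambda>N n. measure M {\<omega> \<in> space M. \<bar>?Y n \<omega>\<bar> \<ge> N}"
    (* tightness keeps all characteristic functions above 1/2 at one fixed t > 0 *)
    have "eventually (\<lambda>N. (SUP n\<in>{1..}. ?p N n) < 1 / 8) at_top"
      using bdd unfolding bounded_in_probability_def by (rule order_tendstoD(2)) simp
    from eventually_happens'[OF _ eventually_conj[OF this eventually_gt_at_top[of 0]]]
    obtain N :: real where N: "(SUP n\<in>{1..}. ?p N n) < 1 / 8" "0 < N" by auto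
    have small: "?p N n \<le> 1 / 8" if "1 \<le> n" for n
    proof -
      have "?p N n \<le> (SUP n\<in>{1..}. ?p N n)"
        using that by (intro cSUP_upper bdd_aboveI[of _ 1]) auto
      then show ?thesis using N(1) by linarith
    qed
    define t where "t = 1 / (4 * N)"
    have t: "0 < t" using N(2) by (simp add: t_def)
    define c where "c = 2 * ln 2 / t\<^sup>2"
    have "truncated_variance h K \<le> c" if K: "0 < K" for K
    proof -
      let ?v = "truncated_variance h K"
      have "1 / 2 \<le> exp (- (t\<^sup>2 * ?v / 2))"
      proof (rule field_le_epsilon)
        fix e :: real assume e: "0 < e"
        from eventually_happens'[OF sequentially_bot
          eventually_conj[OF char_additive_functional_bound[OF irr h K e, of t] eventually_ge_at_top[of 1]]]
        obtain n where n: "cmod (char (distr M borel (?Y n)) t) \<le> exp (- (t\<^sup>2 * ?v / 2)) + e" "1 \<le> n"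
          by blast
        have "1 / 2 \<le> cmod (char (distr M borel (?Y n)) t)"
          unfolding t_def using small[OF n(2)] by (intro M.char_ge_half N(2)) auto
        with n(1) show "1 / 2 \<le> exp (- (t\<^sup>2 * ?v / 2)) + e" by (rule order_trans[rotated])
      qed
      then have "ln (1 / 2) \<le> ln (exp (- (t\<^sup>2 * ?v / 2)))" by (subst ln_le_cancel_iff) auto
      then have "t\<^sup>2 * ?v \<le> 2 * ln 2" by (simp add: ln_div)
      then show ?thesis using t by (simp add: c_def pos_le_divide_eq mult.commute)
    qed
    from holding_variance_le[OF hm h(1) this]
    show fin: "?V < \<infinity>" by (rule order.strict_trans1) auto
    show "(\<lambda>n. of_nat n * (\<integral>\<^sup>+\<omega>. ennreal ((h (X 0 \<omega>))\<^sup>2 * holding_prob P (X 0 \<omega>) ^ n) \<partial>M)) \<longlonglongrightarrow> 0"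
      by (rule holding_moment_limit[OF hm fin zero])
  next
    fix \<sigma>2 :: real
    assume a: "0 \<le> \<sigma>2 \<and> weak_conv_m (\<lambda>n. distr M borel (?Y n)) (normal_law 0 \<sigma>2)"
    have "(\<lambda>n. char (distr M borel (?Y n)) 1) \<longlonglongrightarrow> char (normal_law 0 \<sigma>2) 1"
    proof (rule levy_continuity1)
      show "real_distribution (distr M borel (?Y n))" for n
        by (rule M.real_distribution_distr) measurable
    qed (use a in \<open>auto intro: real_distribution_normal_law\<close>)
    then have lim: "(\<lambda>n. cmod (char (distr M borel (?Y n)) 1)) \<longlonglongrightarrow> exp (- (\<sigma>2 / 2))"
      using a tendsto_norm[of "\<lambda>n. char (distr M borel (?Y n)) 1" "char (normal_law 0 \<sigma>2) 1" sequentially]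
      by (simp add: char_normal_law)
    have "truncated_variance h K \<le> \<sigma>2" if K: "0 < K" for K
    proof -
      let ?v = "truncated_variance h K"
      have "exp (- (\<sigma>2 / 2)) \<le> exp (- (?v / 2))"
      proof (rule field_le_epsilon)
        fix e :: real assume e: "0 < e"
        have "eventually (\<lambda>n. cmod (char (distr M borel (?Y n)) 1) \<le> exp (- (?v / 2)) + e) sequentially"
          using char_additive_functional_bound[OF irr h K e, of 1] by simp
        then show "exp (- (\<sigma>2 / 2)) \<le> exp (- (?v / 2)) + e"
          by (intro tendsto_upperbound[OF lim]) auto
      qed
      then show ?thesis by simp
    qed
    then show "?V \<le> ennreal \<sigma>2" by (rule holding_variance_le[OF hm h(1)])
  qed
qed

end
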